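(* Let $k\ge 3$ be an integer, let $\gamma\subset\mathbb{R}^2$ be a $C^2$-smooth, planar, strictly convex closed curve, and let $K$ be its interior. Assume that $K$ is invariant under a linear map $A$ of order $k$. Define $$a=\begin{cases}1, & k\equiv 2 \pmod 4,\\ 2, & k\equiv 0\pmod 4,\\ 4, & k\equiv 1\pmod 2.\end{cases}$$ If the Minkowski billiard map in $K$, with the norm induced by $K$, has a rotational invariant curve of $k$-periodic orbits, then $K$ is invariant under a linear map of order $ak$ which commutes with $A$. Moreover, this condition is sufficient for the existence of rotational invariant curves of all rotation numbers $\frac{r}{k}$ with $r$ coprime to $k$: if $K$ is invariant under a linear map of order $ak$ which commutes with $A$, then for every integer $0<r<k$ coprime to $k$ the Minkowski billiard map in $K$, with the norm induced by $K$, has a rotational invariant curve of $k$-periodic orbits of rotation number $\frac{r}{k}$.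
   Context: A linear map $A$ has order $k$ if $k$ is the least positive integer with $A^k=I$; $K$ is invariant under $A$ if $A(K)=K$. The norm (not necessarily symmetric) induced by $K$ is the gauge function $g_K(x)=\inf\{r>0 : x\in rK\}$. Minkowski billiard map in $K$ with the norm induced by $K$: parametrize $\gamma$ counterclockwise so that $g_K(\dot\gamma(t))=1$. The map $T$ is the twist map of the phase cylinder (oriented chords of $\gamma$, i.e. ordered pairs of distinct points $\gamma(t),\gamma(t_1)$) with generating function $L(t,t_1)=g_K(\gamma(t_1)-\gamma(t))$, i.e. $T(t,s)=(t_1,s_1)$ iff $s=-\partial L/\partial t\,(t,t_1)$ and $s_1=\partial L/\partial t_1\,(t,t_1)$. Equivalently, $\gamma(t_0),\gamma(t_1),\gamma(t_2)$ are consecutive bounce points iff $t_1$ is a critical point of $\tau\mapsto L(t_0,\tau)+L(\tau,t_2)$. A rotational invariant curve is a simple closed curve in the phase cylinder, homotopically non-trivial (winding once around the cylinder), that is mapped to itself by $T$. Its rotation number is the rotation number of the circle map $T$ induces on it, where one full turn around $\gamma$ counts as $1$ and each step advances the base point by a positive amount less than one turn. It is a rotational invariant curve of $k$-periodic orbits if all its points are periodic for $T$ with (minimal) period $k$; its rotation number is then of the form $r/k$ with $r$ coprime to $k$. *)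

theory Defs
  imports "HOL-Analysis.Analysis"
begin

definition map_order :: "('a \<Rightarrow> 'a) \<Rightarrow> nat \<Rightarrow> bool" where
  "map_order A k \<longleftrightarrow> 0 < k \<and> A ^^ k = id \<and> (\<forall>j. 0 < j \<and> j < k \<longrightarrow> A ^^ j \<noteq> id)"

definition gauge_fun :: "'a::real_vector set \<Rightarrow> 'a \<Rightarrow> real" where
  "gauge_fun K x = Inf {r. 0 < r \<and> x \<in> (\<lambda>y. r *\<^sub>R y) ` K}"

definition strictly_convex_set :: "'a::real_normed_vector set \<Rightarrow> bool" where
  "strictly_convex_set K \<longleftrightarrow> convex K \<and>
     (\<forall>x\<in>closure K. \<forall>y\<in>closure K. x \<noteq> y \<longrightarrow> open_segment x y \<subseteq> interior K)"

text \<open>Regular \<open>C\<^sup>2\<close> parametrizations, of period \<open>P\<close>, of simple closed curves.\<close>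

definition C2_closed_curve :: "(real \<Rightarrow> real^2) \<Rightarrow> real \<Rightarrow> bool" where
  "C2_closed_curve \<gamma> P \<longleftrightarrow> 0 < P \<and> (\<forall>t. \<gamma> (t + P) = \<gamma> t) \<and> inj_on \<gamma> {0..<P} \<and>
     (\<exists>\<gamma>' \<gamma>''. (\<forall>t. (\<gamma> has_vector_derivative \<gamma>' t) (at t)) \<and>
              (\<forall>t. (\<gamma>' has_vector_derivative \<gamma>'' t) (at t)) \<and>
              continuous_on UNIV \<gamma>'' \<and> (\<forall>t. \<gamma>' t \<noteq> 0))"

definition strictly_convex_C2_curve :: "(real \<Rightarrow> real^2) \<Rightarrow> real \<Rightarrow> bool" where
  "strictly_convex_C2_curve \<gamma> P \<longleftrightarrow>
     C2_closed_curve \<gamma> P \<and> strictly_convex_set (inside (range \<gamma>))"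

definition cross2 :: "real^2 \<Rightarrow> real^2 \<Rightarrow> real" where
  "cross2 u v = u $ 1 * v $ 2 - u $ 2 * v $ 1"

text \<open>Counterclockwise parametrizations of the boundary of a convex domain \<open>K\<close> with unit speed
  in the gauge of \<open>K\<close>. Counterclockwise means that \<open>K\<close> lies to the left of every tangent line.
  Such a parametrization is unique up to a shift of the parameter.\<close>

definition unit_gauge_param :: "(real^2) set \<Rightarrow> (real \<Rightarrow> real^2) \<Rightarrow> real \<Rightarrow> bool" where
  "unit_gauge_param K \<gamma> P \<longleftrightarrow> C2_closed_curve \<gamma> P \<and> range \<gamma> = frontier K \<and>
     (\<forall>t. gauge_fun K (vector_derivative \<gamma> (at t)) = 1) \<and>
     (\<forall>t. \<forall>x\<in>K. 0 < cross2 (vector_derivative \<gamma> (at t)) (x - \<gamma> t))"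

definition gen_fun :: "(real^2) set \<Rightarrow> (real \<Rightarrow> real^2) \<Rightarrow> real \<Rightarrow> real \<Rightarrow> real" where
  "gen_fun K \<gamma> t t1 = gauge_fun K (\<gamma> t1 - \<gamma> t)"

text \<open>The phase cylinder in the coordinates \<open>(t, s)\<close>, where the circle of parameters \<open>t\<close> modulo
  the period is realized as the curve itself, i.e. \<open>t\<close> is recorded as the point \<open>\<gamma> t\<close>. The
  oriented chord from \<open>\<gamma> t\<close> to \<open>\<gamma> t1\<close> is the point with \<open>s = - \<partial>L/\<partial>t (t, t1)\<close>.\<close>

definition phase_cylinder :: "(real^2) set \<Rightarrow> (real \<Rightarrow> real^2) \<Rightarrow> ((real^2) \<times> real) set" where
  "phase_cylinder K \<gamma> = {(\<gamma> t, s) | t s. \<exists>t1. \<gamma> t1 \<noteq> \<gamma> t \<and>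
     ((\<lambda>u. gen_fun K \<gamma> u t1) has_real_derivative - s) (at t)}"

definition billiard_rel ::
  "(real^2) set \<Rightarrow> (real \<Rightarrow> real^2) \<Rightarrow> (real^2) \<times> real \<Rightarrow> (real^2) \<times> real \<Rightarrow> bool" where
  "billiard_rel K \<gamma> x y \<longleftrightarrow> (\<exists>t s t1 s1. x = (\<gamma> t, s) \<and> y = (\<gamma> t1, s1) \<and> \<gamma> t1 \<noteq> \<gamma> t \<and>
     ((\<lambda>u. gen_fun K \<gamma> u t1) has_real_derivative - s) (at t) \<and>
     ((\<lambda>u. gen_fun K \<gamma> t u) has_real_derivative s1) (at t1))"

definition billiard_map ::
  "(real^2) set \<Rightarrow> (real \<Rightarrow> real^2) \<Rightarrow> (real^2) \<times> real \<Rightarrow> (real^2) \<times> real" where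
  "billiard_map K \<gamma> x = (THE y. billiard_rel K \<gamma> x y)"

definition rotational_invariant_curve ::
  "(real^2) set \<Rightarrow> (real \<Rightarrow> real^2) \<Rightarrow> ((real^2) \<times> real) set \<Rightarrow> bool" where
  "rotational_invariant_curve K \<gamma> C \<longleftrightarrow>
     (\<exists>c. simple_path c \<and> pathfinish c = pathstart c \<and> path_image c = C \<and>
          C \<subseteq> phase_cylinder K \<gamma> \<and>
          \<not> (\<exists>a. homotopic_loops (phase_cylinder K \<gamma>) c (linepath a a))) \<and>
     billiard_map K \<gamma> ` C = C"

text \<open>The rotation number is computed from the base points \<open>\<gamma> (t n)\<close> of the orbits on the
  curve, lifted to the real line so that each step advances by less than one turn.\<close>

definition has_rotation_number ::
  "(real^2) set \<Rightarrow> (real \<Rightarrow> real^2) \<Rightarrow> real \<Rightarrow> ((real^2) \<times> real) set \<Rightarrow> real \<Rightarrow> bool" where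
  "has_rotation_number K \<gamma> P C \<rho> \<longleftrightarrow>
     (\<forall>x\<in>C. \<exists>t :: nat \<Rightarrow> real.
        (\<forall>n. \<gamma> (t n) = fst ((billiard_map K \<gamma> ^^ n) x) \<and> t n < t (Suc n) \<and> t (Suc n) < t n + P) \<and>
        (\<lambda>n. (t n - t 0) / (real n * P)) \<longlonglongrightarrow> \<rho>)"

definition curve_of_periodic_orbits ::
  "(real^2) set \<Rightarrow> (real \<Rightarrow> real^2) \<Rightarrow> nat \<Rightarrow> ((real^2) \<times> real) set \<Rightarrow> bool" where
  "curve_of_periodic_orbits K \<gamma> k C \<longleftrightarrow> rotational_invariant_curve K \<gamma> C \<and>
     (\<forall>x\<in>C. 0 < k \<and> (billiard_map K \<gamma> ^^ k) x = x \<and>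
        (\<forall>j. 0 < j \<and> j < k \<longrightarrow> (billiard_map K \<gamma> ^^ j) x \<noteq> x))"

definition has_periodic_curve :: "(real^2) set \<Rightarrow> nat \<Rightarrow> bool" where
  "has_periodic_curve K k \<longleftrightarrow>
     (\<exists>\<gamma> P C. unit_gauge_param K \<gamma> P \<and> curve_of_periodic_orbits K \<gamma> k C)"

definition has_periodic_curve_rot :: "(real^2) set \<Rightarrow> nat \<Rightarrow> real \<Rightarrow> bool" where
  "has_periodic_curve_rot K k \<rho> \<longleftrightarrow>
     (\<exists>\<gamma> P C. unit_gauge_param K \<gamma> P \<and> curve_of_periodic_orbits K \<gamma> k C \<and>
              has_rotation_number K \<gamma> P C \<rho>)"

end

theory Submission
  imports Defs
begin

text \<open>The generating function \<open>L(t, u) = g (\<gamma> u - \<gamma> t)\<close> is differentiable off the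
diagonal because the gauge \<open>g\<close> is, with a gradient that is read off the support lines of
\<open>K\<close>. Its partial derivatives give the momentum \<open>dep t u\<close> with which the chord leaves
\<open>\<gamma> t\<close> and the momentum \<open>arr t u\<close> with which it arrives at \<open>\<gamma>
u\<close>. Strict convexity is the twist condition: the former decreases strictly in \<open>u\<close>, the
latter increases strictly in \<open>t\<close> (\<open>dep_decreasing\<close>, \<open>arr_increasing\<close>).
Orbits are the sequences of parameters \<open>y\<close> with \<open>arr (y j) (y (j+1)) = dep (y (j+1)) (y
(j+2))\<close>, and two periodic ones with the same rotation, one of them below the other, are equal as soon
as they touch (\<open>touching_orbits_eq\<close>).

A linear map of finite order \<open>k \<ge> 3\<close> of the plane is multiplication by a complex number for a
suitable complex structure. The maps commuting with it are multiplications as well, and those that preserve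
\<open>K\<close> shift the unit speed parameter of the boundary. Some power of \<open>A\<close> is the shift
by one \<open>k\<close>-th of the period.

Necessity. The orbits on an invariant curve of \<open>k\<close>-periodic points, lifted to the line, form a
continuous one-parameter family of sequences with \<open>x (j+k) = x j + r P\<close>. The family is unbounded
above and below because the curve is essential. Sweeping it across any sequence \<open>y\<close> of the same
kind, the first contact is an equality. Hence \<open>y\<close> belongs to the family, and the family is
totally ordered. For an orbit \<open>x\<close> of the family both \<open>x (j+1)\<close> and, by symmetry,
\<open>x j + r P / k\<close> belong to the family, and a strict inequality between them would, after
\<open>k\<close> steps, contradict \<open>x k = x 0 + r P\<close>. So the bounce points are \<open>\<gamma>
t\<close>, \<open>\<eta> \<gamma> t\<close>, \<open>\<eta>\<^sup>2 \<gamma> t\<close>, and so on for a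
primitive \<open>k\<close>-th root of unity \<open>\<eta>\<close>, for all \<open>t\<close>. The gauge length
of the chord from \<open>\<gamma> t\<close> to \<open>\<eta> \<gamma> t\<close> has derivative \<open>arr -
dep\<close>, which vanishes, so it is a constant \<open>\<kappa>\<close>. Therefore multiplication by
\<open>\<sigma> = (\<eta> - 1) / \<kappa>\<close> maps the boundary into itself and \<open>K\<close> onto
itself. As \<open>(\<eta> - 1)\<^sup>2\<close> is a negative multiple of \<open>\<eta>\<close> and no proper
homothety preserves \<open>K\<close>, it follows that \<open>\<sigma>\<^sup>2 = - \<eta>\<close>, and such a
\<open>\<sigma>\<close> has order \<open>2 k\<close> if \<open>4\<close> divides \<open>k\<close> and \<open>4
k\<close> if \<open>k\<close> is odd. For \<open>k mod 4 = 2\<close> the map \<open>A\<close> itself has the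
required order.

Sufficiency. All roots of unity of order dividing \<open>a k\<close> are powers of the given symmetry, and
among them is \<open>\<sigma> = (\<eta> - 1) / \<bar>\<eta> - 1\<bar>\<close> for every primitive
\<open>k\<close>-th root of unity \<open>\<eta>\<close>. So the argument above can be read backwards: the
chords from \<open>\<gamma> t\<close> to \<open>\<eta> \<gamma> t\<close> have constant gauge length, arrive
with the momentum with which the next one departs, and form the invariant curve. The unit speed
parametrization itself is obtained by inverting the arc length in the gauge.\<close>

section \<open>Linear maps of finite order as complex numbers\<close>

locale complex_structure =
  fixes J :: "real^2 \<Rightarrow> real^2"
  assumes linear_J: "linear J" and J_J: "J (J x) = - x"
begin

text \<open>The plane as a complex line: multiplication by \<open>z\<close>, with \<open>J\<close> in the role of the
imaginary unit.\<close>

definition act :: "complex \<Rightarrow> real^2 \<Rightarrow> real^2" where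
  "act z x = Re z *\<^sub>R x + Im z *\<^sub>R J x"

lemma act_one [simp]: "act 1 x = x" and act_zero [simp]: "act z 0 = 0" and act_0 [simp]: "act 0 x = 0"
  using linear_0[OF linear_J] by (auto simp: act_def)

lemma act_mult: "act (z * w) x = act z (act w x)"
  using linear_J by (simp add: act_def linear_add linear_scale J_J algebra_simps)

lemma act_diff: "act (z - w) x = act z x - act w x"
  by (simp add: act_def algebra_simps)

lemma act_of_real: "act (of_real c) x = c *\<^sub>R x"
  by (simp add: act_def)

lemma linear_act: "linear (act z)"
  using linear_J by (intro linearI) (auto simp: act_def linear_add linear_scale algebra_simps)

lemma act_eq_0_iff: "act z x = 0 \<longleftrightarrow> z = 0 \<or> x = 0"
proof -
  have "x = 0" if "act z x = 0" "z \<noteq> 0"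
  proof -
    have "act (inverse z) (act z x) = x"
      using \<open>z \<noteq> 0\<close> by (simp flip: act_mult)
    then show ?thesis using that by simp
  qed
  then show ?thesis by auto
qed

lemma act_eq_iff: "act z x = act w x \<longleftrightarrow> z = w \<or> x = 0"
  using act_eq_0_iff[of "z - w" x] by (auto simp: act_diff)

lemma act_funpow: "(act z ^^ n) = act (z ^ n)"
  by (induction n) (auto simp: fun_eq_iff act_mult)

lemma act_eq_id_iff: "act z = id \<longleftrightarrow> z = 1"
proof
  assume "act z = id"
  then have "act z (axis 1 1) = act 1 (axis 1 1)" by simp
  then show "z = 1" unfolding act_eq_iff by (simp add: axis_eq_0_iff)
qed (auto simp: fun_eq_iff)

lemma map_order_act: "map_order (act z) n \<longleftrightarrow> 0 < n \<and> z ^ n = 1 \<and> (\<forall>j. 0 < j \<and> j < n \<longrightarrow> z ^ j \<noteq> 1)"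
  unfolding map_order_def act_funpow act_eq_id_iff by blast

lemma ex_act:
  assumes "e \<noteq> 0"
  shows "\<exists>z. x = act z e"
proof -
  let ?b = "{e, J e}"
  have ne: "J e \<noteq> s *\<^sub>R e" for s
  proof
    assume h: "J e = s *\<^sub>R e"
    then have "act (Complex s (-1)) e = 0" by (simp add: act_def)
    then show False using assms by (simp add: act_eq_0_iff complex_eq_iff)
  qed
  then have "J e \<notin> span {e}" by (auto simp: span_singleton)
  then have "independent (insert (J e) {e})"
    using assms by (simp add: independent_insert)
  moreover have "J e \<noteq> e" using ne[of 1] by simp
  ultimately have "dim {J e, e} = DIM(real^2)"
    by (simp add: dim_eq_card_independent)
  then have "span {J e, e} = UNIV"
    by (simp only: dim_eq_full)
  then have "x \<in> span {J e, e}" by simp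
  then obtain a b where "x = a *\<^sub>R J e + b *\<^sub>R e"
    by (auto simp: span_insert span_singleton algebra_simps)
  then have "x = act (Complex b a) e" by (simp add: act_def)
  then show ?thesis by blast
qed

text \<open>A real linear map that commutes with \<open>J\<close> is complex linear, and the plane is a complex line, so
the map is determined by its value at one vector.\<close>

lemma commutes_imp_act:
  assumes "linear B" and "\<And>x. B (J x) = J (B x)"
  shows "\<exists>z. B = act z"
proof -
  let ?e = "axis 1 1 :: real^2"
  have e: "?e \<noteq> 0" by (simp add: axis_eq_0_iff)
  obtain z where z: "B ?e = act z ?e" using ex_act[OF e] by blast
  have "B x = act z x" for x
  proof -
    obtain w where w: "x = act w ?e" using ex_act[OF e] by blast
    have "B x = act w (B ?e)"
      unfolding w using assms by (simp add: act_def linear_add linear_scale)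
    also have "\<dots> = act z x" unfolding z w by (simp flip: act_mult add: mult.commute)
    finally show ?thesis .
  qed
  then show ?thesis by blast
qed

text \<open>\<open>J\<^sup>2 = -1\<close> forces trace \<open>0\<close>: otherwise both off-diagonal entries vanish and a
real number would have square \<open>-1\<close>. With trace \<open>0\<close> the relation \<open>J\<^sup>2 =
-1\<close> says that the determinant is \<open>1\<close>.\<close>

lemma cross2_J: "cross2 (J x) (J y) = cross2 x y"
proof -
  define a b c d where "a = J (axis 1 1) $ 1" and "b = J (axis 2 1) $ 1"
    and "c = J (axis 1 1) $ 2" and "d = J (axis 2 1) $ 2"
  have J: "J x $ 1 = a * x $ 1 + b * x $ 2 \<and> J x $ 2 = c * x $ 1 + d * x $ 2" for x
  proof -
    have "x = x $ 1 *\<^sub>R axis 1 1 + x $ 2 *\<^sub>R axis 2 1"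
      by (simp add: vec_eq_iff forall_2 axis_def)
    from arg_cong[OF this, of J] have "J x = x $ 1 *\<^sub>R J (axis 1 1) + x $ 2 *\<^sub>R J (axis 2 1)"
      by (simp add: linear_add[OF linear_J] linear_scale[OF linear_J])
    then show ?thesis by (simp add: a_def b_def c_def d_def)
  qed
  have "J (J x) $ 1 = (a*a+b*c) * x$1 + (b*(a+d)) * x$2" "J (J x) $ 2 = (c*(a+d)) * x$1 + (d*d+b*c) * x$2" for x
    by (simp_all add: J algebra_simps)
  from this[of "axis 1 1"] this[of "axis 2 1"]
  have 1: "a*a+b*c = -1" "b*(a+d) = 0" "c*(a+d) = 0" "d*d+b*c=-1"
    by (simp_all add: J_J axis_def)
  have "a * d - b * c = 1"
  proof (cases "a + d = 0")
    case True
    then show ?thesis using 1 by algebra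
  next
    case False
    then have "a * a = -1" using 1 by auto
    then show ?thesis by (metis not_square_less_zero zero_less_one neg_less_0_iff_less)
  qed
  moreover have "cross2 (J x) (J y) = (a * d - b * c) * cross2 x y"
    by (simp add: cross2_def J algebra_simps)
  ultimately show ?thesis by simp
qed

lemma cross2_act: "cross2 (act z x) (act z y) = (cmod z)\<^sup>2 * cross2 x y"
proof -
  have "cross2 (J x) y = cross2 (J (J x)) (J y)" by (simp add: cross2_J)
  also have "\<dots> = - cross2 x (J y)" by (simp add: J_J cross2_def)
  finally have *: "cross2 (J x) y = - cross2 x (J y)" .
  have "cross2 (act z x) (act z y) = (Re z)^2 * cross2 x y + (Im z)^2 * cross2 (J x) (J y)
      + Re z * Im z * (cross2 x (J y) + cross2 (J x) y)"
    by (simp add: act_def cross2_def power2_eq_square algebra_simps)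
  then show ?thesis by (simp add: cross2_J * cmod_power2 algebra_simps)
qed

end

text \<open>By Cayley and Hamilton \<open>A\<^sup>2 = T A - D\<close> with trace \<open>T\<close> and determinant
\<open>D\<close>. A real eigenvalue is a root of unity, hence \<open>1\<close> or \<open>-1\<close>; if both
eigenvalues were real, they would be opposite, or equal, in which case the nilpotent part of \<open>A\<close>
would make the powers of \<open>A\<close> grow linearly. Either way \<open>A\<^sup>2 = 1\<close>, against
\<open>k \<ge> 3\<close>. So \<open>T\<^sup>2 < 4 D\<close> and \<open>D = 1\<close>, and the complex
structure is the traceless part of \<open>A\<close>, scaled.\<close>

lemma finite_order_imp_act:
  fixes A :: "real^2 \<Rightarrow> real^2"
  assumes A: "linear A" and k: "k \<ge> 3" and ord: "map_order A k"
  obtains J \<zeta> where "complex_structure J" and "A = complex_structure.act J \<zeta>"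
    and "\<And>B. \<lbrakk>linear B; A \<circ> B = B \<circ> A\<rbrakk> \<Longrightarrow> \<exists>\<beta>. B = complex_structure.act J \<beta>"
proof -
  define a b c d where "a = A (axis 1 1) $ 1" and "b = A (axis 2 1) $ 1"
    and "c = A (axis 1 1) $ 2" and "d = A (axis 2 1) $ 2"
  have Ax: "A x $ 1 = a * x $ 1 + b * x $ 2 \<and> A x $ 2 = c * x $ 1 + d * x $ 2" for x
  proof -
    have "x = x $ 1 *\<^sub>R axis 1 1 + x $ 2 *\<^sub>R axis 2 1"
      by (simp add: vec_eq_iff forall_2 axis_def)
    from arg_cong[OF this, of A] have "A x = x $ 1 *\<^sub>R A (axis 1 1) + x $ 2 *\<^sub>R A (axis 2 1)"
      by (simp add: linear_add[OF A] linear_scale[OF A])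
    then show ?thesis by (simp add: a_def b_def c_def d_def)
  qed
  have Ak: "(A ^^ k) x = x" for x using ord by (simp add: map_order_def)
  have A2: "\<exists>x. A (A x) \<noteq> x"
  proof -
    have "A ^^ 2 \<noteq> id" using ord k unfolding map_order_def by auto
    then show ?thesis by (auto simp: fun_eq_iff numeral_2_eq_2)
  qed
  define T D where "T = a + d" and "D = a * d - b * c"
  have CH: "A (A x) = T *\<^sub>R A x - D *\<^sub>R x" for x
    by (simp add: vec_eq_iff forall_2 Ax T_def D_def algebra_simps)
  have eig: "l\<^sup>2 = 1 \<and> l ^ k = 1" if "l * l - T * l + D = 0" for l
  proof -
    have det: "(a - l) * (d - l) = b * c" using that unfolding T_def D_def by algebra
    obtain v where v: "v \<noteq> 0" "A v = l *\<^sub>R v"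
    proof (cases "b = 0 \<and> l = a")
      case False
      let ?v = "vector [b, l - a] :: real^2"
      have "?v \<noteq> 0" using False by (auto simp: vec_eq_iff forall_2)
      moreover have "A ?v = l *\<^sub>R ?v"
        using det by (simp add: vec_eq_iff forall_2 Ax algebra_simps)
      ultimately show ?thesis by (rule that)
    next
      case t: True
      show ?thesis
      proof (cases "c = 0 \<and> l = d")
        case False
        let ?v = "vector [l - d, c] :: real^2"
        have "?v \<noteq> 0" using False by (auto simp: vec_eq_iff forall_2)
        moreover have "A ?v = l *\<^sub>R ?v"
          using det by (simp add: vec_eq_iff forall_2 Ax algebra_simps)
        ultimately show ?thesis by (rule that)
      next
        case True
        have "A (axis 1 1) = l *\<^sub>R axis 1 1"
          using t True by (simp add: vec_eq_iff forall_2 Ax axis_def)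
        then show ?thesis by (intro that[of "axis 1 1"]) (simp_all add: axis_eq_0_iff)
      qed
    qed
    have "(A ^^ n) v = l ^ n *\<^sub>R v" for n
      by (induction n) (simp_all add: v linear_scale[OF A])
    then have "l ^ k *\<^sub>R v = 1 *\<^sub>R v" using Ak[of v] by simp
    then have lk: "l ^ k = 1" using v by (metis scaleR_right_imp_eq)
    then have "\<bar>l\<bar> = 1" using k power_eq_1_iff[of l k] by simp
    then show ?thesis using lk by (metis power2_abs power_one)
  qed
  have disc: "T\<^sup>2 < 4 * D"
  proof (rule ccontr)
    assume "\<not> T\<^sup>2 < 4 * D"
    define s where "s = sqrt (T\<^sup>2 - 4 * D)"
    have s: "s\<^sup>2 = T\<^sup>2 - 4 * D" using \<open>\<not> T\<^sup>2 < 4 * D\<close> by (simp add: s_def)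
    define l m where "l = (T + s) / 2" and "m = (T - s) / 2"
    have T: "T = l + m" and "l * m = (T\<^sup>2 - s\<^sup>2)/4"
      by (simp_all add: l_def m_def power2_eq_square field_simps)
    then have D: "D = l * m" using s by simp
    have lk: "l\<^sup>2 = 1" "m\<^sup>2 = 1" "l ^ k = 1" using eig[of l] eig[of m] by (simp_all add: T D algebra_simps)
    then consider "m = - l" | "m = l" by (metis power2_eq_iff minus_minus)
    then have "A (A x) = x" for x
    proof cases
      case 1
      then show ?thesis using CH[of x] T D \<open>l\<^sup>2 = 1\<close> by (simp add: power2_eq_square)
    next
      case 2
      have ll: "l * l = 1" using \<open>l\<^sup>2 = 1\<close> by (simp add: power2_eq_square)
      have CH': "A (A x) = (2 * l) *\<^sub>R A x - x" for x
        using CH[of x] T D 2 ll by simp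
      \<comment> \<open>The binomial formula for \<open>A = l + (A - l)\<close> with \<open>(A - l)\<^sup>2 = 0\<close>, using \<open>l\<^sup>2 = 1\<close>.\<close>
      have "(A ^^ n) x = l ^ n *\<^sub>R x + (of_nat n * l ^ (Suc n)) *\<^sub>R (A x - l *\<^sub>R x)" for n
      proof (induction n)
        case (Suc n)
        have lp: "l ^ Suc (Suc n) = l ^ n" by (simp add: mult.assoc[symmetric] ll)
        have "(A ^^ Suc n) x = l ^ n *\<^sub>R A x + (of_nat n * l ^ (Suc n)) *\<^sub>R (A (A x) - l *\<^sub>R A x)"
          by (simp add: Suc linear_add[OF A] linear_scale[OF A] linear_diff[OF A])
        also have "A (A x) - l *\<^sub>R A x = l *\<^sub>R (A x - l *\<^sub>R x)"
        proof -
          have "l * (l * c) = c" for c using ll by (simp flip: mult.assoc)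
          then show ?thesis unfolding CH' vec_eq_iff by (simp add: right_diff_distrib)
        qed
        also have "l ^ n *\<^sub>R A x = l ^ Suc n *\<^sub>R x + l ^ Suc (Suc n) *\<^sub>R (A x - l *\<^sub>R x)"
          unfolding lp by (simp add: scaleR_diff_right mult.commute)
        finally show ?case by (simp add: algebra_simps)
      qed simp
      from this[of k] have "x = l ^ k *\<^sub>R x + (of_nat k * l ^ Suc k) *\<^sub>R (A x - l *\<^sub>R x)"
        using Ak by simp
      then have "(of_nat k * l) *\<^sub>R (A x - l *\<^sub>R x) = 0" using lk by simp
      moreover have "of_nat k * l \<noteq> 0" using k lk by auto
      ultimately have "A x = l *\<^sub>R x" by simp
      then show ?thesis by (simp add: linear_scale[OF A] ll)
    qed
    then show False using A2 by blast
  qed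
  define s where "s = sqrt (4 * D - T\<^sup>2)"
  have s: "s > 0" "s\<^sup>2 = 4 * D - T\<^sup>2" using disc by (simp_all add: s_def)
  have "D ^ k = 1"
  proof -
    have "cross2 (A x) (A y) = D * cross2 x y" for x y
      by (simp add: cross2_def Ax D_def algebra_simps)
    then have "cross2 ((A ^^ n) x) ((A ^^ n) y) = D ^ n * cross2 x y" for n x y
      by (induction n) (simp_all del: mult_cancel_left)
    from this[of k "axis 1 1" "axis 2 1"] show ?thesis by (simp add: Ak cross2_def axis_def)
  qed
  moreover have "D > 0" using disc by (smt (verit) zero_le_power2)
  ultimately have D1: "D = 1" using k power_eq_1_iff[of D k] by simp
  \<comment> \<open>The solution of \<open>A = T / 2 + (s / 2) J\<close>.\<close>
  define J where "J = (\<lambda>x. (2 / s) *\<^sub>R A x - (T / s) *\<^sub>R x)"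
  interpret complex_structure J
  proof (rule complex_structure.intro)
    show "linear J" unfolding J_def using A
      by (intro linearI) (auto simp: linear_add linear_scale algebra_simps)
  next
    fix x
    have "J (J x) = (4 / s\<^sup>2) *\<^sub>R A (A x) - (4 * T / s\<^sup>2) *\<^sub>R A x
      + (T\<^sup>2 / s\<^sup>2) *\<^sub>R x"
      unfolding J_def using s
      by (simp add: linear_diff[OF A] linear_scale[OF A] vec_eq_iff power2_eq_square field_simps)
    also have "\<dots> = ((T\<^sup>2 - 4 * D) / s\<^sup>2) *\<^sub>R x"
      unfolding CH using s by (simp add: vec_eq_iff field_simps power2_eq_square)
    also have "(T\<^sup>2 - 4 * D) / s\<^sup>2 = -1" using s by (simp add: field_simps)
    finally show "J (J x) = - x" by simp
  qed
  show ?thesis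
  proof (rule that)
    show "complex_structure J" by (rule complex_structure_axioms)
    show "A = act (Complex (T/2) (s/2))"
      unfolding fun_eq_iff act_def vec_eq_iff using s by (simp add: J_def field_simps)
    fix B :: "real^2 \<Rightarrow> real^2" assume B: "linear B" "A \<circ> B = B \<circ> A"
    then have "B (J x) = J (B x)" for x
      by (simp add: J_def linear_diff linear_scale fun_eq_iff)
    then show "\<exists>\<beta>. B = act \<beta>" using commutes_imp_act B by blast
  qed
qed

section \<open>Roots of unity\<close>

definition is_primitive_root :: "nat \<Rightarrow> complex \<Rightarrow> bool" where
  "is_primitive_root k z \<longleftrightarrow> 0 < k \<and> z ^ k = 1 \<and> (\<forall>j. 0 < j \<and> j < k \<longrightarrow> z ^ j \<noteq> 1)"

text \<open>The powers of a primitive root are \<open>n\<close> distinct solutions of an equation that has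
\<open>n\<close> solutions.\<close>

lemma primitive_root_powers:
  assumes \<beta>: "is_primitive_root n \<beta>" and "z ^ n = 1"
  obtains i where "z = \<beta> ^ i"
proof -
  have n: "0 < n" "\<beta> ^ n = 1" "\<And>j. 0 < j \<Longrightarrow> j < n \<Longrightarrow> \<beta> ^ j \<noteq> 1" using \<beta> by (auto simp: is_primitive_root_def)
  then have "\<beta> \<noteq> 0" by (auto simp: power_0_left)
  have ne: "\<beta> ^ i \<noteq> \<beta> ^ j" if "i < j" "j < n" for i j
  proof
    assume "\<beta> ^ i = \<beta> ^ j"
    also have "\<dots> = \<beta> ^ i * \<beta> ^ (j - i)" using that by (simp flip: power_add)
    finally have "\<beta> ^ (j - i) = 1" using \<open>\<beta> \<noteq> 0\<close> by simp
    then show False using n(3)[of "j - i"] that by simp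
  qed
  then have "inj_on (\<lambda>i. \<beta> ^ i) {..<n}" by (intro linorder_inj_onI') (metis lessThan_iff)
  then have "card ((\<lambda>i. \<beta> ^ i) ` {..<n}) = card {z::complex. z ^ n = 1}"
    by (simp add: card_image card_roots_unity_eq[OF n(1)])
  moreover have "(\<lambda>i. \<beta> ^ i) ` {..<n} \<subseteq> {z. z ^ n = 1}"
    using n(2) by (auto simp: power_mult[symmetric] mult.commute[of _ n]) (simp add: power_mult)
  moreover have "finite {z::complex. z ^ n = 1}" by (rule card_ge_0_finite) (simp add: card_roots_unity_eq[OF n(1)] n(1))
  ultimately have "(\<lambda>i. \<beta> ^ i) ` {..<n} = {z. z ^ n = 1}" by (metis card_subset_eq)
  then show ?thesis using that assms(2) by blast
qed

lemma root_of_unity_minus_one_square: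
  fixes \<eta> :: complex
  assumes "norm \<eta> = 1"
  shows "(\<eta> - 1)\<^sup>2 = - \<eta> * of_real ((norm (\<eta> - 1))\<^sup>2)"
proof -
  have "\<eta> * cnj \<eta> = 1" using assms by (simp add: complex_norm_square[symmetric])
  then have "(\<eta> - 1)\<^sup>2 = - \<eta> * ((\<eta> - 1) * cnj (\<eta> - 1))" by (simp add: power2_eq_square algebra_simps)
  also have "(\<eta> - 1) * cnj (\<eta> - 1) = of_real ((norm (\<eta> - 1))\<^sup>2)" by (simp only: complex_norm_square)
  finally show ?thesis .
qed

text \<open>This number theory fixes the value of \<open>a\<close>. If \<open>\<sigma> ^ j = 1\<close>, squaring gives
\<open>(- \<eta>) ^ j = 1\<close>, so \<open>k\<close> divides \<open>2 j\<close> and parity considerations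
leave only the multiples of \<open>k\<close>. What excludes the proper divisors of \<open>a k\<close> is
\<open>\<sigma> ^ (2 k) = (- \<eta>) ^ k = - 1\<close> for odd \<open>k\<close>, and \<open>\<sigma> ^ k = (-
\<eta>) ^ (k / 2) = - 1\<close> if \<open>4\<close> divides \<open>k\<close>.\<close>

lemma half_order_root:
  assumes \<eta>: "is_primitive_root k \<eta>" and "3 \<le> k" and \<sigma>: "\<sigma>\<^sup>2 = - \<eta>" and "k mod 4 \<noteq> 2"
    and a: "a = (if k mod 4 = 2 then 1 else if k mod 4 = 0 then 2 else 4)"
  shows "is_primitive_root (a * k) \<sigma>"
proof -
  have \<eta>_eq_1: "\<eta> ^ j = 1 \<longleftrightarrow> k dvd j" for j
  proof -
    have "\<eta> ^ j = \<eta> ^ (k * (j div k) + j mod k)" by simp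
    also have "\<dots> = \<eta> ^ (j mod k)" using \<eta> unfolding power_add power_mult by (simp add: is_primitive_root_def)
    finally have "\<eta> ^ j = 1 \<longleftrightarrow> j mod k = 0"
      using \<eta> unfolding is_primitive_root_def by (metis mod_less_divisor neq0_conv power_0)
    then show ?thesis by (simp add: dvd_eq_mod_eq_0)
  qed
  have \<sigma>_even: "\<sigma> ^ (2 * j) = (- 1) ^ j * \<eta> ^ j" for j
    unfolding power_mult \<sigma> by (metis mult_minus1 power_mult_distrib)
  have \<sigma>1: "k dvd 2 * j" if "\<sigma> ^ j = 1" for j
  proof -
    have "\<eta> ^ (2 * j) = \<sigma> ^ (2 * (2 * j))" unfolding \<sigma>_even by simp
    also have "\<dots> = (\<sigma> ^ j) ^ 4" by (simp flip: power_mult add: mult.commute)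
    also have "\<dots> = 1" using that by simp
    finally show ?thesis using \<eta>_eq_1 by blast
  qed
  have "odd k \<or> 4 dvd k" using \<open>k mod 4 \<noteq> 2\<close> by presburger
  then consider (odd) "odd k" | (four) "4 dvd k" by blast
  then show ?thesis
  proof cases
    case odd
    then have a4: "a = 4" using \<open>k mod 4 \<noteq> 2\<close> unfolding a by presburger
    have "\<sigma> ^ (4 * k) = 1" using \<sigma>_even[of "2 * k"] \<eta>_eq_1[of "2 * k"] by simp
    moreover have "\<sigma> ^ j \<noteq> 1" if j: "0 < j" "j < 4 * k" for j
    proof
      assume 1: "\<sigma> ^ j = 1"
      have "k dvd j" using \<sigma>1[OF 1] odd by (simp add: coprime_dvd_mult_right_iff)
      then have "\<eta> ^ j = 1" by (simp add: \<eta>_eq_1)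
      moreover have "\<sigma> ^ (2 * j) = 1" using 1 by (simp add: mult.commute power_mult)
      ultimately have "even j" using \<sigma>_even[of j] by (cases "even j") simp_all
      obtain i where i: "j = k * i" using \<open>k dvd j\<close> by blast
      then have "even i" "0 < i" "i < 4" using \<open>even j\<close> odd j by auto
      then have "i = 2" by presburger
      then have "\<sigma> ^ j = (- 1) ^ k * \<eta> ^ k" using \<sigma>_even[of k] i by (simp add: mult.commute)
      then show False using 1 odd \<eta>_eq_1[of k] by simp
    qed
    ultimately show ?thesis using a4 \<open>3 \<le> k\<close> by (simp add: is_primitive_root_def)
  next
    case four
    then have a2: "a = 2" unfolding a by presburger
    obtain h where h: "k = 4 * h" "0 < h" using four \<open>3 \<le> k\<close> by (auto elim: dvdE)
    have "\<eta> ^ (2 * h) = - 1"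
    proof -
      have "(\<eta> ^ (2 * h))\<^sup>2 = 1" using \<eta>_eq_1[of k] h by (simp flip: power_mult add: mult.commute)
      moreover have "\<eta> ^ (2 * h) \<noteq> 1" using \<eta>_eq_1[of "2 * h"] h by (auto dest: dvd_imp_le)
      ultimately show ?thesis by (simp add: power2_eq_1_iff)
    qed
    then have \<sigma>k: "\<sigma> ^ k = - 1" using \<sigma>_even[of "2 * h"] h by simp
    then have "\<sigma> ^ (2 * k) = 1" by (simp add: mult.commute[of 2] power_mult)
    moreover have "\<sigma> ^ j \<noteq> 1" if j: "0 < j" "j < 2 * k" for j
    proof
      assume 1: "\<sigma> ^ j = 1"
      have "k dvd 2 * j" by (rule \<sigma>1[OF 1])
      then obtain m where "2 * j = k * m" by blast
      then have "j = 2 * (h * m)" using h by simp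
      then have "even j" by simp
      have "\<sigma> ^ (2 * j) = 1" using 1 by (simp add: mult.commute power_mult)
      then have "\<eta> ^ j = 1" using \<sigma>_even[of j] \<open>even j\<close> by simp
      then obtain i where "j = k * i" unfolding \<eta>_eq_1 by blast
      then have "j = k" using j by auto
      then show False using 1 \<sigma>k by simp
    qed
    ultimately show ?thesis using a2 \<open>3 \<le> k\<close> by (simp add: is_primitive_root_def)
  qed
qed

text \<open>If \<open>k = 2 h\<close> with \<open>h\<close> odd, then \<open>\<eta> ^ h = - 1\<close> and \<open>\<sigma>
^ k = (- \<eta>) ^ h = 1\<close>, so \<open>a = 1\<close> suffices in this case.\<close>

lemma half_chord_power:
  assumes "3 \<le> k" and \<eta>: "is_primitive_root k \<eta>" and \<sigma>: "\<sigma>\<^sup>2 = - \<eta>"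
    and a: "a = (if k mod 4 = 2 then 1 else if k mod 4 = 0 then 2 else 4)"
  shows "\<sigma> ^ (a * k) = 1"
proof (cases "k mod 4 = 2")
  case True
  define h where "h = k div 2"
  have h: "k = 2 * h" "odd h" using True unfolding h_def by presburger+
  have "(\<eta> ^ h)\<^sup>2 = 1" using \<eta> h by (simp add: is_primitive_root_def mult.commute flip: power_mult)
  moreover have "\<eta> ^ h \<noteq> 1" using \<eta> h \<open>3 \<le> k\<close> unfolding is_primitive_root_def by auto
  ultimately have "\<eta> ^ h = - 1" by (simp add: power2_eq_1_iff)
  moreover have "\<sigma> ^ k = (- 1) ^ h * \<eta> ^ h"
    unfolding h(1) power_mult \<sigma> by (metis mult_minus1 power_mult_distrib)
  ultimately show ?thesis using h True a by simp
next
  case False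
  then show ?thesis using half_order_root[OF \<eta> assms(1) \<sigma> False a] by (simp add: is_primitive_root_def)
qed

lemma (in complex_structure) act_sum: "act (\<Sum>j\<in>S. f j) x = (\<Sum>j\<in>S. act (f j) x)"
  by (simp add: act_def Re_sum Im_sum scaleR_sum_left sum.distrib)

text \<open>The centroid of an orbit of \<open>z\<close> lies in the convex set, and it is \<open>0\<close> because the
powers of a nontrivial root of unity sum to \<open>0\<close>.\<close>

lemma (in complex_structure) zero_in_invariant_convex_set:
  assumes "convex K" "K \<noteq> {}" and inv: "act z ` K = K" and z: "is_primitive_root k z" "3 \<le> k"
  shows "0 \<in> K"
proof -
  obtain x where "x \<in> K" using assms(2) by blast
  have pow: "act (z ^ j) x \<in> K" for j
    by (induction j) (use \<open>x \<in> K\<close> inv in \<open>auto simp: act_mult\<close>)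
  have "z \<noteq> 1" using z unfolding is_primitive_root_def by (metis less_le_trans one_less_numeral_iff power_one_right semiring_norm(77) zero_less_one)
  then have "(\<Sum>j<k. z ^ j) = 0" using z(1) by (simp add: geometric_sum is_primitive_root_def)
  then have "(\<Sum>j<k. (1 / real k) *\<^sub>R act (z ^ j) x) = 0"
    unfolding scaleR_sum_right[symmetric] act_sum[symmetric] by simp
  moreover have "(\<Sum>j<k. (1 / real k) *\<^sub>R act (z ^ j) x) \<in> K"
    using z(2) pow by (intro convex_sum[OF _ assms(1)]) auto
  ultimately show ?thesis by simp
qed

section \<open>The gauge of a convex domain and its gradient\<close>

lemma cross2_eq_0_imp_scaled:
  assumes "cross2 x y = 0" and "x \<noteq> 0"
  shows "\<exists>s. y = s *\<^sub>R x"
proof (cases "x$1 = 0")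
  case True
  then have "x$2 \<noteq> 0" using assms by (auto simp: vec_eq_iff forall_2)
  then show ?thesis using assms True
    by (intro exI[of _ "y$2 / x$2"]) (auto simp: vec_eq_iff forall_2 cross2_def)
next
  case False
  then show ?thesis using assms
    by (intro exI[of _ "y$1 / x$1"]) (auto simp: vec_eq_iff forall_2 cross2_def field_simps)
qed

lemma inner_real2: "(x::real^2) \<bullet> y = x$1 * y$1 + x$2 * y$2"
  by (simp add: inner_vec_def sum_2)

text \<open>A continuous surjection from a compact space onto a Hausdorff space is a quotient map.\<close>

lemma continuous_on_compact_quotient:
  fixes \<gamma> :: "'a::topological_space \<Rightarrow> 'b::t2_space" and f :: "'b \<Rightarrow> 'c::topological_space"
  assumes "compact S" and "continuous_on S \<gamma>" and "continuous_on S (f \<circ> \<gamma>)"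
  shows "continuous_on (\<gamma> ` S) f"
  unfolding continuous_on_closed_invariant
proof (intro allI impI)
  fix B :: "'c set" assume B: "closed B"
  obtain A where A: "closed A" "A \<inter> S = (f \<circ> \<gamma>) -` B \<inter> S"
    using assms(3) B unfolding continuous_on_closed_invariant by blast
  have "compact (A \<inter> S)" using A(1) assms(1) by (simp add: closed_Int_compact)
  then have "closed (\<gamma> ` (A \<inter> S))"
    using assms(2) by (intro compact_imp_closed compact_continuous_image) (auto intro: continuous_on_subset)
  moreover have "\<gamma> ` (A \<inter> S) \<inter> \<gamma> ` S = f -` B \<inter> \<gamma> ` S"
    unfolding A by auto
  ultimately show "\<exists>A. closed A \<and> A \<inter> \<gamma> ` S = f -` B \<inter> \<gamma> ` S" by blast
qed

locale closed_curve =
  fixes \<gamma> :: "real \<Rightarrow> real^2" and P :: real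
  assumes P_pos: "0 < P" and period: "\<gamma> (t + P) = \<gamma> t" and inj: "inj_on \<gamma> {0..<P}"
begin

lemma period_int: "\<gamma> (t + of_int n * P) = \<gamma> t"
proof (induction n rule: int_induct[where k = 0])
  case (step1 i)
  have "\<gamma> (t + of_int (i + 1) * P) = \<gamma> (t + of_int i * P + P)" by (simp add: algebra_simps)
  then show ?case using step1 period by simp
next
  case (step2 i)
  have "\<gamma> (t + of_int i * P) = \<gamma> (t + of_int (i - 1) * P + P)" by (simp add: algebra_simps)
  then show ?case using step2 period by simp
qed simp

lemma reduce_mod_period: obtains n :: int where "0 \<le> t + of_int n * P" "t + of_int n * P < P"
proof -
  define n where "n = - \<lfloor>t / P\<rfloor>"
  have "of_int \<lfloor>t / P\<rfloor> * P \<le> t"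
    using of_int_floor_le pos_le_divide_eq[OF P_pos] by blast
  moreover have "t / P < of_int \<lfloor>t / P\<rfloor> + 1" by linarith
  then have "t < (of_int \<lfloor>t / P\<rfloor> + 1) * P"
    by (simp only: pos_divide_less_eq[OF P_pos])
  then have "t < of_int \<lfloor>t / P\<rfloor> * P + P" by (simp add: algebra_simps)
  ultimately show ?thesis by (intro that[of n]) (simp_all add: n_def)
qed

lemma curve_eq_iff: "\<gamma> t = \<gamma> u \<longleftrightarrow> (\<exists>n::int. u = t + of_int n * P)"
proof
  assume eq: "\<gamma> t = \<gamma> u"
  obtain m :: int where m: "0 \<le> t + of_int m * P" "t + of_int m * P < P" by (rule reduce_mod_period)
  obtain n :: int where n: "0 \<le> u + of_int n * P" "u + of_int n * P < P" by (rule reduce_mod_period)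
  have "\<gamma> (t + of_int m * P) = \<gamma> (u + of_int n * P)" using eq by (simp add: period_int)
  then have "t + of_int m * P = u + of_int n * P" using inj m n by (auto dest: inj_onD)
  then have "u = t + of_int (m - n) * P" by (simp add: algebra_simps)
  then show "\<exists>n::int. u = t + of_int n * P" by blast
qed (auto simp: period_int)

lemma curve_neq: "t < u \<Longrightarrow> u < t + P \<Longrightarrow> \<gamma> u \<noteq> \<gamma> t"
proof
  assume h: "t < u" "u < t + P" "\<gamma> u = \<gamma> t"
  then obtain n :: int where n: "u = t + of_int n * P" using curve_eq_iff by metis
  then have "0 < of_int n * P" "of_int n * P < 1 * P" using h by auto
  then have "0 < n" "n < 1" using P_pos by (simp_all add: zero_less_mult_iff)
  then show False by linarith
qed

lemma range_eq_image: "range \<gamma> = \<gamma> ` {0..P}"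
proof -
  have "\<gamma> t \<in> \<gamma> ` {0..P}" for t
  proof -
    obtain n :: int where n: "0 \<le> t + of_int n * P" "t + of_int n * P < P" by (rule reduce_mod_period)
    then show ?thesis using period_int[of t n] by (metis atLeastAtMost_iff image_eqI less_imp_le)
  qed
  then show ?thesis by auto
qed

end

text \<open>A counterclockwise parametrization of the boundary of \<open>K\<close>. The speed is left arbitrary because
the unit speed parametrization is constructed by means of the gradient of the gauge, which is obtained from
\<open>\<gamma>\<close>.\<close>

locale convex_curve = closed_curve +
  fixes \<gamma>' :: "real \<Rightarrow> real^2" and K :: "(real^2) set"
  assumes open_K: "open K" and convex_K: "convex K" and bounded_K: "bounded K" and zero_in_K: "0 \<in> K"
    and strict_K: "strictly_convex_set K"
    and range_curve: "range \<gamma> = frontier K"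
    and deriv: "(\<gamma> has_vector_derivative \<gamma>' t) (at t)"
    and continuous_deriv: "continuous_on UNIV \<gamma>'"
    and supporting: "x \<in> K \<Longrightarrow> 0 < cross2 (\<gamma>' t) (x - \<gamma> t)"
begin

abbreviation g :: "real^2 \<Rightarrow> real" where "g \<equiv> gauge_fun K"

lemma continuous_curve: "continuous_on S \<gamma>"
  by (meson continuous_at_imp_continuous_on deriv has_vector_derivative_continuous)

lemma curve_in_frontier: "\<gamma> t \<in> frontier K"
  using range_curve by auto

lemma curve_in_closure: "\<gamma> t \<in> closure K" and curve_notin: "\<gamma> t \<notin> K"
  using curve_in_frontier[of t] open_K by (auto simp: frontier_def interior_open)

lemma deriv_period: "\<gamma>' (t + of_int n * P) = \<gamma>' t"
proof -
  have "((\<lambda>u. \<gamma> (u + of_int n * P)) has_vector_derivative \<gamma>' (t + of_int n * P)) (at t)"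
  proof -
    have "((\<lambda>u. u + of_int n * P) has_vector_derivative 1) (at t)"
      by (auto intro!: derivative_eq_intros)
    from vector_diff_chain_at[OF this deriv] show ?thesis by (simp add: o_def)
  qed
  then have "(\<gamma> has_vector_derivative \<gamma>' (t + of_int n * P)) (at t)"
    by (simp add: period_int)
  then show ?thesis using deriv vector_derivative_unique_at by blast
qed

lemma deriv_eq: "\<gamma> t = \<gamma> u \<Longrightarrow> \<gamma>' t = \<gamma>' u"
  using curve_eq_iff deriv_period by metis

lemma open_segment_in_K:
  assumes "x \<in> closure K" "y \<in> closure K" "x \<noteq> y"
  shows "open_segment x y \<subseteq> K"
  using strict_K assms open_K unfolding strictly_convex_set_def by (metis interior_open)

text \<open>The inequality is strict on the boundary too: the midpoint of a second boundary point on the tangent line and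
\<open>\<gamma> t\<close> would be a point of \<open>K\<close> on that line.\<close>

lemma cross2_tangent:
  assumes "y \<in> closure K" "y \<noteq> \<gamma> t"
  shows "0 < cross2 (\<gamma>' t) (y - \<gamma> t)"
proof -
  have "midpoint (\<gamma> t) y \<in> K"
    using open_segment_in_K[OF curve_in_closure assms(1)] assms(2) by (metis midpoint_in_open_segment subsetD)
  from supporting[OF this, of t] show ?thesis
    by (simp add: cross2_def midpoint_def field_simps)
qed

text \<open>The covector, written as a vector, whose level line \<open>1\<close> is the tangent line at \<open>\<gamma>
t\<close>. These covectors trace the boundary of the polar dual of \<open>K\<close>.\<close>

definition covector :: "real \<Rightarrow> real^2" where
  "covector t = (1 / cross2 (\<gamma> t) (\<gamma>' t)) *\<^sub>R vector [\<gamma>' t $ 2, - \<gamma>' t $ 1]"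

lemma cross2_curve_pos: "0 < cross2 (\<gamma> t) (\<gamma>' t)"
  using supporting[OF zero_in_K, of t] by (simp add: cross2_def mult.commute)

lemma covector_inner: "covector t \<bullet> w = cross2 w (\<gamma>' t) / cross2 (\<gamma> t) (\<gamma>' t)"
  by (simp add: covector_def inner_real2 cross2_def diff_divide_distrib mult.commute)

lemma covector_curve: "covector t \<bullet> \<gamma> t = 1"
  using cross2_curve_pos[of t] by (simp add: covector_inner)

lemma covector_less_1:
  assumes "y \<in> closure K" "y \<noteq> \<gamma> t"
  shows "covector t \<bullet> y < 1"
proof -
  have "cross2 y (\<gamma>' t) < cross2 (\<gamma> t) (\<gamma>' t)"
    using cross2_tangent[OF assms] by (simp add: cross2_def algebra_simps)
  then show ?thesis using cross2_curve_pos[of t] by (simp add: covector_inner field_simps)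
qed

lemma covector_eq: "\<gamma> t = \<gamma> u \<Longrightarrow> covector t = covector u"
  using deriv_eq[of t u] by (simp add: covector_def)

lemma continuous_covector: "continuous_on S covector"
proof -
  have c: "continuous_on S \<gamma>" "continuous_on S \<gamma>'" using continuous_curve continuous_deriv continuous_on_subset by blast+
  have "continuous_on S (\<lambda>t. \<gamma>' t $ i)" "continuous_on S (\<lambda>t. \<gamma> t $ i)" for i
    using c by (auto intro: continuous_intros)
  moreover have "vector [\<gamma>' t $ 2, - \<gamma>' t $ 1] = \<gamma>' t $ 2 *\<^sub>R axis 1 1 - \<gamma>' t $ 1 *\<^sub>R (axis 2 1 :: real^2)" for t
    by (simp add: vec_eq_iff forall_2 axis_def)
  ultimately show ?thesis unfolding covector_def cross2_def
    using cross2_curve_pos[unfolded cross2_def]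
    by (auto intro!: continuous_intros c simp: less_le)
qed

lemma polar_form:
  assumes "v \<noteq> 0"
  obtains \<rho> t where "0 < \<rho>" "v = \<rho> *\<^sub>R \<gamma> t"
proof -
  have "0 \<in> interior K" using zero_in_K open_K by (simp add: interior_open)
  then obtain d where d: "0 < d" "0 + d *\<^sub>R v \<in> frontier K"
    using ray_to_frontier[OF bounded_K, of 0 v] assms by metis
  then obtain t where "d *\<^sub>R v = \<gamma> t" using range_curve by auto
  then have "v = (1/d) *\<^sub>R \<gamma> t" using d by (metis divide_inverse inverse_eq_divide left_inverse less_irrefl scaleR_one scaleR_scaleR)
  then show ?thesis using d that[of "1/d" t] by simp
qed

lemma curve_nonzero: "\<gamma> t \<noteq> 0"
  using curve_notin zero_in_K by metis

lemma scaled_curve_in_K_iff: "0 \<le> s \<Longrightarrow> s *\<^sub>R \<gamma> t \<in> K \<longleftrightarrow> s < 1"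
proof
  assume s: "0 \<le> s" "s < 1"
  show "s *\<^sub>R \<gamma> t \<in> K"
  proof (cases "s = 0")
    case False
    have "s *\<^sub>R \<gamma> t \<in> open_segment 0 (\<gamma> t)"
      using s False curve_nonzero[of t] by (auto simp: in_segment intro!: exI[of _ s])
    then show ?thesis
      using open_segment_in_K[of 0 "\<gamma> t"] curve_in_closure curve_nonzero zero_in_K closure_subset by (metis subsetD)
  qed (simp add: zero_in_K)
next
  assume s: "0 \<le> s" "s *\<^sub>R \<gamma> t \<in> K"
  then have "s *\<^sub>R \<gamma> t \<noteq> \<gamma> t" using curve_notin by metis
  then have "covector t \<bullet> (s *\<^sub>R \<gamma> t) < 1" using s closure_subset by (intro covector_less_1) auto
  then show "s < 1" by (simp add: covector_curve)
qed

lemma gauge_curve: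
  assumes "0 < \<rho>"
  shows "g (\<rho> *\<^sub>R \<gamma> t) = \<rho>"
proof -
  have "{r. 0 < r \<and> \<rho> *\<^sub>R \<gamma> t \<in> (\<lambda>y. r *\<^sub>R y) ` K} = {\<rho><..}"
  proof (intro set_eqI iffI; clarsimp)
    fix r x assume "0 < r" "x \<in> K" and eq: "\<rho> *\<^sub>R \<gamma> t = r *\<^sub>R x"
    from arg_cong[OF eq, of "\<lambda>v. (1/r) *\<^sub>R v"] have "x = (\<rho>/r) *\<^sub>R \<gamma> t" using \<open>0 < r\<close> by simp
    then show "\<rho> < r" using scaled_curve_in_K_iff[of "\<rho>/r" t] \<open>x \<in> K\<close> \<open>0 < r\<close> assms by simp
  next
    fix r assume "\<rho> < r"
    moreover from this have "(\<rho>/r) *\<^sub>R \<gamma> t \<in> K" using assms by (simp add: scaled_curve_in_K_iff)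
    ultimately show "0 < r \<and> \<rho> *\<^sub>R \<gamma> t \<in> (*\<^sub>R) r ` K" using assms
      by (auto simp: image_iff intro!: bexI[of _ "(\<rho>/r) *\<^sub>R \<gamma> t"])
  qed
  then show ?thesis by (simp add: gauge_fun_def)
qed

lemma gauge_pos: "v \<noteq> 0 \<Longrightarrow> 0 < g v"
  by (metis polar_form gauge_curve)

lemma gauge_scale: "0 < c \<Longrightarrow> v \<noteq> 0 \<Longrightarrow> g (c *\<^sub>R v) = c * g v"
  by (metis polar_form gauge_curve scaleR_scaleR mult_pos_pos)

text \<open>The gauge is the support function of the polar dual, and strict convexity of \<open>K\<close> says that the
maximum is attained at one covector only.\<close>

lemma covector_le_gauge:
  assumes "v \<noteq> 0"
  shows "covector t \<bullet> v \<le> g v" and "covector t \<bullet> v = g v \<Longrightarrow> v = g v *\<^sub>R \<gamma> t"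
proof -
  obtain \<rho> u where v: "0 < \<rho>" "v = \<rho> *\<^sub>R \<gamma> u" using polar_form[OF assms] .
  have g: "g v = \<rho>" using v gauge_curve by simp
  have *: "\<gamma> u = \<gamma> t \<or> covector t \<bullet> \<gamma> u < 1" using covector_less_1 curve_in_closure by blast
  then show "covector t \<bullet> v \<le> g v" using v g by (auto simp: covector_curve)
  show "v = g v *\<^sub>R \<gamma> t" if "covector t \<bullet> v = g v" using * v g that by auto
qed

text \<open>The gradient of the gauge, see \<open>gauge_has_derivative\<close>. It is constant along rays, so it is
defined by the tangent line at the point where the ray of \<open>v\<close> leaves \<open>K\<close>.\<close>

definition grad :: "real^2 \<Rightarrow> real^2" where
  "grad v = covector (SOME t. v = g v *\<^sub>R \<gamma> t)"

lemma grad_curve: assumes "0 < \<rho>" shows "grad (\<rho> *\<^sub>R \<gamma> t) = covector t"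
proof -
  have "\<rho> *\<^sub>R \<gamma> t = g (\<rho> *\<^sub>R \<gamma> t) *\<^sub>R \<gamma> t" using gauge_curve[OF assms] by simp
  then have "\<rho> *\<^sub>R \<gamma> t = g (\<rho> *\<^sub>R \<gamma> t) *\<^sub>R \<gamma> (SOME u. \<rho> *\<^sub>R \<gamma> t = g (\<rho> *\<^sub>R \<gamma> t) *\<^sub>R \<gamma> u)"
    by (rule someI)
  then have "\<gamma> t = \<gamma> (SOME u. \<rho> *\<^sub>R \<gamma> t = g (\<rho> *\<^sub>R \<gamma> t) *\<^sub>R \<gamma> u)"
    using gauge_curve[OF assms] assms by simp
  then show ?thesis unfolding grad_def by (metis covector_eq)
qed

lemma grad_inner_self: "v \<noteq> 0 \<Longrightarrow> grad v \<bullet> v = g v"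
  by (metis polar_form grad_curve gauge_curve inner_scaleR_right covector_curve mult.right_neutral)

lemma grad_le_gauge: "u \<noteq> 0 \<Longrightarrow> v \<noteq> 0 \<Longrightarrow> grad u \<bullet> v \<le> g v"
  by (metis polar_form grad_curve covector_le_gauge(1))

lemma grad_eq_gaugeD: "u \<noteq> 0 \<Longrightarrow> v \<noteq> 0 \<Longrightarrow> grad u \<bullet> v = g v \<Longrightarrow> \<exists>c>0. v = c *\<^sub>R u"
proof -
  assume h: "u \<noteq> 0" "v \<noteq> 0" "grad u \<bullet> v = g v"
  obtain \<rho> t where u: "0 < \<rho>" "u = \<rho> *\<^sub>R \<gamma> t" using polar_form[OF h(1)] .
  then have "v = g v *\<^sub>R \<gamma> t" using h covector_le_gauge(2)[OF h(2)] grad_curve by auto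
  also have "\<dots> = (g v / \<rho>) *\<^sub>R u" using u by simp
  finally show ?thesis using gauge_pos[OF h(2)] u by (metis divide_pos_pos)
qed

lemma covector_bounded: obtains M where "\<And>t. norm (covector t) \<le> M"
proof -
  have "bounded (covector ` {0..P})"
    using continuous_covector by (intro compact_imp_bounded compact_continuous_image) auto
  then obtain M where M: "\<And>t. t \<in> {0..P} \<Longrightarrow> norm (covector t) \<le> M" unfolding bounded_iff by blast
  have "norm (covector t) \<le> M" for t
    using M covector_eq[of t] range_eq_image by (metis imageE rangeI)
  then show ?thesis by (rule that)
qed

lemma gauge_diff_bounds:
  assumes "v \<noteq> 0" "u \<noteq> 0"
  shows "grad v \<bullet> (u - v) \<le> g u - g v" "g u - g v \<le> grad u \<bullet> (u - v)"
  using grad_le_gauge[OF assms(1,2)] grad_le_gauge[OF assms(2,1)] grad_inner_self assms by (auto simp: inner_diff_right)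

lemma continuous_gauge: "continuous_on (- {0}) g"
proof -
  obtain M where M: "\<And>t. norm (covector t) \<le> M" by (rule covector_bounded) blast
  have "M \<ge> 0" using M[of 0] norm_ge_zero order_trans by blast
  have "\<bar>g u - g v\<bar> \<le> M * norm (u - v)" if uv: "v \<noteq> 0" "u \<noteq> 0" for u v
  proof -
    have "norm (grad w) \<le> M" for w by (simp add: grad_def M)
    then have "\<bar>grad w \<bullet> (u - v)\<bar> \<le> M * norm (u - v)" for w
      using Cauchy_Schwarz_ineq2[of "grad w" "u - v"] by (meson mult_right_mono norm_ge_zero order_trans)
    from this[of u] this[of v] show ?thesis using gauge_diff_bounds[OF uv] by linarith
  qed
  then have "M-lipschitz_on (- {0}) g"
    using \<open>M \<ge> 0\<close> by (intro lipschitz_onI) (auto simp: dist_real_def dist_norm)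
  then show ?thesis by (rule lipschitz_on_continuous_on)
qed

text \<open>On the boundary this holds since \<open>grad \<circ> \<gamma>\<close> is the continuous map
\<open>covector\<close> and \<open>\<gamma>\<close> is a quotient map; elsewhere the gradient is that of the
radial projection.\<close>

lemma continuous_grad: "continuous_on (- {0}) grad"
proof -
  have "continuous_on (\<gamma> ` {0..P}) grad"
  proof (rule continuous_on_compact_quotient)
    have "grad \<circ> \<gamma> = covector" using grad_curve[of 1] by auto
    then show "continuous_on {0..P} (grad \<circ> \<gamma>)" using continuous_covector by simp
  qed (auto intro: continuous_curve)
  then have "continuous_on (frontier K) grad" using range_eq_image range_curve by simp
  moreover have "(1 / g v) *\<^sub>R v \<in> frontier K" if nz: "v \<noteq> 0" for v
  proof -
    obtain \<rho> t where "0 < \<rho>" "v = \<rho> *\<^sub>R \<gamma> t" using polar_form[OF nz] .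
    then show ?thesis by (simp add: gauge_curve curve_in_frontier)
  qed
  then have "(\<lambda>v. (1 / g v) *\<^sub>R v) ` (- {0}) \<subseteq> frontier K" by auto
  moreover have "continuous_on (- {0}) (\<lambda>v. (1 / g v) *\<^sub>R v)"
    using gauge_pos by (intro continuous_intros continuous_gauge) (auto simp: less_le)
  ultimately have "continuous_on (- {0}) (\<lambda>v. grad ((1 / g v) *\<^sub>R v))"
    using continuous_on_compose2 by blast
  moreover have "grad ((1 / g v) *\<^sub>R v) = grad v" if nz: "v \<noteq> 0" for v
  proof -
    obtain \<rho> t where "0 < \<rho>" "v = \<rho> *\<^sub>R \<gamma> t" using polar_form[OF nz] .
    then show ?thesis using grad_curve[of \<rho> t] grad_curve[of 1 t] by (simp add: gauge_curve)
  qed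
  then have "continuous_on (- {0}) (\<lambda>v. grad ((1 / g v) *\<^sub>R v)) = continuous_on (- {0}) grad"
    by (intro continuous_on_cong) auto
  ultimately show ?thesis by simp
qed

text \<open>The increment of \<open>g\<close> from \<open>v\<close> to \<open>u\<close> lies between the values of the
covectors at \<open>v\<close> and at \<open>u\<close> on \<open>u - v\<close>
(\<open>gauge_diff_bounds\<close>), which differ by little when \<open>u\<close> is close to \<open>v\<close>.\<close>

lemma gauge_has_derivative:
  assumes "v \<noteq> 0"
  shows "(g has_derivative (\<lambda>h. grad v \<bullet> h)) (at v)"
proof -
  have "isCont grad v" using continuous_grad assms by (simp add: continuous_on_eq_continuous_at open_Compl)
  show ?thesis
    unfolding has_derivative_at_alt
  proof (intro conjI allI impI)
    show "bounded_linear ((\<bullet>) (grad v))" by (rule bounded_linear_inner_right)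
    fix e :: real assume "0 < e"
    then obtain d where d: "0 < d" "\<And>u. dist u v < d \<Longrightarrow> dist (grad u) (grad v) < e"
      using \<open>isCont grad v\<close> unfolding continuous_at_eps_delta by blast
    show "\<exists>d>0. \<forall>y. norm (y - v) < d \<longrightarrow> norm (g y - g v - grad v \<bullet> (y - v)) \<le> e * norm (y - v)"
    proof (intro exI[of _ "min d (norm v)"] conjI allI impI)
      show "0 < min d (norm v)" using d assms by simp
      fix y assume y: "norm (y - v) < min d (norm v)"
      then have "y \<noteq> 0" by auto
      have "norm (grad y - grad v) \<le> e" using d(2)[of y] y by (auto simp: dist_norm less_imp_le)
      have "\<bar>g y - g v - grad v \<bullet> (y - v)\<bar> \<le> \<bar>(grad y - grad v) \<bullet> (y - v)\<bar>"
        using gauge_diff_bounds[OF assms \<open>y \<noteq> 0\<close>] by (simp add: inner_diff_left)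
      also have "\<dots> \<le> norm (grad y - grad v) * norm (y - v)" by (rule Cauchy_Schwarz_ineq2)
      also have "\<dots> \<le> e * norm (y - v)" using \<open>norm (grad y - grad v) \<le> e\<close> by (simp add: mult_right_mono)
      finally show "norm (g y - g v - grad v \<bullet> (y - v)) \<le> e * norm (y - v)" by simp
    qed
  qed
qed

lemma gauge_comp_has_derivative:
  fixes f :: "real \<Rightarrow> real^2"
  assumes "(f has_vector_derivative f') (at t)" and "f t \<noteq> 0"
  shows "((\<lambda>u. g (f u)) has_real_derivative grad (f t) \<bullet> f') (at t)"
proof -
  have "((\<lambda>u. g (f u)) has_derivative (\<lambda>h. grad (f t) \<bullet> (h *\<^sub>R f'))) (at t)"
    using assms by (intro has_derivative_compose[OF _ gauge_has_derivative]) (auto simp: has_vector_derivative_def)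
  then show ?thesis by (simp add: has_field_derivative_def mult_commute_abs)
qed

text \<open>The source of the twist condition: if \<open>u\<close> lies strictly between the directions \<open>v\<close>
and \<open>w\<close>, then turning from \<open>v\<close> to \<open>u\<close> increases the derivative of the
gauge along \<open>w\<close>. Both inequalities used are strict instances of \<open>grad_le_gauge\<close>.\<close>

lemma grad_inner_less:
  assumes w: "u = \<alpha> *\<^sub>R w + \<beta> *\<^sub>R v" and "0 < \<alpha>" "0 < \<beta>" and nz: "cross2 u v \<noteq> 0"
  shows "grad v \<bullet> w < grad u \<bullet> w"
proof -
  have uv: "u \<noteq> 0" "v \<noteq> 0" "\<And>c. u \<noteq> c *\<^sub>R v" "\<And>c. v \<noteq> c *\<^sub>R u" using nz by (auto simp: cross2_def)
  have 1: "grad v \<bullet> u < g u" using grad_le_gauge[of v u] grad_eq_gaugeD[of v u] uv by (auto simp: less_le)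
  have 2: "grad u \<bullet> v < g v" using grad_le_gauge[of u v] grad_eq_gaugeD[of u v] uv by (auto simp: less_le)
  have "\<alpha> * (grad v \<bullet> w) = grad v \<bullet> u - \<beta> * g v"
    using grad_inner_self[OF uv(2)] by (simp add: w inner_add_right)
  also have "\<dots> < g u - \<beta> * (grad u \<bullet> v)" using 1 2 \<open>0 < \<beta>\<close> by (smt (verit) mult_strict_left_mono)
  also have "\<dots> = \<alpha> * (grad u \<bullet> w)"
    using grad_inner_self[OF uv(1)] by (simp add: w inner_add_right)
  finally show ?thesis using \<open>0 < \<alpha>\<close> by simp
qed

end

section \<open>Lifting boundary points to the parameter line\<close>

context convex_curve begin

text \<open>A homeomorphism from the boundary of \<open>K\<close> onto the unit circle, used to lift paths by means of the
complex logarithm.\<close>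

definition circle_coord :: "real^2 \<Rightarrow> complex" where
  "circle_coord x = cis (2 * pi / P * (SOME t. \<gamma> t = x))"

lemma cis_eq_iff: "cis (2 * pi / P * t) = cis (2 * pi / P * u) \<longleftrightarrow> (\<exists>n::int. u = t + of_int n * P)"
proof -
  have "cis (2 * pi / P * t) = cis (2 * pi / P * u) \<longleftrightarrow> cis (2 * pi / P * u) = cis (2 * pi / P * t)"
    by auto
  also have "\<dots> \<longleftrightarrow> exp (\<i> * of_real (2 * pi / P * u)) = exp (\<i> * of_real (2 * pi / P * t))"
    by (simp only: cis_conv_exp)
  also have "\<dots> \<longleftrightarrow> (\<exists>n::int. \<i> * of_real (2 * pi / P * u) = \<i> * of_real (2 * pi / P * t) + of_int (2 * n) * pi * \<i>)"
    by (rule exp_eq)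
  also have "\<dots> \<longleftrightarrow> (\<exists>n::int. u = t + of_int n * P)"
  proof (rule iff_exI)
    fix n :: int
    have "\<i> * of_real (2 * pi / P * u) = \<i> * of_real (2 * pi / P * t) + of_int (2 * n) * pi * \<i>
        \<longleftrightarrow> \<i> * of_real (2 * pi / P * u) = \<i> * complex_of_real (2 * pi / P * (t + of_int n * P))"
      using P_pos by (simp add: field_simps)
    also have "\<dots> \<longleftrightarrow> complex_of_real (2 * pi / P * u) = complex_of_real (2 * pi / P * (t + of_int n * P))"
      by simp
    also have "\<dots> \<longleftrightarrow> u = t + of_int n * P"
      using P_pos by (simp only: of_real_eq_iff) simp
    finally show "\<i> * of_real (2 * pi / P * u) = \<i> * of_real (2 * pi / P * t) + of_int (2 * n) * pi * \<i>
        \<longleftrightarrow> u = t + of_int n * P" .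
  qed
  finally show ?thesis .
qed

lemma circle_coord_curve: "circle_coord (\<gamma> t) = cis (2 * pi / P * t)"
proof -
  have "\<gamma> (SOME u. \<gamma> u = \<gamma> t) = \<gamma> t" by (rule someI) (rule refl)
  then show ?thesis unfolding circle_coord_def cis_eq_iff curve_eq_iff .
qed

lemma continuous_circle_coord: "continuous_on (frontier K) circle_coord"
proof -
  have "continuous_on (\<gamma> ` {0..P}) circle_coord"
    using P_pos by (intro continuous_on_compact_quotient)
      (auto intro!: continuous_intros continuous_curve simp: o_def circle_coord_curve)
  then show ?thesis using range_eq_image range_curve by simp
qed

lemma continuous_lift:
  fixes f :: "'a::real_normed_vector \<Rightarrow> real^2"
  assumes "convex S" and f: "continuous_on S f" and "f ` S \<subseteq> frontier K"
  obtains \<theta> where "continuous_on S \<theta>" "\<And>x. x \<in> S \<Longrightarrow> \<gamma> (\<theta> x) = f x"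
proof -
  have "continuous_on S (\<lambda>x. circle_coord (f x))"
    using continuous_on_compose2[OF continuous_circle_coord f] assms(3) by blast
  moreover have "circle_coord (f x) \<noteq> 0" if "x \<in> S" for x by (simp add: circle_coord_def)
  ultimately obtain h where h: "continuous_on S h" "\<And>x. x \<in> S \<Longrightarrow> circle_coord (f x) = exp (h x)"
    using continuous_logarithm_on_contractible[OF _ convex_imp_contractible[OF assms(1)]] by blast
  show ?thesis
  proof (rule that[of "\<lambda>x. P / (2 * pi) * Im (h x)"])
    show "continuous_on S (\<lambda>x. P / (2 * pi) * Im (h x))" using h by (intro continuous_intros)
    fix x assume x: "x \<in> S"
    obtain t where t: "f x = \<gamma> t" using assms(3) x range_curve by blast
    have "exp (h x) = cis (2 * pi / P * t)" using h(2)[OF x] t circle_coord_curve by simp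
    moreover from this have "norm (exp (h x)) = 1" by simp
    then have "Re (h x) = 0" by (simp only: norm_exp_eq_Re) simp
    then have "h x = \<i> * of_real (Im (h x))" by (simp add: complex_eq_iff)
    then have "exp (h x) = cis (Im (h x))" by (metis cis_conv_exp)
    ultimately have "cis (2 * pi / P * (P / (2 * pi) * Im (h x))) = cis (2 * pi / P * t)"
      using P_pos by simp
    then show "\<gamma> (P / (2 * pi) * Im (h x)) = f x"
      unfolding cis_eq_iff t curve_eq_iff .
  qed
qed

text \<open>Two lifts of the same map differ by a continuous function with values in a discrete set.\<close>

lemma lift_difference_constant:
  assumes "connected S" "continuous_on S d" and "\<And>x. x \<in> S \<Longrightarrow> \<exists>n::int. d x = of_int n * P"
  shows "d constant_on S"
proof (rule continuous_discrete_range_constant[OF assms(1,2)])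
  fix x assume x: "x \<in> S"
  show "\<exists>e>0. \<forall>y. y \<in> S \<and> d y \<noteq> d x \<longrightarrow> e \<le> norm (d y - d x)"
  proof (intro exI[of _ P] conjI allI impI P_pos)
    fix y assume y: "y \<in> S \<and> d y \<noteq> d x"
    obtain m n :: int where m: "d x = of_int m * P" and n: "d y = of_int n * P" using assms(3) x y by meson
    have "m \<noteq> n" using y m n by auto
    then have "1 \<le> \<bar>n - m\<bar>" by linarith
    then have "(1::real) \<le> \<bar>of_int (n - m)\<bar>" by linarith
    then have "1 * P \<le> \<bar>of_int (n - m)\<bar> * P" using P_pos by (intro mult_right_mono) auto
    also have "\<dots> = norm (d y - d x)"
      using P_pos unfolding m n by (simp add: abs_mult left_diff_distrib[symmetric])
    finally show "P \<le> norm (d y - d x)" by simp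
  qed
qed

end

section \<open>The twist property and the billiard map\<close>

context convex_curve begin

text \<open>The coordinate \<open>s\<close> of the oriented chord from \<open>\<gamma> t\<close> to \<open>\<gamma>
u\<close>: the momentum at departure.\<close>

definition dep :: "real \<Rightarrow> real \<Rightarrow> real" where
  "dep t u = grad (\<gamma> u - \<gamma> t) \<bullet> \<gamma>' t"

text \<open>The coordinate \<open>s\<close> after the bounce at \<open>\<gamma> u\<close>: the momentum at arrival.\<close>

definition arr :: "real \<Rightarrow> real \<Rightarrow> real" where
  "arr t u = grad (\<gamma> u - \<gamma> t) \<bullet> \<gamma>' u"

lemma cross2_tangent_chord: "t < u \<Longrightarrow> u < t + P \<Longrightarrow> 0 < cross2 (\<gamma>' t) (\<gamma> u - \<gamma> t)"
  using cross2_tangent curve_in_closure curve_neq by blast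

lemma not_collinear:
  assumes "t < u" "u < v" "v < t + P"
  shows "cross2 (\<gamma> u - \<gamma> t) (\<gamma> v - \<gamma> t) \<noteq> 0"
proof
  assume 0: "cross2 (\<gamma> u - \<gamma> t) (\<gamma> v - \<gamma> t) = 0"
  define a b c where "a = \<gamma> t" and "b = \<gamma> u" and "c = \<gamma> v"
  have ne: "a \<noteq> b" "b \<noteq> c" "a \<noteq> c"
    using curve_neq[of t u] curve_neq[of u v] curve_neq[of t v] assms by (auto simp: a_def b_def c_def)
  have coll: "collinear {a, b, c}"
  proof -
    have "cross2 (b - a) (c - a) = 0" using 0 by (simp add: a_def b_def c_def)
    then obtain s where s: "c - a = s *\<^sub>R (b - a)" using cross2_eq_0_imp_scaled ne by (metis right_minus_eq)
    have "\<exists>r. x - y = r *\<^sub>R (b - a)" if "x \<in> {a,b,c}" "y \<in> {a,b,c}" for x y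
    proof -
      have "\<exists>r. z = a + r *\<^sub>R (b - a)" if "z \<in> {a,b,c}" for z
        using that s by (auto intro: exI[of _ 0] exI[of _ 1] exI[of _ s] simp: algebra_simps)
      from this[OF \<open>x \<in> _\<close>] this[OF \<open>y \<in> _\<close>]
      obtain r r' where "x = a + r *\<^sub>R (b - a)" "y = a + r' *\<^sub>R (b - a)" by blast
      then have "x - y = (r - r') *\<^sub>R (b - a)" by (simp add: scaleR_diff_left)
      then show ?thesis ..
    qed
    then show ?thesis unfolding collinear_def by blast
  qed
  have "b \<notin> open_segment a c" "a \<notin> open_segment b c" "c \<notin> open_segment a b"
    using open_segment_in_K[OF curve_in_closure curve_in_closure] curve_notin ne
    unfolding a_def b_def c_def by (metis subsetD)+
  then show False using coll ne unfolding collinear_between_cases between_mem_segment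
    by (auto simp: open_segment_def open_segment_commute[of b c] closed_segment_commute insert_commute)
qed

text \<open>The cross product does not vanish for \<open>t < u < v < t + P\<close>, because no three boundary points are
collinear, so its sign can be read off for \<open>v\<close> slightly larger than \<open>u\<close>, where the
derivative at \<open>u\<close> decides.\<close>

lemma orientation:
  assumes "t < u" "u < v" "v < t + P"
  shows "0 < cross2 (\<gamma> u - \<gamma> t) (\<gamma> v - \<gamma> t)"
proof (rule ccontr)
  define h where "h s = cross2 (\<gamma> u - \<gamma> t) (\<gamma> s - \<gamma> t)" for s
  assume "\<not> 0 < cross2 (\<gamma> u - \<gamma> t) (\<gamma> v - \<gamma> t)"
  then have hv: "h v < 0" using not_collinear[OF assms] by (simp add: h_def)
  have dh: "(h has_real_derivative cross2 (\<gamma> u - \<gamma> t) (\<gamma>' s)) (at s)" for s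
  proof -
    have "((\<lambda>s. \<gamma> s $ i) has_real_derivative \<gamma>' s $ i) (at s)" for i
      unfolding has_real_derivative_iff_has_vector_derivative
      by (rule bounded_linear.has_vector_derivative[OF bounded_linear_vec_nth deriv])
    then show ?thesis unfolding h_def cross2_def vector_minus_component
      by (auto intro!: derivative_eq_intros)
  qed
  have "0 < cross2 (\<gamma>' u) (\<gamma> t - \<gamma> u)"
    using cross2_tangent_chord[of u "t + P"] assms by (simp add: period)
  then have "0 < cross2 (\<gamma> u - \<gamma> t) (\<gamma>' u)" by (simp add: cross2_def algebra_simps)
  then obtain d where d: "0 < d" "\<And>e. 0 < e \<Longrightarrow> e < d \<Longrightarrow> h u < h (u + e)"
    using DERIV_pos_inc_right[OF dh] by blast
  define e where "e = min (d/2) ((v - u)/2)"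
  have e: "0 < e" "e < d" "u + e < v" using d assms by (auto simp: e_def min_def field_simps)
  have "0 < h (u + e)" using d(2)[OF e(1,2)] by (simp add: h_def cross2_def)
  moreover have "continuous_on {u + e..v} h" using dh by (meson DERIV_isCont continuous_at_imp_continuous_on)
  ultimately obtain s where s: "u + e \<le> s" "s \<le> v" "h s = 0"
    using IVT2'[of h v 0 "u + e"] hv e by auto
  then show False using not_collinear[of t u s] assms e by (simp add: h_def)
qed

lemma cross2_decompose:
  assumes "cross2 w y \<noteq> 0"
  shows "x = (cross2 x y / cross2 w y) *\<^sub>R w + (cross2 w x / cross2 w y) *\<^sub>R y"
proof -
  have "cross2 w y * x$i = cross2 x y * w$i + cross2 w x * y$i" for i
    using exhaust_2[of i] by (auto simp: cross2_def algebra_simps)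
  then show ?thesis using assms by (simp add: vec_eq_iff field_simps)
qed

text \<open>As the endpoint moves forward, the chord turns counterclockwise, away from the tangent vector at its starting
point.\<close>

lemma dep_decreasing:
  assumes "t < u" "u < v" "v < t + P"
  shows "dep t v < dep t u"
proof -
  let ?w = "\<gamma>' t" and ?x = "\<gamma> u - \<gamma> t" and ?y = "\<gamma> v - \<gamma> t"
  have pos: "0 < cross2 ?w ?y" "0 < cross2 ?w ?x" "0 < cross2 ?x ?y"
    using cross2_tangent_chord orientation assms by auto
  then show ?thesis unfolding dep_def
    by (intro grad_inner_less[OF cross2_decompose[of ?w ?y ?x]]) auto
qed

text \<open>As the starting point moves forward, the chord turns towards the tangent vector at its endpoint.\<close>

lemma arr_increasing:
  assumes "t < t'" "t' < u" "u < t + P"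
  shows "arr t u < arr t' u"
proof -
  let ?w = "\<gamma>' u" and ?x = "\<gamma> u - \<gamma> t'" and ?y = "\<gamma> u - \<gamma> t"
  have "0 < cross2 ?w (\<gamma> t - \<gamma> u)" "0 < cross2 ?w (\<gamma> t' - \<gamma> u)" "0 < cross2 (\<gamma> t - \<gamma> u) (\<gamma> t' - \<gamma> u)"
    using cross2_tangent_chord[of u "t + P"] cross2_tangent_chord[of u "t' + P"]
      orientation[of u "t + P" "t' + P"] assms by (auto simp: period)
  then have "cross2 ?w ?y < 0" "cross2 ?w ?x < 0" "cross2 ?x ?y < 0"
    by (simp_all add: cross2_def algebra_simps)
  then show ?thesis unfolding arr_def
    by (intro grad_inner_less[OF cross2_decompose[of ?w ?y ?x]]) (auto simp: divide_neg_neg)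
qed

lemma dep_period: "dep (t + of_int n * P) (u + of_int m * P) = dep t u"
  and arr_period: "arr (t + of_int n * P) (u + of_int m * P) = arr t u"
  by (simp_all add: dep_def arr_def period_int deriv_period)

text \<open>The universal cover of the phase cylinder, in the coordinates \<open>(t, u)\<close> of the two ends of the
chord. Unlike the phase cylinder itself it is visibly convex.\<close>

definition strip :: "(real \<times> real) set" where
  "strip = {(t, u). t < u \<and> u < t + P}"

lemma strip_iff: "(t, u) \<in> strip \<longleftrightarrow> t < u \<and> u < t + P"
  by (simp add: strip_def)

lemma continuous_chord_momenta:
  assumes a: "continuous_on S a" and b: "continuous_on S b" and strip: "\<And>x. x \<in> S \<Longrightarrow> (a x, b x) \<in> strip"
  shows "continuous_on S (\<lambda>x. dep (a x) (b x))" and "continuous_on S (\<lambda>x. arr (a x) (b x))"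
proof -
  have c: "continuous_on S (\<lambda>x. \<gamma> (a x))" "continuous_on S (\<lambda>x. \<gamma> (b x))"
      "continuous_on S (\<lambda>x. \<gamma>' (a x))" "continuous_on S (\<lambda>x. \<gamma>' (b x))"
    using continuous_on_compose2[OF continuous_curve[of UNIV]] continuous_on_compose2[OF continuous_deriv] a b
    by auto
  have "continuous_on S (\<lambda>x. grad (\<gamma> (b x) - \<gamma> (a x)))"
    using strip curve_neq by (intro continuous_on_compose2[OF continuous_grad] continuous_intros c) (auto simp: strip_iff)
  then show "continuous_on S (\<lambda>x. dep (a x) (b x))" "continuous_on S (\<lambda>x. arr (a x) (b x))"
    unfolding dep_def arr_def by (intro continuous_intros c; assumption)+
qed

text \<open>An implicit function theorem for strictly monotone functions: \<open>b\<close> stays between \<open>b x0 -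
d\<close> and \<open>b x0 + d\<close> as long as the momentum stays between the momenta of these two
endpoints.\<close>

lemma continuous_chord_end:
  fixes a b :: "'a::metric_space \<Rightarrow> real"
  assumes a: "continuous_on S a" and s: "continuous_on S (\<lambda>x. dep (a x) (b x))"
    and strip: "\<And>x. x \<in> S \<Longrightarrow> (a x, b x) \<in> strip"
  shows "continuous_on S b"
  unfolding continuous_on_eq_continuous_within
proof
  fix x0 assume x0: "x0 \<in> S"
  show "continuous (at x0 within S) b"
    unfolding continuous_within tendsto_iff
  proof (intro allI impI)
    fix e :: real assume "0 < e"
    \<comment> \<open>Small enough for both \<open>b x0 - d\<close> and \<open>b x0 + d\<close> to remain ends of chords starting at \<open>a x0\<close>.\<close>
    define d where "d = min e (min ((b x0 - a x0)/2) ((a x0 + P - b x0)/2))"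
    have s0: "a x0 < b x0" "b x0 < a x0 + P" using strip[OF x0] by (auto simp: strip_iff)
    then have d: "0 < d" "d \<le> e" "d \<le> (b x0 - a x0)/2" "d \<le> (a x0 + P - b x0)/2"
      using \<open>0 < e\<close> by (auto simp: d_def min_def field_simps)
    define l r where "l = b x0 - d" and "r = b x0 + d"
    have lr: "a x0 < l" "l < b x0" "b x0 < r" "r < a x0 + P"
      using d s0 by (auto simp: l_def r_def field_simps)
      have at: "(a \<longlongrightarrow> a x0) (at x0 within S)" and st: "((\<lambda>x. dep (a x) (b x)) \<longlongrightarrow> dep (a x0) (b x0)) (at x0 within S)"
      using a s x0 unfolding continuous_on_def by auto
    have evS: "\<forall>\<^sub>F x in at x0 within S. x \<in> S" by (simp add: eventually_at_filter)
    have ev1: "\<forall>\<^sub>F x in at x0 within S. a x < l" using order_tendstoD(2)[OF at lr(1)] .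
    have ev2: "\<forall>\<^sub>F x in at x0 within S. r < a x + P"
      using order_tendstoD(1)[OF at, of "r - P"] lr by (simp add: less_diff_eq algebra_simps)
    have lim: "((\<lambda>x. dep (a x) c) \<longlongrightarrow> dep (a x0) c) (at x0 within S)" if "c = l \<or> c = r" for c
    proof -
      have "continuous_on {x \<in> S. a x < c \<and> c < a x + P} (\<lambda>x. dep (a x) c)"
        by (rule continuous_chord_momenta) (auto simp: strip_iff intro: continuous_on_subset[OF a])
      then have "((\<lambda>x. dep (a x) c) \<longlongrightarrow> dep (a x0) c) (at x0 within {x \<in> S. a x < c \<and> c < a x + P})"
        using x0 lr that unfolding continuous_on_def by auto
      moreover have "\<forall>\<^sub>F x in at x0 within S. a x < c \<and> c < a x + P"
        using ev1 ev2 by eventually_elim (use that lr in auto)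
      then have "\<forall>\<^sub>F x in nhds x0. x \<noteq> x0 \<longrightarrow> (x \<in> S) = (x \<in> {x \<in> S. a x < c \<and> c < a x + P})"
        unfolding eventually_at_filter by eventually_elim auto
      then have "at x0 within S = at x0 within {x \<in> S. a x < c \<and> c < a x + P}"
        by (intro filter_eqI) (auto simp: eventually_at_filter elim: eventually_elim2)
      ultimately show ?thesis by simp
    qed
    have "dep (a x0) (b x0) < dep (a x0) l" "dep (a x0) r < dep (a x0) (b x0)"
      using dep_decreasing lr by auto
    then have "\<forall>\<^sub>F x in at x0 within S. dep (a x) (b x) < dep (a x) l"
      "\<forall>\<^sub>F x in at x0 within S. dep (a x) r < dep (a x) (b x)"
      using order_tendstoD(1)[OF tendsto_diff[OF lim[of l] st], of 0]
        order_tendstoD(2)[OF tendsto_diff[OF lim[of r] st], of 0] by auto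
    then show "\<forall>\<^sub>F x in at x0 within S. dist (b x) (b x0) < e"
      using ev1 ev2 evS
    proof eventually_elim
      case (elim x)
      then have "a x < b x" "b x < a x + P" using strip[of x] by (auto simp: strip_iff)
      have "l < b x"
        using dep_decreasing[of "a x" "b x" l] elim lr \<open>a x < b x\<close> by (cases "b x = l") (auto simp: not_less[symmetric] elim: linorder_neqE)
      moreover have "b x < r"
        using dep_decreasing[of "a x" r "b x"] elim lr \<open>b x < a x + P\<close> by (smt (verit))
      ultimately show ?case using d by (auto simp: l_def r_def dist_real_def)
    qed
  qed
qed

end

context convex_curve begin

definition phase_point :: "real \<Rightarrow> real \<Rightarrow> (real^2) \<times> real" where
  "phase_point t u = (\<gamma> t, dep t u)"

lemma gen_fun_derivatives:
  assumes "\<gamma> u \<noteq> \<gamma> t"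
  shows "((\<lambda>x. gen_fun K \<gamma> x u) has_real_derivative - dep t u) (at t)"
    and "((\<lambda>x. gen_fun K \<gamma> t x) has_real_derivative arr t u) (at u)"
proof -
  have "((\<lambda>x. \<gamma> u - \<gamma> x) has_vector_derivative - \<gamma>' t) (at t)"
    "((\<lambda>x. \<gamma> x - \<gamma> t) has_vector_derivative \<gamma>' u) (at u)"
    by (auto intro!: derivative_eq_intros deriv)
  from this[THEN gauge_comp_has_derivative]
  show "((\<lambda>x. gen_fun K \<gamma> x u) has_real_derivative - dep t u) (at t)"
    "((\<lambda>x. gen_fun K \<gamma> t x) has_real_derivative arr t u) (at u)"
    using assms by (simp_all add: gen_fun_def dep_def arr_def)
qed

lemma chord_in_strip:
  assumes "\<gamma> u \<noteq> \<gamma> t"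
  obtains n :: int where "(t, u + of_int n * P) \<in> strip"
proof -
  obtain n :: int where n: "0 \<le> (u - t) + of_int n * P" "(u - t) + of_int n * P < P" by (rule reduce_mod_period)
  have "u + of_int n * P \<noteq> t" using assms period_int[of u n] by auto
  then show ?thesis using n that[of n] by (auto simp: strip_iff)
qed

lemma phase_cylinder_eq: "phase_cylinder K \<gamma> = (\<lambda>(t, u). phase_point t u) ` strip"
proof (intro equalityI subsetI)
  fix x assume "x \<in> phase_cylinder K \<gamma>"
  then obtain t s u where x: "x = (\<gamma> t, s)" "\<gamma> u \<noteq> \<gamma> t"
    and d: "((\<lambda>x. gen_fun K \<gamma> x u) has_real_derivative - s) (at t)"
    unfolding phase_cylinder_def by blast
  have "s = dep t u" using DERIV_unique[OF d gen_fun_derivatives(1)[OF x(2)]] by simp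
  moreover obtain n :: int where "(t, u + of_int n * P) \<in> strip" using chord_in_strip[OF x(2)] .
  ultimately show "x \<in> (\<lambda>(t, u). phase_point t u) ` strip"
    using dep_period[of t 0 u n] x by (force simp: phase_point_def image_iff)
next
  fix x assume "x \<in> (\<lambda>(t, u). phase_point t u) ` strip"
  then obtain t u where "x = (\<gamma> t, dep t u)" "t < u" "u < t + P" by (auto simp: phase_point_def strip_iff)
  then show "x \<in> phase_cylinder K \<gamma>"
    using curve_neq gen_fun_derivatives(1) unfolding phase_cylinder_def by blast
qed

lemma dep_inj:
  assumes "(t, u) \<in> strip" "(t, v) \<in> strip" "dep t u = dep t v"
  shows "u = v"
  using assms dep_decreasing[of t u v] dep_decreasing[of t v u] by (cases u v rule: linorder_cases) (auto simp: strip_iff)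

lemma phase_point_eq_iff:
  assumes "(t, u) \<in> strip" "(t', u') \<in> strip"
  shows "phase_point t u = phase_point t' u' \<longleftrightarrow> (\<exists>n::int. t' = t + of_int n * P \<and> u' = u + of_int n * P)"
proof
  assume eq: "phase_point t u = phase_point t' u'"
  then obtain n :: int where n: "t' = t + of_int n * P" using curve_eq_iff by (auto simp: phase_point_def)
  have "(t', u + of_int n * P) \<in> strip" using assms n by (auto simp: strip_iff)
  moreover have "dep t' (u + of_int n * P) = dep t' u'"
    using eq n dep_period[of t n u n] by (simp add: phase_point_def)
  ultimately show "\<exists>n::int. t' = t + of_int n * P \<and> u' = u + of_int n * P"
    using dep_inj assms(2) n by metis
qed (auto simp: phase_point_def period_int dep_period)

lemma phase_point_over:
  assumes "x \<in> phase_cylinder K \<gamma>" and "\<gamma> t = fst x"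
  obtains u where "(t, u) \<in> strip" "x = phase_point t u"
proof -
  obtain t' u' where t': "(t', u') \<in> strip" "x = phase_point t' u'" using assms(1) unfolding phase_cylinder_eq by auto
  then have "\<gamma> t' = \<gamma> t" using assms(2) by (simp add: phase_point_def)
  then obtain n :: int where n: "t = t' + of_int n * P" using curve_eq_iff by auto
  then have s: "(t, u' + of_int n * P) \<in> strip" using t' by (auto simp: strip_iff)
  then show ?thesis using that[OF s] phase_point_eq_iff[OF t'(1) s] n t'(2) by auto
qed

lemma billiard_map_phase_point:
  assumes "(t, u) \<in> strip"
  shows "billiard_map K \<gamma> (phase_point t u) = (\<gamma> u, arr t u)"
  unfolding billiard_map_def
proof (rule the_equality)
  have ne: "\<gamma> u \<noteq> \<gamma> t" using assms curve_neq by (auto simp: strip_iff)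
  then show "billiard_rel K \<gamma> (phase_point t u) (\<gamma> u, arr t u)"
    using gen_fun_derivatives unfolding billiard_rel_def phase_point_def by blast
  fix y assume "billiard_rel K \<gamma> (phase_point t u) y"
  then obtain t' s u' s' where *: "phase_point t u = (\<gamma> t', s)" "y = (\<gamma> u', s')" "\<gamma> u' \<noteq> \<gamma> t'"
     "((\<lambda>x. gen_fun K \<gamma> x u') has_real_derivative - s) (at t')"
     "((\<lambda>x. gen_fun K \<gamma> t' x) has_real_derivative s') (at u')"
    unfolding billiard_rel_def by blast
  have s: "s = dep t' u'" "s' = arr t' u'"
    using DERIV_unique[OF *(4) gen_fun_derivatives(1)[OF *(3)]] DERIV_unique[OF *(5) gen_fun_derivatives(2)[OF *(3)]] by simp_all
  obtain n :: int where n: "(t', u' + of_int n * P) \<in> strip" using chord_in_strip[OF *(3)] .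
  have "phase_point t u = phase_point t' (u' + of_int n * P)"
    using * s dep_period[of t' 0 u' n] by (simp add: phase_point_def)
  then obtain m :: int where "t' = t + of_int m * P" "u' + of_int n * P = u + of_int m * P"
    using phase_point_eq_iff[OF assms n] by auto
  then have "t' = t + of_int m * P" "u' = u + of_int (m - n) * P" by (simp_all add: algebra_simps)
  then show "y = (\<gamma> u, arr t u)" unfolding *(2) s(2) by (simp only: period_int arr_period)
qed

end

section \<open>Linear symmetries shift the unit speed parameter\<close>

text \<open>Recovers the derivative of a continuous inner function: by Caratheodory, the difference quotient of the
composite is that of \<open>\<theta>\<close> times a factor tending to \<open>D\<close>.\<close>

lemma DERIV_of_composite:
  fixes \<phi> \<theta> :: "real \<Rightarrow> real"
  assumes \<phi>: "(\<phi> has_real_derivative D) (at (\<theta> x))" and "D \<noteq> 0" and \<theta>: "isCont \<theta> x"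
    and comp: "((\<lambda>t. \<phi> (\<theta> t)) has_real_derivative E) (at x)"
  shows "(\<theta> has_real_derivative E / D) (at x)"
proof -
  obtain h where h: "\<And>z. \<phi> z - \<phi> (\<theta> x) = h z * (z - \<theta> x)" "isCont h (\<theta> x)" "h (\<theta> x) = D"
    using CARAT_DERIV[THEN iffD1, OF \<phi>] by blast
  have lim: "((\<lambda>t. h (\<theta> t)) \<longlongrightarrow> D) (at x)"
    using isCont_o2[OF \<theta> h(2)] h(3) by (simp add: isCont_def)
  have "((\<lambda>t. (\<phi> (\<theta> t) - \<phi> (\<theta> x)) / (t - x) / h (\<theta> t)) \<longlongrightarrow> E / D) (at x)"
    using comp lim \<open>D \<noteq> 0\<close> unfolding has_field_derivative_iff by (rule tendsto_divide)
  moreover have "\<forall>\<^sub>F t in at x. (\<phi> (\<theta> t) - \<phi> (\<theta> x)) / (t - x) / h (\<theta> t) = (\<theta> t - \<theta> x) / (t - x)"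
    using tendsto_imp_eventually_ne[OF lim \<open>D \<noteq> 0\<close>] by eventually_elim (simp add: h(1))
  ultimately show ?thesis unfolding has_field_derivative_iff by (rule Lim_transform_eventually)
qed

context convex_curve begin

text \<open>Preserving \<open>cross2\<close> means determinant \<open>1\<close>; so reflections, which reverse the
parameter, are excluded.\<close>

definition is_symmetry :: "(real^2 \<Rightarrow> real^2) \<Rightarrow> bool" where
  "is_symmetry Z \<longleftrightarrow> linear Z \<and> Z ` K = K \<and> (\<forall>x y. cross2 (Z x) (Z y) = cross2 x y)"

lemma symmetry_inj: "is_symmetry Z \<Longrightarrow> inj Z"
proof (rule injI)
  fix x y assume Z: "is_symmetry Z" and eq: "Z x = Z y"
  have "cross2 (x - y) v = cross2 (Z (x - y)) (Z v)" for v using Z by (simp add: is_symmetry_def)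
  moreover have "Z (x - y) = 0" using Z eq by (simp add: is_symmetry_def linear_diff)
  ultimately have "cross2 (x - y) v = 0" for v by (simp add: cross2_def)
  from this[of "axis 1 1"] this[of "axis 2 1"] show "x = y"
    by (simp add: vec_eq_iff forall_2 cross2_def axis_def)
qed

lemma symmetry_images:
  assumes "is_symmetry Z"
  shows "Z ` closure K = closure K" "Z ` frontier K = frontier K"
proof -
  have Z: "linear Z" "inj Z" "Z ` K = K" using assms symmetry_inj by (auto simp: is_symmetry_def)
  show 1: "Z ` closure K = closure K" using closure_injective_linear_image[OF Z(1,2), of K] Z(3) by simp
  have "frontier K = closure K - K" using open_K by (simp add: frontier_def interior_open)
  then show "Z ` frontier K = frontier K" using 1 Z by (simp add: image_set_diff)
qed

lemma gauge_symmetry: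
  assumes "is_symmetry Z"
  shows "g (Z v) = g v"
proof (cases "v = 0")
  case True
  then show ?thesis using assms by (simp add: is_symmetry_def linear_0)
next
  case False
  then obtain \<rho> t where v: "0 < \<rho>" "v = \<rho> *\<^sub>R \<gamma> t" by (rule polar_form)
  obtain u where "Z (\<gamma> t) = \<gamma> u"
    using symmetry_images(2)[OF assms] curve_in_frontier range_curve by blast
  then have "Z v = \<rho> *\<^sub>R \<gamma> u" using assms v by (simp add: is_symmetry_def linear_scale)
  then show ?thesis using v gauge_curve by simp
qed

text \<open>Differentiation of the identity \<open>g \<circ> Z = g\<close>.\<close>

lemma grad_symmetry:
  assumes "is_symmetry Z" and "v \<noteq> 0"
  shows "grad (Z v) \<bullet> Z w = grad v \<bullet> w"
proof -
  have Z: "linear Z" and "Z v \<noteq> 0"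
    using assms symmetry_inj[OF assms(1)] by (auto simp: is_symmetry_def linear_injective_0)
  have "((\<lambda>s. v + s *\<^sub>R w) has_vector_derivative w) (at 0)" "((\<lambda>s. Z v + s *\<^sub>R Z w) has_vector_derivative Z w) (at 0)"
    by (auto intro!: derivative_eq_intros)
  from this[THEN gauge_comp_has_derivative]
  have "((\<lambda>s. g (v + s *\<^sub>R w)) has_real_derivative grad v \<bullet> w) (at 0)"
    "((\<lambda>s. g (Z (v + s *\<^sub>R w))) has_real_derivative grad (Z v) \<bullet> Z w) (at 0)"
    using assms \<open>Z v \<noteq> 0\<close> Z by (simp_all add: linear_add linear_scale)
  then show ?thesis unfolding gauge_symmetry[OF assms(1)] by (metis DERIV_unique)
qed

end

locale unit_curve = convex_curve +
  assumes unit_speed: "gauge_fun K (\<gamma>' t) = 1"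
begin

lemma deriv_nonzero: "\<gamma>' t \<noteq> 0"
  using cross2_curve_pos[of t] by (auto simp: cross2_def)

text \<open>Both vectors span the only support line of \<open>K\<close> at \<open>\<gamma> u\<close>, with
\<open>K\<close> on the left, and both have gauge \<open>1\<close>.\<close>

lemma symmetry_deriv:
  assumes Z: "is_symmetry Z" and eq: "Z (\<gamma> t) = \<gamma> u"
  shows "Z (\<gamma>' t) = \<gamma>' u"
proof -
  have lin: "linear Z" and cr: "\<And>x y. cross2 (Z x) (Z y) = cross2 x y" using Z by (auto simp: is_symmetry_def)
  define m where "m s = cross2 (Z (\<gamma>' t)) (\<gamma> s - \<gamma> u)" for s
  have "0 \<le> m s" for s
  proof -
    obtain x where x: "x \<in> closure K" "\<gamma> s = Z x" using symmetry_images(1)[OF Z] curve_in_closure by blast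
    have "m s = cross2 (Z (\<gamma>' t)) (Z (x - \<gamma> t))" by (simp add: m_def x(2) flip: eq add: linear_diff[OF lin])
    also have "\<dots> = cross2 (\<gamma>' t) (x - \<gamma> t)" by (rule cr)
    also have "\<dots> \<ge> 0" using cross2_tangent[OF x(1), of t] by (cases "x = \<gamma> t") (auto simp: cross2_def)
    finally show ?thesis .
  qed
  moreover have "m u = 0" by (simp add: m_def cross2_def)
  moreover have "(m has_real_derivative cross2 (Z (\<gamma>' t)) (\<gamma>' u)) (at u)"
  proof -
    have "((\<lambda>s. \<gamma> s $ i) has_real_derivative \<gamma>' u $ i) (at u)" for i
      unfolding has_real_derivative_iff_has_vector_derivative
      by (rule bounded_linear.has_vector_derivative[OF bounded_linear_vec_nth deriv])
    then show ?thesis unfolding m_def cross2_def vector_minus_component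
      by (auto intro!: derivative_eq_intros)
  qed
  ultimately have "cross2 (Z (\<gamma>' t)) (\<gamma>' u) = 0" by (auto intro!: DERIV_local_min[of m _ u 1])
  moreover have "Z (\<gamma>' t) \<noteq> 0" using deriv_nonzero symmetry_inj[OF Z] lin by (metis linear_injective_0)
  ultimately obtain s where s: "\<gamma>' u = s *\<^sub>R Z (\<gamma>' t)" using cross2_eq_0_imp_scaled by blast
  have "cross2 (\<gamma> u) (Z (\<gamma>' t)) > 0" "cross2 (\<gamma> u) (\<gamma>' u) > 0"
    using cross2_curve_pos cr[of "\<gamma> t" "\<gamma>' t"] eq by simp_all
  moreover have "cross2 (\<gamma> u) (\<gamma>' u) = s * cross2 (\<gamma> u) (Z (\<gamma>' t))"
    unfolding s by (simp add: cross2_def algebra_simps)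
  ultimately have "0 < s" by (simp add: zero_less_mult_iff)
  then have "g (\<gamma>' u) = s * g (\<gamma>' t)" using gauge_scale s \<open>Z (\<gamma>' t) \<noteq> 0\<close> gauge_symmetry[OF Z] by simp
  then have "s = 1" by (simp add: unit_speed)
  then show ?thesis using s by simp
qed

text \<open>A continuous lift \<open>\<theta>\<close> of \<open>Z\<close> to the parameter line preserves the unit speed
tangent vectors, so its derivative is \<open>1\<close>. Differentiability of \<open>\<theta>\<close> comes
from the regularity of \<open>\<gamma>\<close>.\<close>

lemma symmetry_shift:
  assumes Z: "is_symmetry Z"
  obtains c where "\<And>t. Z (\<gamma> t) = \<gamma> (t + c)"
proof -
  have lin: "linear Z" using Z by (auto simp: is_symmetry_def)
  then have bl: "bounded_linear Z" by (rule linear_conv_bounded_linear[THEN iffD1])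
  have "continuous_on UNIV (\<lambda>t. Z (\<gamma> t))"
    using continuous_on_compose2[OF linear_continuous_on[OF bl, of UNIV] continuous_curve] by simp
  moreover have "(\<lambda>t. Z (\<gamma> t)) ` UNIV \<subseteq> frontier K"
    using symmetry_images(2)[OF Z] curve_in_frontier by blast
  ultimately obtain \<theta> where \<theta>: "continuous_on UNIV \<theta>" "\<And>t. \<gamma> (\<theta> t) = Z (\<gamma> t)"
    using continuous_lift[OF convex_UNIV] by auto
  have "(\<theta> has_real_derivative 1) (at t)" for t
  proof -
    define w where "w = \<gamma>' (\<theta> t)"
    have w: "Z (\<gamma>' t) = w" unfolding w_def using symmetry_deriv[OF Z \<theta>(2)[symmetric]] .
    have "((\<lambda>s. w \<bullet> \<gamma> s) has_real_derivative w \<bullet> w) (at (\<theta> t))"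
      unfolding has_real_derivative_iff_has_vector_derivative w_def
      by (rule bounded_linear.has_vector_derivative[OF bounded_linear_inner_right deriv])
    moreover have "((\<lambda>s. w \<bullet> \<gamma> (\<theta> s)) has_real_derivative w \<bullet> w) (at t)"
    proof -
      have "((\<lambda>s. w \<bullet> Z (\<gamma> s)) has_real_derivative w \<bullet> Z (\<gamma>' t)) (at t)"
        unfolding has_real_derivative_iff_has_vector_derivative
        by (intro bounded_linear.has_vector_derivative[OF bounded_linear_inner_right]
            bounded_linear.has_vector_derivative[OF bl] deriv)
      then show ?thesis by (simp add: \<theta>(2) w)
    qed
    moreover have "w \<bullet> w \<noteq> 0" using deriv_nonzero by (simp add: w_def)
    moreover have "isCont \<theta> t" using \<theta>(1) by (simp add: continuous_on_eq_continuous_at)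
    ultimately show ?thesis using DERIV_of_composite[of "\<lambda>s. w \<bullet> \<gamma> s" "w \<bullet> w" \<theta> t "w \<bullet> w"] by simp
  qed
  then have d: "((\<lambda>t. \<theta> t - t) has_real_derivative 1 - 1) (at t)" for t
    by (intro DERIV_diff DERIV_ident)
  have const: "(\<lambda>t. \<theta> t - t) t = (\<lambda>t. \<theta> t - t) 0" for t
    by (rule DERIV_isconst_all) (use d in simp)
  define c where "c = \<theta> 0"
  have \<theta>_eq: "\<theta> t = t + c" for t using const[of t] by (simp add: c_def)
  show ?thesis using \<theta>(2) by (intro that[of c]) (simp add: \<theta>_eq)
qed

lemma momenta_shift:
  assumes Z: "is_symmetry Z" and shift: "\<And>t. Z (\<gamma> t) = \<gamma> (t + c)" and "(t, u) \<in> strip"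
  shows "dep (t + c) (u + c) = dep t u" and "arr (t + c) (u + c) = arr t u"
proof -
  have "\<gamma> u - \<gamma> t \<noteq> 0" using assms(3) curve_neq by (auto simp: strip_iff)
  moreover have "\<gamma> (u + c) - \<gamma> (t + c) = Z (\<gamma> u - \<gamma> t)" using Z shift by (simp add: is_symmetry_def linear_diff)
  ultimately show "dep (t + c) (u + c) = dep t u" "arr (t + c) (u + c) = arr t u"
    using grad_symmetry[OF Z] symmetry_deriv[OF Z shift] unfolding dep_def arr_def by metis+
qed

end

locale symmetric_curve = unit_curve + complex_structure J for J +
  fixes \<zeta> :: complex and k :: nat
  assumes primitive: "is_primitive_root k \<zeta>" and k_ge_3: "k \<ge> 3" and invariant: "act \<zeta> ` K = K"
begin

lemma act_symmetry: "norm z = 1 \<Longrightarrow> act z ` K = K \<Longrightarrow> is_symmetry (act z)"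
  by (simp add: is_symmetry_def linear_act cross2_act)

lemma invariant_power: "act z ` K = K \<Longrightarrow> act (z ^ n) ` K = K"
proof (induction n)
  case 0
  have "act 1 = id" by auto
  then show ?case by simp
next
  case (Suc n)
  have "act (z ^ Suc n) ` K = act z ` (act (z ^ n) ` K)" by (auto simp: act_mult)
  then show ?case using Suc by simp
qed

lemma norm_root_of_unity: "0 < n \<Longrightarrow> z ^ n = 1 \<Longrightarrow> norm (z::complex) = 1"
  using power_eq_1_iff[of z n] by auto

text \<open>If \<open>\<zeta>\<close> shifts the parameter by \<open>c\<close>, then \<open>k c = m P\<close>, and
\<open>m\<close> is coprime to \<open>k\<close> since a common divisor would lower the order of
\<open>\<zeta>\<close>. The generator is the power of \<open>\<zeta>\<close> whose exponent inverts
\<open>m\<close> modulo \<open>k\<close>.\<close>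

lemma ex_generator:
  obtains \<omega> where "is_primitive_root k \<omega>" "act \<omega> ` K = K" "\<And>t. act \<omega> (\<gamma> t) = \<gamma> (t + P / real k)"
proof -
  have \<zeta>: "\<zeta> ^ k = 1" "\<And>j. 0 < j \<Longrightarrow> j < k \<Longrightarrow> \<zeta> ^ j \<noteq> 1"
    using primitive by (auto simp: is_primitive_root_def)
  obtain c where c: "\<And>t. act \<zeta> (\<gamma> t) = \<gamma> (t + c)"
    using symmetry_shift[OF act_symmetry[OF norm_root_of_unity invariant]] \<zeta>(1) k_ge_3 by (metis less_le_trans zero_less_numeral)
  have pow: "act (\<zeta> ^ n) (\<gamma> t) = \<gamma> (t + of_nat n * c)" for n t
    by (induction n) (simp_all add: act_mult c algebra_simps)
  have "\<gamma> 0 = \<gamma> (0 + of_nat k * c)" using pow[of k 0] \<zeta>(1) by simp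
  then obtain m :: int where m: "of_nat k * c = of_int m * P" using curve_eq_iff by auto
  have "coprime m (int k)"
  proof (rule ccontr)
    assume "\<not> coprime m (int k)"
    define d where "d = gcd m (int k)"
    have "d > 0" using k_ge_3 by (simp add: d_def)
    moreover have "d \<noteq> 1" using \<open>\<not> coprime m (int k)\<close> by (simp add: d_def coprime_iff_gcd_eq_1)
    ultimately have "d > 1" by linarith
    obtain m' where m': "m = d * m'" using gcd_dvd1 by (metis d_def dvdE)
    obtain k' where k': "int k = d * k'" using gcd_dvd2 by (metis d_def dvdE)
    have "0 < d * k'" using k' k_ge_3 by linarith
    then have "0 < k'" using \<open>d > 0\<close> by (simp add: zero_less_mult_iff)
    then have "k' < d * k'" using \<open>d > 1\<close> by simp
    define j where "j = nat k'"
    have j: "int k = d * int j" "0 < j" "j < k"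
      using k' \<open>0 < k'\<close> \<open>k' < d * k'\<close> by (simp_all only: j_def nat_less_iff) auto
    have "of_int d * (of_nat j * c) = of_int d * (of_int m' * P)"
      using m m' j(1) by (metis mult.assoc of_int_mult of_int_of_nat_eq)
    then have "of_nat j * c = of_int m' * P" using \<open>d > 0\<close> by simp
    then have "act (\<zeta> ^ j) (\<gamma> 0) = act 1 (\<gamma> 0)" using pow[of j 0] period_int[of 0 m'] by simp
    then show False using \<zeta>(2) j curve_nonzero unfolding act_eq_iff by blast
  qed
  then obtain u v where "u * m + v * int k = 1" using bezout_int[of m "int k"] by auto
  define i where "i = nat (u mod int k)"
  have i: "int i = u mod int k" using k_ge_3 by (simp add: i_def)
  obtain l where l: "int i = u + l * int k" using i by (metis mult.commute mod_div_decomp minus_mod_eq_mult_div add_diff_cancel_left' diff_add_cancel minus_mult_left uminus_add_conv_diff)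
  have "int i * m = 1 + (l * m - v) * int k" using \<open>u * m + v * int k = 1\<close> unfolding l by (simp add: algebra_simps)
  then have im: "of_nat i * of_int m = (1::real) + of_int (l * m - v) * of_nat k" by (metis of_int_1 of_int_add of_int_mult of_int_of_nat_eq)
  have ic: "of_nat i * c = P / k + of_int (l * m - v) * P"
  proof -
    have "c = of_int m * P / k" using m k_ge_3 by (simp add: field_simps)
    then have "of_nat i * c = (of_nat i * of_int m) * P / k" by simp
    also have "\<dots> = P / k + of_int (l * m - v) * P" unfolding im using k_ge_3 by (simp add: field_simps)
    finally show ?thesis .
  qed
  define \<omega> where "\<omega> = \<zeta> ^ i"
  have \<omega>: "act \<omega> (\<gamma> t) = \<gamma> (t + P / k)" for t
    using pow[of i t] period_int[of "t + P / k" "l * m - v"] unfolding ic \<omega>_def by (simp add: add.assoc)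
  have \<omega>pow: "act (\<omega> ^ n) (\<gamma> t) = \<gamma> (t + of_nat n * (P / k))" for n t
    by (induction n) (simp_all add: act_mult \<omega> algebra_simps add_divide_distrib)
  have "\<omega> ^ k = 1"
    using \<omega>pow[of k 0] k_ge_3 period[of 0] act_eq_iff[of "\<omega> ^ k" "\<gamma> 0" 1] curve_nonzero by auto
  moreover have "\<omega> ^ j \<noteq> 1" if "0 < j" "j < k" for j
  proof -
    have "\<gamma> (0 + of_nat j * (P / k)) \<noteq> \<gamma> 0"
      using that P_pos by (intro curve_neq) (auto simp: field_simps)
    then show ?thesis using \<omega>pow[of j 0] by auto
  qed
  ultimately have "is_primitive_root k \<omega>" using k_ge_3 by (simp add: is_primitive_root_def)
  then show ?thesis using that \<omega> invariant_power[OF invariant] by (simp add: \<omega>_def)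
qed

end

section \<open>Billiard sequences in ordered families\<close>

text \<open>Loops are continuous functions on the circle; composition with the covering of the circle by the line gives
the periodic extension.\<close>

lemma continuous_on_loop_extension:
  assumes "path c" and "pathfinish c = pathstart c"
  shows "continuous_on UNIV (\<lambda>s. c (frac s))"
proof -
  let ?f = "c \<circ> (\<lambda>z. Arg2pi z / (2 * pi))"
  have "homotopic_loops (path_image c) c c" using assms by (simp add: homotopic_loops_refl)
  then have "homotopic_with_canon (\<lambda>h. True) (sphere 0 1) (path_image c) ?f ?f"
    by (rule homotopic_loops_imp_homotopic_circlemaps)
  then have "continuous_on (sphere 0 1) ?f" using homotopic_with_imp_continuous by blast
  moreover have "continuous_on UNIV (\<lambda>s. cis (2 * pi * s))" by (intro continuous_intros)
  ultimately have "continuous_on UNIV (\<lambda>s. ?f (cis (2 * pi * s)))"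
    by (rule continuous_on_compose2) auto
  moreover have "?f (cis (2 * pi * s)) = c (frac s)" for s
  proof -
    have "cis (2 * pi * s) = cis (2 * pi * frac s) * cis (2 * pi * of_int \<lfloor>s\<rfloor>)"
      unfolding cis_mult by (simp add: frac_def algebra_simps)
    also have "cis (2 * pi * of_int \<lfloor>s\<rfloor>) = 1" by (rule cis_multiple_2pi) simp
    finally have "cis (2 * pi * s) = 1 * exp (\<i> * of_real (2 * pi * frac s))" by (simp only: cis_conv_exp mult_1_left mult_1_right)
    then have "Arg2pi (cis (2 * pi * s)) = 2 * pi * frac s"
      using frac_lt_1[of s] by (intro Arg2pi_unique[of 1]) (auto simp: cis_conv_exp)
    then show ?thesis by simp
  qed
  ultimately show ?thesis by simp
qed

lemma simple_loop_extension_eq_iff: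
  assumes "simple_path c" and "pathfinish c = pathstart c"
  shows "c (frac s) = c (frac s') \<longleftrightarrow> (\<exists>n::int. s' = s + of_int n)"
proof
  assume "c (frac s) = c (frac s')"
  then have "frac s = frac s'"
    using simple_path_inj_on assms(1) frac_lt_1[of s] frac_lt_1[of s'] frac_ge_0[of s] frac_ge_0[of s']
    unfolding simple_path_def loop_free_def by (smt (verit) atLeastAtMost_iff)
  then have "s' = s + of_int (\<lfloor>s'\<rfloor> - \<lfloor>s\<rfloor>)" by (simp add: frac_def)
  then show "\<exists>n::int. s' = s + of_int n" by blast
next
  assume "\<exists>n::int. s' = s + of_int n"
  then show "c (frac s) = c (frac s')" by (auto simp: frac_def)
qed

context convex_curve begin

lemma continuous_phase_point: "continuous_on strip (\<lambda>(t, u). phase_point t u)"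
proof -
  have "continuous_on strip (\<lambda>x. dep (fst x) (snd x))"
    by (rule continuous_chord_momenta) (auto intro: continuous_intros)
  moreover have "continuous_on strip (\<lambda>x. \<gamma> (fst x))"
    by (rule continuous_on_compose2[OF continuous_curve[of UNIV]]) (auto intro: continuous_intros)
  ultimately show ?thesis by (simp add: phase_point_def case_prod_unfold continuous_on_Pair)
qed

lemma convex_strip: "convex strip"
proof -
  have "strip = {x. (1, -1) \<bullet> x < 0} \<inter> {x. (-1, 1) \<bullet> x < P}" by (auto simp: strip_def)
  then show ?thesis by (simp add: convex_Int convex_halfspace_lt)
qed

text \<open>The strip is convex, so a loop that lifts to a loop in the strip is contractible, and the contraction descends
to the phase cylinder.\<close>

lemma essential_loop_winds:
  assumes c: "path c" "path_image c \<subseteq> phase_cylinder K \<gamma>"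
    and essential: "\<nexists>x. homotopic_loops (phase_cylinder K \<gamma>) c (linepath x x)"
    and ab: "continuous_on {0..1} a" "continuous_on {0..1} b"
    and strip: "\<And>s. s \<in> {0..1} \<Longrightarrow> (a s, b s) \<in> strip \<and> c s = phase_point (a s) (b s)"
  shows "a 1 \<noteq> a 0 \<or> b 1 \<noteq> b 0"
proof (rule ccontr)
  assume closed: "\<not> (a 1 \<noteq> a 0 \<or> b 1 \<noteq> b 0)"
  define q where "q s = (a s, b s)" for s
  have "path q" using ab by (auto simp: path_def q_def intro: continuous_on_Pair)
  moreover have "path_image q \<subseteq> strip" using strip by (auto simp: path_image_def q_def)
  moreover have "pathfinish q = pathstart q" using closed by (simp add: q_def pathfinish_def pathstart_def)
  moreover have "simply_connected strip" by (rule convex_imp_simply_connected[OF convex_strip])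
  moreover have "q 0 \<in> strip" using strip[of 0] by (simp add: q_def)
  ultimately have "homotopic_loops strip q (linepath (q 0) (q 0))"
    unfolding simply_connected_eq_contractible_loop_any by blast
  then have "homotopic_loops (phase_cylinder K \<gamma>) ((\<lambda>(t, u). phase_point t u) \<circ> q)
      ((\<lambda>(t, u). phase_point t u) \<circ> linepath (q 0) (q 0))"
    using continuous_phase_point phase_cylinder_eq by (intro homotopic_loops_continuous_image) auto
  moreover have "homotopic_loops (phase_cylinder K \<gamma>) c ((\<lambda>(t, u). phase_point t u) \<circ> q)"
    using c closed strip[of 0] strip[of 1] by (intro homotopic_loops_eq) (auto simp: strip q_def pathfinish_def pathstart_def)
  moreover have "(\<lambda>(t, u). phase_point t u) \<circ> linepath (q 0) (q 0) = linepath (c 0) (c 0)"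
    using strip[of 0] by (auto simp: linepath_def q_def fun_eq_iff algebra_simps)
  ultimately show False using essential homotopic_loops_trans by metis
qed

text \<open>Orbits of the billiard map in the universal cover, recorded by the lifted parameters of the bounce points.\<close>

definition is_billiard_seq :: "(nat \<Rightarrow> real) \<Rightarrow> bool" where
  "is_billiard_seq y \<longleftrightarrow> (\<forall>j. (y j, y (Suc j)) \<in> strip \<and>
     arr (y j) (y (Suc j)) = dep (y (Suc j)) (y (Suc (Suc j))))"

lemma billiard_seq_add_period: "is_billiard_seq y \<Longrightarrow> is_billiard_seq (\<lambda>j. y j + of_int n * P)"
  by (auto simp: is_billiard_seq_def strip_iff arr_period dep_period)

lemma billiard_seq_drop: "is_billiard_seq y \<Longrightarrow> is_billiard_seq (\<lambda>j. y (j + i))"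
  by (auto simp: is_billiard_seq_def)

lemma billiard_seq_unique:
  assumes "is_billiard_seq y" "is_billiard_seq z" "y 0 = z 0" "y 1 = z 1"
  shows "y = z"
proof -
  have "y j = z j \<and> y (Suc j) = z (Suc j)" for j
  proof (induction j)
    case (Suc j)
    then have "dep (y (Suc j)) (y (Suc (Suc j))) = dep (y (Suc j)) (z (Suc (Suc j)))"
      using assms by (metis is_billiard_seq_def)
    then show ?case using Suc assms dep_inj by (metis is_billiard_seq_def)
  qed (use assms in auto)
  then show ?thesis by auto
qed

definition has_rotation :: "nat \<Rightarrow> int \<Rightarrow> (nat \<Rightarrow> real) \<Rightarrow> bool" where
  "has_rotation k r y \<longleftrightarrow> (\<forall>j. y (j + k) = y j + of_int r * P)"

lemma rotation_mult: "has_rotation k r y \<Longrightarrow> y (j + i * k) = y j + of_nat i * of_int r * P"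
proof (induction i)
  case (Suc i)
  have "y (j + Suc i * k) = y ((j + i * k) + k)" by (simp add: algebra_simps)
  also have "\<dots> = y (j + i * k) + of_int r * P" using Suc.prems unfolding has_rotation_def by blast
  finally show ?case using Suc by (simp add: algebra_simps)
qed simp

text \<open>A discrete maximum principle. Suppose \<open>y \<le> z\<close> with equality at some index. The arrival
momentum there increases with the preceding bounce and the departure momentum decreases with the next one, so
both neighbours of \<open>z\<close> being at least those of \<open>y\<close> forces equality of the next ones.
The equality propagates forward and, by periodicity, to all indices.\<close>

lemma touching_orbits_eq:
  assumes "0 < k" and y: "is_billiard_seq y" "has_rotation k r y" and z: "is_billiard_seq z" "has_rotation k r z"
    and le: "\<And>j. y j \<le> z j" and touch: "y i = z i"
  shows "y = z"
proof -
  have step: "y (Suc (Suc j)) = z (Suc (Suc j))" if "y (Suc j) = z (Suc j)" for j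
  proof (rule ccontr)
    assume "y (Suc (Suc j)) \<noteq> z (Suc (Suc j))"
    then have lt: "y (Suc (Suc j)) < z (Suc (Suc j))" using le[of "Suc (Suc j)"] by simp
    have s: "(y j, y (Suc j)) \<in> strip" "(z j, z (Suc j)) \<in> strip"
      "(y (Suc j), y (Suc (Suc j))) \<in> strip" "(z (Suc j), z (Suc (Suc j))) \<in> strip"
      using y z by (simp_all add: is_billiard_seq_def)
    have "arr (y j) (y (Suc j)) \<le> arr (z j) (y (Suc j))"
      using arr_increasing[of "y j" "z j" "y (Suc j)"] s le[of j] that by (cases "y j = z j") (auto simp: strip_iff)
    also have "\<dots> = dep (y (Suc j)) (z (Suc (Suc j)))" using z that by (simp add: is_billiard_seq_def)
    also have "\<dots> < dep (y (Suc j)) (y (Suc (Suc j)))"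
      using dep_decreasing lt s that by (auto simp: strip_iff)
    also have "\<dots> = arr (y j) (y (Suc j))" using y by (simp add: is_billiard_seq_def)
    finally show False by simp
  qed
  have "y (i + k) = z (i + k)" using touch y z by (simp add: has_rotation_def)
  moreover obtain m where m: "i + k = Suc m" using \<open>0 < k\<close> by (metis add_gr_0 gr0_conv_Suc)
  ultimately have fwd: "y (Suc m + n) = z (Suc m + n)" for n
    by (induction n) (use step in auto)
  have "y j = z j" for j
  proof -
    have "Suc m \<le> j + Suc m * k" using \<open>0 < k\<close> by (metis le_add2 le_trans mult.right_neutral mult_le_mono2 Suc_leI One_nat_def)
    then have "y (j + Suc m * k) = z (j + Suc m * k)"
      using fwd[of "j + Suc m * k - Suc m"] by (simp only: le_add_diff_inverse)
    then show ?thesis using rotation_mult y(2) z(2) by (metis add_right_cancel)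
  qed
  then show ?thesis by auto
qed

end

text \<open>A continuous family of closed orbits that is shifted by \<open>w > 0\<close> turns when the parameter of the
family increases by \<open>1\<close>, and in which no orbit occurs twice. The orbits on an essential invariant
curve form such a family; a curve with \<open>w < 0\<close> is run through backwards.\<close>

locale orbit_family = convex_curve +
  fixes k :: nat and r w :: int and x :: "nat \<Rightarrow> real \<Rightarrow> real"
  assumes k_pos: "0 < k" and w_pos: "0 < w"
    and orbits: "is_billiard_seq (\<lambda>j. x j s)" and rotation: "has_rotation k r (\<lambda>j. x j s)"
    and continuous_orbits: "continuous_on UNIV (x j)"
    and closes: "x j (s + 1) = x j s + of_int w * P"
    and injective: "x 0 s = x 0 s' \<Longrightarrow> x 1 s = x 1 s' \<Longrightarrow> s = s'"
begin

lemma closes_nat: "x j (s + of_nat n) = x j s + of_nat n * of_int w * P"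
proof (induction n)
  case (Suc n)
  have "x j (s + of_nat (Suc n)) = x j ((s + of_nat n) + 1)" by (simp add: algebra_simps)
  then show ?case unfolding closes Suc by (simp add: algebra_simps)
qed simp

lemma compare_on_one_period:
  assumes "has_rotation k r y"
  shows "(\<forall>j. y j < x j s) \<longleftrightarrow> (\<forall>j<k. y j < x j s)"
    and "(\<forall>j. y j \<le> x j s) \<longleftrightarrow> (\<forall>j<k. y j \<le> x j s)"
proof -
  have "y j = y (j mod k) + of_nat (j div k) * of_int r * P" "x j s = x (j mod k) s + of_nat (j div k) * of_int r * P" for j
    using rotation_mult[OF assms, of "j mod k" "j div k"] rotation_mult[OF rotation[of s], of "j mod k" "j div k"] by simp_all
  then show "(\<forall>j. y j < x j s) \<longleftrightarrow> (\<forall>j<k. y j < x j s)" "(\<forall>j. y j \<le> x j s) \<longleftrightarrow> (\<forall>j<k. y j \<le> x j s)"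
    using k_pos mod_less_divisor by (metis add_less_cancel_right, metis add_le_cancel_right)
qed

lemma eventually_above:
  assumes "has_rotation k r y"
  obtains s where "s0 < s" "\<forall>j. y j < x j s"
proof -
  define M where "M = Max ((\<lambda>j. \<bar>y j - x j s0\<bar>) ` {..<k})"
  obtain n :: nat where n: "M < of_nat n * P" using reals_Archimedean3[OF P_pos] by blast
  have "y j < x j (s0 + of_nat (Suc n))" if "j < k" for j
  proof -
    have "\<bar>y j - x j s0\<bar> \<le> M" unfolding M_def using that by (intro Max_ge) auto
    also have "M < of_nat n * P" by fact
    also have "\<dots> \<le> of_nat (Suc n) * of_int w * P"
    proof -
      have "of_nat n * 1 \<le> of_nat (Suc n) * (of_int w :: real)" using w_pos by (intro mult_mono) auto
      then show ?thesis using P_pos by (simp add: mult_right_mono)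
    qed
    finally show ?thesis unfolding closes_nat by linarith
  qed
  then show ?thesis using that[of "s0 + of_nat (Suc n)"] compare_on_one_period(1)[OF assms] by simp
qed

text \<open>The set of members above \<open>y\<close> is open. It is also closed, because by
\<open>touching_orbits_eq\<close> a limit of members above \<open>y\<close> lies strictly above
\<open>y\<close> unless it is equal to \<open>y\<close>. Periodicity makes the comparison one between finitely
many terms.\<close>

lemma above_on_connected:
  assumes y: "is_billiard_seq y" "has_rotation k r y"
    and S: "connected S" and avoid: "\<And>s. s \<in> S \<Longrightarrow> (\<lambda>j. x j s) \<noteq> y"
    and above: "s0 \<in> S" "\<forall>j. y j < x j s0" and "s \<in> S"
  shows "y j < x j s"
proof -
  define U where "U = {s. \<forall>j\<in>{..<k}. y j < x j s}"
  define V where "V = {s. \<forall>j\<in>{..<k}. y j \<le> x j s}"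
  have "open U" unfolding U_def Collect_ball_eq
    using continuous_orbits by (intro open_INT ballI open_Collect_less continuous_intros) auto
  moreover have "closed V" unfolding V_def Collect_ball_eq
    using continuous_orbits by (intro closed_INT ballI closed_Collect_le continuous_intros) auto
  moreover have "S \<inter> U = S \<inter> V"
  proof -
    have "s \<in> U" if s: "s \<in> S" "s \<in> V" for s
    proof -
      have le: "\<forall>j. y j \<le> x j s" using s compare_on_one_period(2)[OF y(2)] by (auto simp: V_def)
      then have "y j \<noteq> x j s" for j
        using touching_orbits_eq[OF k_pos y orbits rotation, of s j] avoid[OF s(1)] by auto
      then show ?thesis using le by (auto simp: U_def less_le)
    qed
    moreover have "U \<subseteq> V" by (auto simp: U_def V_def less_imp_le)
    ultimately show ?thesis by blast
  qed
  ultimately have "openin (top_of_set S) (S \<inter> U)" "closedin (top_of_set S) (S \<inter> U)"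
    using openin_open_Int[of U S] closedin_closed_Int[of V S] by simp_all
  moreover have "s0 \<in> S \<inter> U" using above by (auto simp: U_def)
  ultimately have "S \<inter> U = S" using S unfolding connected_clopen by blast
  then have "s \<in> U" using \<open>s \<in> S\<close> by blast
  then show ?thesis using compare_on_one_period(1)[OF y(2)] by (auto simp: U_def)
qed

text \<open>Otherwise all members would lie above \<open>y\<close>, since those with large parameter do; but those with
very negative parameter do not.\<close>

lemma orbit_in_family:
  assumes y: "is_billiard_seq y" "has_rotation k r y"
  obtains s where "(\<lambda>j. x j s) = y"
proof (rule ccontr)
  assume "\<not> thesis"
  then have avoid: "(\<lambda>j. x j s) \<noteq> y" for s using that by blast
  obtain s0 where "\<forall>j. y j < x j s0" using eventually_above[OF y(2), of 0] by blast
  then have above: "y 0 < x 0 s" for s using above_on_connected[OF y connected_UNIV] avoid by blast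
  obtain n :: nat where "x 0 0 - y 0 < of_nat n * (of_int w * P)"
    using reals_Archimedean3[of "of_int w * P"] w_pos P_pos by auto
  moreover have "x 0 (- of_nat n) = x 0 0 - of_nat n * of_int w * P" using closes_nat[of 0 "- of_nat n" n] by simp
  ultimately show False using above[of "- of_nat n"] by (simp add: mult.assoc)
qed

text \<open>The members after \<open>s\<close> avoid the member at \<open>s\<close> by injectivity, and those far out lie
above it.\<close>

lemma family_strictly_ordered:
  assumes "s < s'"
  shows "x j s < x j s'"
proof -
  obtain s1 where s1: "s < s1" "\<forall>j. x j s < x j s1" using eventually_above[OF rotation, of s s] by blast
  have "(\<lambda>j. x j u) \<noteq> (\<lambda>j. x j s)" if "u \<in> {s<..}" for u
    using injective[of u s] that by (metis greaterThan_iff less_irrefl)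
  then show ?thesis
    using above_on_connected[OF orbits rotation connected_Ioi, of s s s1 s'] s1 assms by simp
qed

lemma family_surj: obtains s where "x 0 s = t"
proof -
  obtain n :: nat where n: "\<bar>t - x 0 0\<bar> < of_nat n * (of_int w * P)"
    using reals_Archimedean3[of "of_int w * P"] w_pos P_pos by auto
  moreover have "x 0 (- of_nat n) = x 0 0 - of_nat n * of_int w * P" using closes_nat[of 0 "- of_nat n" n] by simp
  moreover have "x 0 (of_nat n) = x 0 0 + of_nat n * of_int w * P" using closes_nat[of 0 0 n] by simp
  ultimately have "x 0 (- of_nat n) \<le> t" "t \<le> x 0 (of_nat n)" by (simp_all add: mult.assoc)
  then show ?thesis
    using IVT'[of "x 0" "- of_nat n" t "of_nat n"] continuous_on_subset[OF continuous_orbits] that by auto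
qed

text \<open>Compare the orbit moved by one bounce with the orbit rotated by \<open>r\<close> of the \<open>k\<close>
sectors of the symmetry. Both are members of the totally ordered family, and both advance the orbit by
\<open>r\<close> turns when iterated \<open>k\<close> times, so neither can be strictly ahead of the other.\<close>

lemma steps_equal:
  assumes shift: "\<And>t u. (t, u) \<in> strip \<Longrightarrow> dep (t + of_int r * P / k) (u + of_int r * P / k) = dep t u \<and>
      arr (t + of_int r * P / k) (u + of_int r * P / k) = arr t u"
  shows "x (Suc j) s = x j s + of_int r * P / k"
proof -
  define \<rho> where "\<rho> = of_int r * P / k"
  let ?y = "\<lambda>j. x j s"
  have "is_billiard_seq (\<lambda>j. ?y (j + 1))" by (rule billiard_seq_drop[OF orbits])
  moreover have "has_rotation k r (\<lambda>j. ?y (j + 1))" using rotation[of s] unfolding has_rotation_def by (metis add.commute add.left_commute)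
  ultimately obtain s1 where s1: "(\<lambda>j. x j s1) = (\<lambda>j. ?y (j + 1))" using orbit_in_family by blast
  have "is_billiard_seq (\<lambda>j. ?y j + \<rho>)"
    using orbits[of s] shift unfolding is_billiard_seq_def \<rho>_def by (auto simp: strip_iff)
  moreover have "has_rotation k r (\<lambda>j. ?y j + \<rho>)" using rotation[of s] by (auto simp: has_rotation_def)
  ultimately obtain s2 where s2: "(\<lambda>j. x j s2) = (\<lambda>j. ?y j + \<rho>)" using orbit_in_family by blast
  have total: "x k s = x 0 s + of_nat k * \<rho>"
  proof -
    have "x (0 + k) s = x 0 s + of_int r * P" using rotation[of s] unfolding has_rotation_def by blast
    then show ?thesis using k_pos by (simp add: \<rho>_def)
  qed
  have "\<not> s1 < s2"
  proof
    assume "s1 < s2"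
    from family_strictly_ordered[OF this] have step: "x (Suc j) s < x j s + \<rho>" for j
      using s1 s2 by (simp add: fun_eq_iff)
    have "x (Suc n) s < x 0 s + of_nat (Suc n) * \<rho>" for n
    proof (induction n)
      case (Suc n)
      from Suc.IH step[of "Suc n"] show ?case by (simp add: algebra_simps)
    qed (use step[of 0] in simp)
    from this[of "k - 1"] show False using total k_pos by simp
  qed
  moreover have "\<not> s2 < s1"
  proof
    assume "s2 < s1"
    from family_strictly_ordered[OF this] have step: "x j s + \<rho> < x (Suc j) s" for j
      using s1 s2 by (simp add: fun_eq_iff)
    have "x 0 s + of_nat (Suc n) * \<rho> < x (Suc n) s" for n
    proof (induction n)
      case (Suc n)
      from Suc.IH step[of "Suc n"] show ?case by (simp add: algebra_simps)
    qed (use step[of 0] in simp)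
    from this[of "k - 1"] show False using total k_pos by simp
  qed
  ultimately have "s1 = s2" by simp
  then show ?thesis using fun_cong[OF s1, of j] fun_cong[OF s2, of j] by (simp add: \<rho>_def)
qed

end

section \<open>Periodic invariant curves force a symmetry\<close>

context convex_curve begin

text \<open>The lift of an orbit that stays in the phase cylinder, built by recursion on the bounces.\<close>

lemma ex_billiard_seq:
  assumes tu: "(t, u) \<in> strip"
    and stays: "\<And>j. (billiard_map K \<gamma> ^^ j) (phase_point t u) \<in> phase_cylinder K \<gamma>"
  shows "\<exists>y. y 0 = t \<and> y 1 = u \<and> is_billiard_seq y \<and>
    (\<forall>j. (billiard_map K \<gamma> ^^ j) (phase_point t u) = phase_point (y j) (y (Suc j)))"
proof -
  let ?T = "billiard_map K \<gamma>"
  have "\<exists>f. \<forall>n. (f n \<in> strip \<and> (?T ^^ n) (phase_point t u) = phase_point (fst (f n)) (snd (f n)) \<and> (n = 0 \<longrightarrow> f n = (t, u)))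
      \<and> fst (f (Suc n)) = snd (f n)"
  proof (rule dependent_nat_choice)
    show "\<exists>x. x \<in> strip \<and> (?T ^^ 0) (phase_point t u) = phase_point (fst x) (snd x) \<and> ((0::nat) = 0 \<longrightarrow> x = (t, u))"
      using tu by auto
    fix x :: "real \<times> real" and n
    assume x: "x \<in> strip \<and> (?T ^^ n) (phase_point t u) = phase_point (fst x) (snd x) \<and> (n = 0 \<longrightarrow> x = (t, u))"
    then have "(?T ^^ Suc n) (phase_point t u) = (\<gamma> (snd x), arr (fst x) (snd x))"
      using billiard_map_phase_point[of "fst x" "snd x"] by simp
    then obtain v where "(snd x, v) \<in> strip" "(?T ^^ Suc n) (phase_point t u) = phase_point (snd x) v"
      using phase_point_over[OF stays[of "Suc n"], of "snd x"] by auto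
    then show "\<exists>y. (y \<in> strip \<and> (?T ^^ Suc n) (phase_point t u) = phase_point (fst y) (snd y) \<and> (Suc n = 0 \<longrightarrow> y = (t, u)))
        \<and> fst y = snd x"
      by (intro exI[of _ "(snd x, v)"]) simp
  qed
  then obtain f where f: "\<And>n. f n \<in> strip" "\<And>n. (?T ^^ n) (phase_point t u) = phase_point (fst (f n)) (snd (f n))"
    "f 0 = (t, u)" "\<And>n. fst (f (Suc n)) = snd (f n)" by blast
  define y where "y n = fst (f n)" for n
  have snd: "snd (f n) = y (Suc n)" for n using f(4) by (simp add: y_def)
  have strip: "(y n, y (Suc n)) \<in> strip" for n using f(1)[of n] by (simp add: y_def f(4))
  have track: "(?T ^^ n) (phase_point t u) = phase_point (y n) (y (Suc n))" for n using f(2)[of n] by (simp add: y_def f(4))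
  have "arr (y n) (y (Suc n)) = dep (y (Suc n)) (y (Suc (Suc n)))" for n
  proof -
    have "?T (phase_point (y n) (y (Suc n))) = phase_point (y (Suc n)) (y (Suc (Suc n)))"
      using track[of n] track[of "Suc n"] by simp
    then show ?thesis unfolding billiard_map_phase_point[OF strip] by (simp add: phase_point_def)
  qed
  then have "is_billiard_seq y" using strip by (simp add: is_billiard_seq_def)
  moreover have "y 0 = t" "y 1 = u" using f(3,4) by (simp_all add: y_def)
  ultimately show ?thesis using track by blast
qed

lemma billiard_seq_mono: "is_billiard_seq y \<Longrightarrow> 0 < n \<Longrightarrow> y 0 < y n"
proof (induction n)
  case (Suc n)
  then have "y n < y (Suc n)" by (auto simp: is_billiard_seq_def strip_iff)
  then show ?case using Suc by (cases "n = 0") auto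
qed simp

text \<open>The loop is extended periodically to the line, its base points are lifted to parameters, and the lifts of the
subsequent bounces are continuous by \<open>continuous_chord_end\<close>. The number \<open>r\<close> of turns
per \<open>k\<close> bounces and the number \<open>w\<close> of turns of the loop are constant by
discreteness, and \<open>w\<close> is not \<open>0\<close> because the loop is essential.\<close>

lemma periodic_curve_orbit_family:
  assumes C: "curve_of_periodic_orbits K \<gamma> k C" and "0 < k"
  obtains r w x where "orbit_family \<gamma> P \<gamma>' K k r w x" "\<And>s. phase_point (x 0 s) (x 1 s) \<in> C"
    "\<And>s j. (billiard_map K \<gamma> ^^ j) (phase_point (x 0 s) (x 1 s)) = phase_point (x j s) (x (Suc j) s)"
proof -
  let ?T = "billiard_map K \<gamma>"
  obtain c where c: "simple_path c" "pathfinish c = pathstart c" "path_image c = C" "C \<subseteq> phase_cylinder K \<gamma>"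
      "\<nexists>a. homotopic_loops (phase_cylinder K \<gamma>) c (linepath a a)" and TC: "?T ` C = C"
    using C unfolding curve_of_periodic_orbits_def rotational_invariant_curve_def by blast
  have period_k: "(?T ^^ k) p = p" if "p \<in> C" for p
    using C that unfolding curve_of_periodic_orbits_def by blast
  define ct where "ct s = c (frac s)" for s
  have "path c" using c(1) by (rule simple_path_imp_path)
  have ct_cont: "continuous_on UNIV ct" unfolding ct_def using \<open>path c\<close> c(2) by (rule continuous_on_loop_extension)
  have ct_eq: "ct s = ct s' \<longleftrightarrow> (\<exists>n::int. s' = s + of_int n)" for s s'
    unfolding ct_def using c(1,2) by (rule simple_loop_extension_eq_iff)
  have ct_C: "ct s \<in> C" for s
    using frac_ge_0[of s] frac_lt_1[of s] unfolding ct_def c(3)[symmetric] path_image_def by auto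
  have iter_C: "(?T ^^ j) (ct s) \<in> C" for j s
    by (induction j) (use ct_C TC in auto)
  have "continuous_on UNIV (\<lambda>s. fst (ct s))" using ct_cont by (intro continuous_intros)
  moreover have "fst (ct s) \<in> frontier K" for s
    using subsetD[OF c(4) ct_C[of s]] curve_in_frontier by (auto simp: phase_cylinder_eq phase_point_def)
  then have "(\<lambda>s. fst (ct s)) ` UNIV \<subseteq> frontier K" by blast
  ultimately obtain a where a: "continuous_on UNIV a" "\<And>s. \<gamma> (a s) = fst (ct s)"
    using continuous_lift[OF convex_UNIV] by auto
  have "\<exists>b. (a s, b) \<in> strip \<and> ct s = phase_point (a s) b" for s
    by (rule phase_point_over[OF subsetD[OF c(4) ct_C[of s]] a(2)[of s]]) blast
  then obtain b where b: "\<And>s. (a s, b s) \<in> strip" "\<And>s. ct s = phase_point (a s) (b s)" by metis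
  have "continuous_on UNIV (\<lambda>s. snd (ct s))" using ct_cont by (intro continuous_intros)
  have b_cont: "continuous_on UNIV b"
  proof (rule continuous_chord_end[OF a(1)])
    show "continuous_on UNIV (\<lambda>s. dep (a s) (b s))"
      using \<open>continuous_on UNIV (\<lambda>s. snd (ct s))\<close> by (simp add: b(2) phase_point_def)
  qed (rule b(1))
  have "\<exists>y. y 0 = a s \<and> y 1 = b s \<and> is_billiard_seq y \<and>
    (\<forall>j. (?T ^^ j) (ct s) = phase_point (y j) (y (Suc j)))" for s
    using ex_billiard_seq[OF b(1)] iter_C c(4) b(2) by (metis subsetD)
  then obtain X where X: "\<And>s. X s 0 = a s" "\<And>s. X s 1 = b s" "\<And>s. is_billiard_seq (X s)"
    "\<And>s j. (?T ^^ j) (ct s) = phase_point (X s j) (X s (Suc j))" by metis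
  have strip: "(X s j, X s (Suc j)) \<in> strip" and step: "arr (X s j) (X s (Suc j)) = dep (X s (Suc j)) (X s (Suc (Suc j)))" for s j
    using X(3) by (auto simp: is_billiard_seq_def)
  have cont2: "continuous_on UNIV (\<lambda>s. X s j) \<and> continuous_on UNIV (\<lambda>s. X s (Suc j))" for j
  proof (induction j)
    case 0
    then show ?case using a(1) b_cont X(1,2) by simp
  next
    case (Suc j)
    then have "continuous_on UNIV (\<lambda>s. arr (X s j) (X s (Suc j)))"
      using strip by (intro continuous_chord_momenta) auto
    then have "continuous_on UNIV (\<lambda>s. X s (Suc (Suc j)))"
      using Suc strip by (intro continuous_chord_end[of UNIV "\<lambda>s. X s (Suc j)" "\<lambda>s. X s (Suc (Suc j))"]) (simp_all add: step)
    then show ?case using Suc by simp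
  qed
  then have cont: "continuous_on UNIV (\<lambda>s. X s j)" for j by blast
  \<comment> \<open>Two lifted orbits whose first two terms differ by \<open>n\<close> turns differ by \<open>n\<close> turns throughout.\<close>
  have shifted: "X s' j = X s j + of_int n * P" if "X s' 0 = X s 0 + of_int n * P" "X s' 1 = X s 1 + of_int n * P" for s s' j n
    using billiard_seq_unique[OF X(3)[of s'] billiard_seq_add_period[OF X(3)[of s], of n]] that by (simp add: fun_eq_iff)
  \<comment> \<open>The number of turns after \<open>k\<close> bounces does not depend on the orbit.\<close>
  obtain r :: int where r: "\<And>s. X s k = X s 0 + of_int r * P \<and> X s (Suc k) = X s 1 + of_int r * P"
  proof -
    have *: "\<exists>n::int. X s k - X s 0 = of_int n * P \<and> X s (Suc k) - X s 1 = of_int n * P" for s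
    proof -
      have "phase_point (X s k) (X s (Suc k)) = phase_point (X s 0) (X s (Suc 0))"
        using X(4)[of k s] X(4)[of 0 s] period_k[OF ct_C] by simp
      then show ?thesis using phase_point_eq_iff[OF strip[of s 0] strip[of s k]] by auto
    qed
    have "(\<lambda>s. X s k - X s 0) constant_on UNIV"
      by (rule lift_difference_constant) (use * in \<open>auto intro!: continuous_intros cont\<close>)
    then obtain d where d: "\<And>s. X s k - X s 0 = d" by (auto simp: constant_on_def)
    obtain r :: int where r: "d = of_int r * P" using *[of 0] d by metis
    show ?thesis
    proof (rule that)
      fix s
      obtain n :: int where "X s k - X s 0 = of_int n * P" "X s (Suc k) - X s 1 = of_int n * P" using * by blast
      then show "X s k = X s 0 + of_int r * P \<and> X s (Suc k) = X s 1 + of_int r * P"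
        using d[of s] r by linarith
    qed
  qed
  have rot: "has_rotation k r (X s)" for s
  proof -
    have "(\<lambda>j. X s (j + k)) = (\<lambda>j. X s j + of_int r * P)"
      by (rule billiard_seq_unique[OF billiard_seq_drop[OF X(3)] billiard_seq_add_period[OF X(3)]]) (use r[of s] in auto)
    then show ?thesis by (simp add: has_rotation_def fun_eq_iff)
  qed
  \<comment> \<open>The number of turns of the curve around the cylinder.\<close>
  obtain w :: int where w: "\<And>s j. X (s + 1) j = X s j + of_int w * P"
  proof -
    have *: "\<exists>n::int. X (s + 1) 0 - X s 0 = of_int n * P \<and> X (s + 1) 1 - X s 1 = of_int n * P" for s
    proof -
      have "ct s = ct (s + 1)" unfolding ct_eq by (rule exI[of _ 1]) simp
      then have "phase_point (X (s+1) 0) (X (s+1) (Suc 0)) = phase_point (X s 0) (X s (Suc 0))"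
        using X(4)[of 0 s] X(4)[of 0 "s + 1"] by simp
      then show ?thesis using phase_point_eq_iff[OF strip[of s 0] strip[of "s+1" 0]] by auto
    qed
    have "(\<lambda>s. X (s + 1) 0 - X s 0) constant_on UNIV"
      by (rule lift_difference_constant)
        (use * in \<open>auto intro!: continuous_intros cont continuous_on_compose2[OF cont[of 0]]\<close>)
    then obtain d where d: "\<And>s. X (s + 1) 0 - X s 0 = d" by (auto simp: constant_on_def)
    obtain w :: int where w: "d = of_int w * P" using *[of 0] d by metis
    show ?thesis
    proof (rule that)
      fix s j
      obtain n :: int where "X (s+1) 0 - X s 0 = of_int n * P" "X (s+1) 1 - X s 1 = of_int n * P" using * by blast
      then show "X (s + 1) j = X s j + of_int w * P"
        using d[of s] w by - (rule shifted; linarith)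
    qed
  qed
  have "w \<noteq> 0"
  proof
    assume "w = 0"
    have "c s = ct s" if "s \<in> {0..1}" for s
    proof (cases "s = 1")
      case True
      then show ?thesis using c(2) by (simp add: ct_def pathfinish_def pathstart_def)
    next
      case False
      then have "frac s = s" using that by (simp add: frac_eq)
      then show ?thesis by (simp add: ct_def)
    qed
    then have "a 1 \<noteq> a 0 \<or> b 1 \<noteq> b 0"
      using c a b b_cont \<open>path c\<close>
      by (intro essential_loop_winds[of c a b]) (auto intro: continuous_on_subset)
    then show False using w[of 0 0] w[of 0 1] \<open>w = 0\<close> X(1,2) by simp
  qed
  have w_nat: "X (s + of_nat n) j = X s j + of_nat n * of_int w * P" for s n j
  proof (induction n)
    case (Suc n)
    have "X (s + of_nat (Suc n)) j = X ((s + of_nat n) + 1) j" by (simp add: algebra_simps)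
    then show ?case unfolding w Suc by (simp add: algebra_simps)
  qed simp
  have inj: "s = s'" if "X s 0 = X s' 0" "X s 1 = X s' 1" for s s'
  proof -
    have *: "s = s'" if eq: "X s 0 = X s' 0" and s': "s' = s + of_nat n" for s s' n
      using eq w_nat[of s n 0] \<open>w \<noteq> 0\<close> P_pos unfolding s' by simp
    have "ct s = ct s'" using X(4)[of 0 s] X(4)[of 0 s'] that by simp
    then obtain n :: int where n: "s' = s + of_int n" unfolding ct_eq by blast
    show ?thesis
    proof (cases "n \<ge> 0")
      case True
      then have "s' = s + of_nat (nat n)" using n by simp
      with that(1) show ?thesis by (rule *)
    next
      case False
      then have "s = s' + of_nat (nat (- n))" using n by simp
      with that(1)[symmetric] have "s' = s" by (rule *)
      then show ?thesis ..
    qed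
  qed
  have pp: "phase_point (X s 0) (X s 1) = ct s" for s using X(4)[of 0 s] by simp
  show ?thesis
  proof (cases "0 < w")
    case True
    have "orbit_family \<gamma> P \<gamma>' K k r w (\<lambda>j s. X s j)"
    proof (unfold_locales)
      show "s = s'" if "X s 0 = X s' 0" "X s 1 = X s' 1" for s s' using inj[OF that] .
    qed (use \<open>0 < k\<close> True X(3) rot cont w in auto)
    then show ?thesis by (rule that) (simp_all add: pp[simplified] ct_C X(4))
  next
    case False
    have "orbit_family \<gamma> P \<gamma>' K k r (- w) (\<lambda>j s. X (- s) j)"
    proof (unfold_locales)
      show "X (- (s + 1)) j = X (- s) j + of_int (- w) * P" for s j
        using w[of "- s - 1" j] by simp
      show "s = s'" if "X (- s) 0 = X (- s') 0" "X (- s) 1 = X (- s') 1" for s s'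
        using inj[OF that] by simp
      show "continuous_on UNIV (\<lambda>s. X (- s) j)" for j
        by (rule continuous_on_compose2[OF cont[of j]]) (auto intro: continuous_intros)
    qed (use \<open>0 < k\<close> False \<open>w \<noteq> 0\<close> X(3) rot in auto)
    then show ?thesis by (rule that) (simp_all add: pp[simplified] ct_C X(4))
  qed
qed

lemma mem_K_iff: "v \<in> K \<longleftrightarrow> v = 0 \<or> g v < 1"
proof (cases "v = 0")
  case False
  then obtain \<rho> t where "0 < \<rho>" "v = \<rho> *\<^sub>R \<gamma> t" by (rule polar_form)
  then show ?thesis using False scaled_curve_in_K_iff[of \<rho> t] gauge_curve by simp
qed (simp add: zero_in_K)

end

context symmetric_curve begin

lemma power_shift:
  assumes "\<And>t. act \<omega> (\<gamma> t) = \<gamma> (t + P / k)"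
  shows "act (\<omega> ^ n) (\<gamma> t) = \<gamma> (t + of_nat n * P / k)"
proof (induction n)
  case (Suc n)
  then show ?case by (simp add: act_mult assms add_divide_distrib algebra_simps)
qed simp

text \<open>The link between the dynamics and the gauge length: a rotationally symmetric family of chords has constant
gauge length precisely when every chord departs and arrives with the same momentum.\<close>

lemma chord_gauge_has_derivative:
  assumes "(t, t + \<rho>) \<in> strip"
  shows "((\<lambda>t. g (\<gamma> (t + \<rho>) - \<gamma> t)) has_real_derivative arr t (t + \<rho>) - dep t (t + \<rho>)) (at t)"
proof -
  have "((\<lambda>s. s + \<rho>) has_vector_derivative 1) (at t)" by (auto intro!: derivative_eq_intros)
  from vector_diff_chain_at[OF this deriv] have "((\<lambda>s. \<gamma> (s + \<rho>)) has_vector_derivative \<gamma>' (t + \<rho>)) (at t)"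
    by (simp add: o_def)
  then have "((\<lambda>s. \<gamma> (s + \<rho>) - \<gamma> s) has_vector_derivative \<gamma>' (t + \<rho>) - \<gamma>' t) (at t)"
    by (intro derivative_intros deriv)
  moreover have "\<gamma> (t + \<rho>) - \<gamma> t \<noteq> 0" using assms curve_neq by (auto simp: strip_iff)
  ultimately show ?thesis
    using gauge_comp_has_derivative unfolding arr_def dep_def inner_diff_right[symmetric] by blast
qed

text \<open>By \<open>steps_equal\<close> every bounce on the curve is the rotation by \<open>\<eta>\<close>. The arrival
momentum of a chord is the departure momentum of its rotated copy, hence its own departure momentum, and the
gauge length of the chord does not depend on \<open>t\<close>. Minimality of the period makes
\<open>\<eta>\<close> primitive.\<close>

lemma periodic_curve_imp_chord_gauge_constant:
  assumes C: "curve_of_periodic_orbits K \<gamma> k C"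
  obtains \<eta> \<kappa> where "is_primitive_root k \<eta>" "act \<eta> ` K = K" "0 < \<kappa>" "\<And>t. g (act (\<eta> - 1) (\<gamma> t)) = \<kappa>"
proof -
  have "0 < k" using k_ge_3 by simp
  obtain r w x where fam: "orbit_family \<gamma> P \<gamma>' K k r w x" and x_C: "\<And>s. phase_point (x 0 s) (x 1 s) \<in> C"
    and track: "\<And>s j. (billiard_map K \<gamma> ^^ j) (phase_point (x 0 s) (x 1 s)) = phase_point (x j s) (x (Suc j) s)"
    using periodic_curve_orbit_family[OF C \<open>0 < k\<close>] by metis
  interpret orbit_family \<gamma> P \<gamma>' K k r w x by (rule fam)
  obtain \<omega> where \<omega>: "is_primitive_root k \<omega>" "act \<omega> ` K = K" "\<And>t. act \<omega> (\<gamma> t) = \<gamma> (t + P / k)" by (rule ex_generator) blast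
  have "0 < r"
  proof -
    have "x 0 0 < x k 0" using billiard_seq_mono[OF orbits \<open>0 < k\<close>] .
    also have "x k 0 = x 0 0 + of_int r * P" using rotation[of 0] unfolding has_rotation_def by (metis add_0)
    finally show ?thesis using P_pos by (simp add: zero_less_mult_iff)
  qed
  define n where "n = nat r"
  have n: "of_int r = real n" using \<open>0 < r\<close> by (simp add: n_def)
  define \<rho> where "\<rho> = real n * P / k"
  define \<eta> where "\<eta> = \<omega> ^ n"
  have \<eta>K: "act \<eta> ` K = K" using invariant_power[OF \<omega>(2)] by (simp add: \<eta>_def)
  have \<eta>k: "\<eta> ^ k = 1" using \<omega>(1) unfolding \<eta>_def is_primitive_root_def by (metis mult.commute power_mult power_one)
  have sym: "is_symmetry (act \<eta>)" using act_symmetry[OF norm_root_of_unity[OF \<open>0 < k\<close> \<eta>k] \<eta>K] .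
  have shift: "act \<eta> (\<gamma> t) = \<gamma> (t + \<rho>)" for t unfolding \<eta>_def \<rho>_def by (rule power_shift[OF \<omega>(3)])
  have step: "x (Suc j) s = x j s + \<rho>" for j s
    using steps_equal[of j s] momenta_shift[OF sym shift] unfolding \<rho>_def n by blast
  have iterate: "x j s = x 0 s + of_nat j * \<rho>" for j s
    by (induction j) (simp_all add: step algebra_simps)
  have strip: "(t, t + \<rho>) \<in> strip" and eq: "arr t (t + \<rho>) = dep t (t + \<rho>)" for t
  proof -
    obtain s where s: "x 0 s = t" by (rule family_surj)
    show "(t, t + \<rho>) \<in> strip" using orbits[of s] step[of 0 s] s unfolding is_billiard_seq_def by metis
    have "arr t (t + \<rho>) = dep (t + \<rho>) (t + \<rho> + \<rho>)"
      using orbits[of s] step[of 0 s] step[of "Suc 0" s] s unfolding is_billiard_seq_def by metis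
    also have "\<dots> = dep t (t + \<rho>)" using momenta_shift[OF sym shift \<open>(t, t + \<rho>) \<in> strip\<close>] by simp
    finally show "arr t (t + \<rho>) = dep t (t + \<rho>)" .
  qed
  have chord: "act (\<eta> - 1) (\<gamma> t) = \<gamma> (t + \<rho>) - \<gamma> t" for t by (simp add: act_diff shift)
  have "((\<lambda>t. g (\<gamma> (t + \<rho>) - \<gamma> t)) has_real_derivative 0) (at t)" for t
    using chord_gauge_has_derivative[OF strip] eq by simp
  then have const: "g (\<gamma> (t + \<rho>) - \<gamma> t) = g (\<gamma> (0 + \<rho>) - \<gamma> 0)" for t
    using DERIV_isconst_all[of "\<lambda>t. g (\<gamma> (t + \<rho>) - \<gamma> t)"] by blast
  show ?thesis
  proof (rule that[OF _ \<eta>K])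
    have "\<gamma> (0 + \<rho>) - \<gamma> 0 \<noteq> 0" using strip[of 0] curve_neq[of 0 \<rho>] by (auto simp: strip_iff)
    then show "0 < g (\<gamma> (0 + \<rho>) - \<gamma> 0)" by (rule gauge_pos)
    show "g (act (\<eta> - 1) (\<gamma> t)) = g (\<gamma> (0 + \<rho>) - \<gamma> 0)" for t unfolding chord by (rule const)
    have "\<eta> ^ j \<noteq> 1" if j: "0 < j" "j < k" for j
    proof
      assume "\<eta> ^ j = 1"
      have pow: "act (\<eta> ^ i) (\<gamma> t) = \<gamma> (t + of_nat i * \<rho>)" for i t
        by (induction i) (simp_all add: act_mult shift algebra_simps)
      have "\<gamma> (x 0 0) = \<gamma> (x 0 0 + of_nat j * \<rho>)" using pow[of j "x 0 0"] \<open>\<eta> ^ j = 1\<close> by simp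
      then obtain m :: int where m: "of_nat j * \<rho> = of_int m * P" unfolding curve_eq_iff by auto
      have "phase_point (x 0 0) (x 1 0) = phase_point (x j 0) (x (Suc j) 0)"
      proof -
        have "x 1 0 = x 0 0 + \<rho>" "x j 0 = x 0 0 + of_int m * P" "x (Suc j) 0 = x 0 0 + of_int m * P + \<rho>"
          using iterate[of 1 0] iterate[of j 0] step[of j 0] m by simp_all
        then show ?thesis
          using phase_point_eq_iff[OF strip[of "x 0 0"] strip[of "x 0 0 + of_int m * P"]] by auto
      qed
      then have "(billiard_map K \<gamma> ^^ j) (phase_point (x 0 0) (x 1 0)) = phase_point (x 0 0) (x 1 0)"
        using track[of j 0] by simp
      then show False using C x_C[of 0] j unfolding curve_of_periodic_orbits_def by blast
    qed
    then show "is_primitive_root k \<eta>" using \<eta>k \<open>0 < k\<close> by (simp add: is_primitive_root_def)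
  qed
qed

lemma invariant_gauge:
  assumes "act z ` K = K" "z \<noteq> 0"
  shows "g (act z v) = g v"
proof -
  have *: "act z u \<in> K \<longleftrightarrow> u \<in> K" for u
  proof
    assume "act z u \<in> K"
    then obtain w where w: "w \<in> K" "act z u = act z w" using assms(1) by blast
    then have "act z (u - w) = 0" by (simp add: linear_diff[OF linear_act])
    then show "u \<in> K" using w assms(2) by (simp add: act_eq_0_iff)
  qed (use assms(1) in blast)
  have "act z v \<in> (\<lambda>y. r *\<^sub>R y) ` K \<longleftrightarrow> v \<in> (\<lambda>y. r *\<^sub>R y) ` K" if "0 < r" for r
  proof -
    have scale: "u \<in> (\<lambda>y. r *\<^sub>R y) ` K \<longleftrightarrow> (1 / r) *\<^sub>R u \<in> K" for u
      using that by (force simp: image_iff)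
    show ?thesis unfolding scale using *[of "(1/r) *\<^sub>R v"] linear_scale[OF linear_act] by metis
  qed
  then have "{r. 0 < r \<and> act z v \<in> (\<lambda>y. r *\<^sub>R y) ` K} = {r. 0 < r \<and> v \<in> (\<lambda>y. r *\<^sub>R y) ` K}" by blast
  then show ?thesis unfolding gauge_fun_def by simp
qed

text \<open>Since \<open>\<kappa>\<close> is the gauge of all the vectors \<open>(\<eta> - 1) \<gamma> t\<close>,
multiplication by \<open>\<sigma> = (\<eta> - 1) / \<kappa>\<close> preserves the gauge. Its square is
\<open>- c \<eta>\<close> with \<open>c > 0\<close>, so that its \<open>4 k\<close>-th power is the homothety
by \<open>c ^ (2 k)\<close>, which preserves the gauge only for \<open>c = 1\<close>.\<close>

lemma periodic_curve_imp_symmetry: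
  assumes C: "curve_of_periodic_orbits K \<gamma> k C" and a: "a = (if k mod 4 = 2 then 1 else if k mod 4 = 0 then 2 else 4)"
  obtains z where "map_order (act z) (a * k)" "act z ` K = K"
proof (cases "k mod 4 = 2")
  case True
  then have "map_order (act \<zeta>) (a * k)" using primitive unfolding a map_order_act is_primitive_root_def by simp
  then show ?thesis using that invariant by blast
next
  case False
  obtain \<eta> \<kappa> where \<eta>: "is_primitive_root k \<eta>" "act \<eta> ` K = K" "0 < \<kappa>" "\<And>t. g (act (\<eta> - 1) (\<gamma> t)) = \<kappa>"
    using periodic_curve_imp_chord_gauge_constant[OF C] by metis
  define \<sigma> where "\<sigma> = (\<eta> - 1) / of_real \<kappa>"
  have "\<eta> \<noteq> 1" using \<eta>(1) k_ge_3 unfolding is_primitive_root_def by (metis less_le_trans one_less_numeral_iff power_one_right semiring_norm(77) zero_less_one)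
  then have "\<sigma> \<noteq> 0" using \<eta>(3) by (simp add: \<sigma>_def)
  have "norm \<eta> = 1" using norm_root_of_unity \<eta>(1) unfolding is_primitive_root_def by blast
  have act\<sigma>: "act \<sigma> v = (1 / \<kappa>) *\<^sub>R act (\<eta> - 1) v" for v
  proof -
    have "\<sigma> = of_real (1 / \<kappa>) * (\<eta> - 1)" by (simp add: \<sigma>_def)
    then show ?thesis by (simp only: act_mult act_of_real)
  qed
  have g\<sigma>: "g (act \<sigma> v) = g v" if v0: "v \<noteq> 0" for v
  proof -
    obtain \<rho> t where v: "0 < \<rho>" "v = \<rho> *\<^sub>R \<gamma> t" using polar_form[OF v0] .
    have nz: "act (\<eta> - 1) (\<gamma> t) \<noteq> 0" using \<open>\<eta> \<noteq> 1\<close> curve_nonzero by (simp add: act_eq_0_iff)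
    have "g (act \<sigma> v) = g ((\<rho> / \<kappa>) *\<^sub>R act (\<eta> - 1) (\<gamma> t))"
      unfolding act\<sigma> v by (simp add: linear_scale[OF linear_act])
    also have "\<dots> = \<rho>" using gauge_scale[OF _ nz, of "\<rho> / \<kappa>"] v \<eta>(3,4) by simp
    finally show ?thesis using v gauge_curve by simp
  qed
  have mem: "act \<sigma> v \<in> K \<longleftrightarrow> v \<in> K" for v
    using g\<sigma>[of v] \<open>\<sigma> \<noteq> 0\<close> by (cases "v = 0") (auto simp: mem_K_iff act_eq_0_iff)
  have \<sigma>K: "act \<sigma> ` K = K"
  proof (intro equalityI subsetI)
    fix v assume "v \<in> K"
    have "v = act \<sigma> (act (inverse \<sigma>) v)" using \<open>\<sigma> \<noteq> 0\<close> by (simp flip: act_mult)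
    then show "v \<in> act \<sigma> ` K" using mem[of "act (inverse \<sigma>) v"] \<open>v \<in> K\<close> by (metis image_eqI)
  qed (use mem in auto)
  define c where "c = (norm (\<eta> - 1) / \<kappa>)\<^sup>2"
  have "c > 0" using \<open>\<eta> \<noteq> 1\<close> \<eta>(3) by (simp add: c_def)
  have \<sigma>2: "\<sigma>\<^sup>2 = - \<eta> * of_real c"
    using root_of_unity_minus_one_square[OF \<open>norm \<eta> = 1\<close>] unfolding \<sigma>_def c_def by (simp add: power_divide)
  have "\<sigma> ^ (4 * k) = (\<sigma>\<^sup>2) ^ (2 * k)" by (simp flip: power_mult)
  also have "\<dots> = of_real (c ^ (2 * k)) * (\<eta> ^ k)\<^sup>2" unfolding \<sigma>2 by (simp add: power_mult_distrib mult.commute flip: power_mult)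
  also have "\<dots> = of_real (c ^ (2 * k))" using \<eta>(1) by (simp add: is_primitive_root_def)
  finally have \<sigma>4: "\<sigma> ^ (4 * k) = of_real (c ^ (2 * k))" .
  \<comment> \<open>Compare the homothety and the invariance of the gauge at one point.\<close>
  have "c ^ (2 * k) * g (\<gamma> 0) = g (act (\<sigma> ^ (4 * k)) (\<gamma> 0))"
    unfolding \<sigma>4 act_of_real using \<open>c > 0\<close> gauge_scale curve_nonzero by simp
  also have "\<dots> = g (\<gamma> 0)" by (rule invariant_gauge[OF invariant_power[OF \<sigma>K]]) (simp add: \<open>\<sigma> \<noteq> 0\<close>)
  finally have "c ^ (2 * k) = 1" using gauge_pos[OF curve_nonzero, of 0] by simp
  then have "c = 1" using \<open>c > 0\<close> k_ge_3 power_eq_1_iff[of c "2 * k"] by simp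
  then have "\<sigma>\<^sup>2 = - \<eta>" using \<sigma>2 by simp
  then have "is_primitive_root (a * k) \<sigma>" using half_order_root[OF \<eta>(1) k_ge_3 _ False a] by blast
  then show ?thesis using that \<sigma>K unfolding map_order_act is_primitive_root_def by blast
qed

end

section \<open>A symmetry produces periodic invariant curves\<close>

context convex_curve begin

text \<open>The projection to the boundary followed by \<open>circle_coord\<close> turns this loop into the standard loop
of the unit circle, so that a contraction of it would contract the circle.\<close>

lemma constant_chord_curve_essential:
  assumes "0 < \<rho>" "\<rho> < P"
  defines "c \<equiv> (\<lambda>s. phase_point (P * s) (P * s + \<rho>))"
  shows "simple_path c" "pathfinish c = pathstart c" "path_image c = range (\<lambda>t. phase_point t (t + \<rho>))"
    "path_image c \<subseteq> phase_cylinder K \<gamma>" "\<not> (\<exists>a. homotopic_loops (phase_cylinder K \<gamma>) c (linepath a a))"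
proof -
  have strip: "(t, t + \<rho>) \<in> strip" for t using assms by (simp add: strip_iff)
  have "continuous_on {0..1} (\<lambda>s. (\<lambda>(t, u). phase_point t u) (P * s, P * s + \<rho>))"
    by (rule continuous_on_compose2[OF continuous_phase_point]) (auto intro!: continuous_intros simp: strip)
  then have path: "path c" by (simp add: path_def c_def)
  have eq: "c s = c s' \<longleftrightarrow> (\<exists>n::int. s' = s + of_int n)" for s s'
  proof -
    have "c s = c s' \<longleftrightarrow> (\<exists>n::int. P * s' = P * s + of_int n * P)"
      unfolding c_def phase_point_eq_iff[OF strip strip] by auto
    also have "\<dots> \<longleftrightarrow> (\<exists>n::int. s' = s + of_int n)"
    proof (rule iff_exI)
      fix n :: int
      have "P * s + of_int n * P = P * (s + of_int n)" by (simp add: algebra_simps)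
      then show "P * s' = P * s + of_int n * P \<longleftrightarrow> s' = s + of_int n" using P_pos by simp
    qed
    finally show ?thesis .
  qed
  have "loop_free c" unfolding loop_free_def
  proof (intro ballI impI)
    fix x y :: real assume xy: "x \<in> {0..1}" "y \<in> {0..1}" "c x = c y"
    then obtain n :: int where n: "y = x + of_int n" using eq by blast
    then have "-1 \<le> n" "n \<le> 1" using xy by auto
    then have "n = -1 \<or> n = 0 \<or> n = 1" by presburger
    then show "x = y \<or> x = 0 \<and> y = 1 \<or> x = 1 \<and> y = 0" using n xy by auto
  qed
  then show "simple_path c" using path by (simp add: simple_path_def)
  show loop: "pathfinish c = pathstart c" unfolding pathfinish_def pathstart_def eq by (rule exI[of _ "-1"]) simp
  show image: "path_image c = range (\<lambda>t. phase_point t (t + \<rho>))"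
  proof (intro equalityI subsetI)
    fix p assume "p \<in> range (\<lambda>t. phase_point t (t + \<rho>))"
    then obtain t where "p = c (t / P)" using P_pos by (auto simp: c_def)
    moreover have "c (t / P) = c (frac (t / P))" unfolding eq frac_def by (rule exI[of _ "- \<lfloor>t / P\<rfloor>"]) simp
    ultimately show "p \<in> path_image c"
      using frac_ge_0[of "t / P"] frac_lt_1[of "t / P"] unfolding path_image_def by auto
  qed (auto simp: path_image_def c_def)
  show sub: "path_image c \<subseteq> phase_cylinder K \<gamma>"
    unfolding image phase_cylinder_eq using imageI[OF strip, of "\<lambda>(t, u). phase_point t u"] by auto
  show "\<not> (\<exists>a. homotopic_loops (phase_cylinder K \<gamma>) c (linepath a a))"
  proof
    assume "\<exists>a. homotopic_loops (phase_cylinder K \<gamma>) c (linepath a a)"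
    then obtain a where a: "homotopic_loops (phase_cylinder K \<gamma>) c (linepath a a)" by blast
    let ?h = "circle_coord \<circ> fst"
    have fst: "fst ` phase_cylinder K \<gamma> \<subseteq> frontier K"
      unfolding phase_cylinder_eq using curve_in_frontier by (auto simp: phase_point_def)
    have "continuous_on (phase_cylinder K \<gamma>) ?h"
      using fst by (intro continuous_on_compose continuous_on_subset[OF continuous_circle_coord] continuous_intros)
    moreover have "?h \<in> phase_cylinder K \<gamma> \<rightarrow> sphere 0 1" by (simp add: circle_coord_def)
    ultimately have "homotopic_loops (sphere 0 1) (?h \<circ> c) (?h \<circ> linepath a a)"
      using a by (intro homotopic_loops_continuous_image)
    then have hom: "homotopic_with_canon (\<lambda>h. True) (sphere 0 1) (sphere 0 1)
        ((?h \<circ> c) \<circ> (\<lambda>z. Arg2pi z / (2 * pi))) ((?h \<circ> linepath a a) \<circ> (\<lambda>z. Arg2pi z / (2 * pi)))"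
      by (rule homotopic_loops_imp_homotopic_circlemaps)
    have "homotopic_with_canon (\<lambda>h. True) (sphere 0 1) (sphere 0 1) id (\<lambda>z. ?h a)"
    proof (rule homotopic_with_eq[OF hom])
      fix z :: complex assume "z \<in> topspace (top_of_set (sphere 0 1))"
      then have "norm z = 1" by simp
      then have "z = exp (\<i> * Arg2pi z)" using Arg2pi_eq[of z] by simp
      moreover have "?h (c (Arg2pi z / (2 * pi))) = cis (Arg2pi z)"
        using P_pos by (simp add: c_def phase_point_def circle_coord_curve)
      ultimately show "id z = ((?h \<circ> c) \<circ> (\<lambda>z. Arg2pi z / (2 * pi))) z" by (simp add: cis_conv_exp)
    qed (auto simp: linepath_def simp flip: scaleR_add_left)
    then have "contractible (sphere (0::complex) 1)" unfolding contractible_def by blast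
    then show False by (simp add: contractible_sphere)
  qed
qed

end

context symmetric_curve begin

text \<open>Multiplication by \<open>\<sigma> = (\<eta> - 1) / \<bar>\<eta> - 1\<bar>\<close> preserves \<open>K\<close>,
because \<open>\<sigma>\<close> is a root of unity whose order divides \<open>a k\<close> and hence a power of
\<open>\<beta>\<close>. So the chords from \<open>\<gamma> t\<close> to \<open>\<eta> \<gamma> t\<close> all
have gauge \<open>\<bar>\<eta> - 1\<bar>\<close>. Differentiating, every chord arrives with the momentum with
which it departs, which by symmetry is the one with which its rotated copy departs.\<close>

lemma symmetry_imp_periodic_curve:
  assumes a: "a = (if k mod 4 = 2 then 1 else if k mod 4 = 0 then 2 else 4)"
    and \<beta>: "is_primitive_root (a * k) \<beta>" "act \<beta> ` K = K" and r: "0 < r" "r < k" "coprime r k"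
  obtains C where "curve_of_periodic_orbits K \<gamma> k C" "has_rotation_number K \<gamma> P C (real r / real k)"
proof -
  let ?T = "billiard_map K \<gamma>"
  have "0 < k" using k_ge_3 by simp
  obtain \<omega> where \<omega>: "is_primitive_root k \<omega>" "act \<omega> ` K = K" "\<And>t. act \<omega> (\<gamma> t) = \<gamma> (t + P / k)" by (rule ex_generator) blast
  define \<rho> where "\<rho> = real r * P / k"
  have \<rho>: "0 < \<rho>" "\<rho> < P" using r P_pos \<open>0 < k\<close> by (simp_all add: \<rho>_def field_simps)
  define \<eta> where "\<eta> = \<omega> ^ r"
  have \<eta>K: "act \<eta> ` K = K" using invariant_power[OF \<omega>(2)] by (simp add: \<eta>_def)
  have shift: "act \<eta> (\<gamma> t) = \<gamma> (t + \<rho>)" for t unfolding \<eta>_def \<rho>_def by (rule power_shift[OF \<omega>(3)])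
  have pow: "act (\<eta> ^ i) (\<gamma> t) = \<gamma> (t + of_nat i * \<rho>)" for i t
    by (induction i) (simp_all add: act_mult shift algebra_simps)
  have not_period: "of_nat j * \<rho> \<noteq> of_int m * P" if j: "0 < j" "j < k" for j m
  proof
    assume "of_nat j * \<rho> = of_int m * P"
    then have "real (j * r) * P = of_int (m * int k) * P" using \<open>0 < k\<close> by (simp add: \<rho>_def field_simps)
    then have "real (j * r) = of_int (m * int k)" using P_pos by simp
    then have "int (j * r) = m * int k" by (metis of_int_eq_iff of_int_of_nat_eq)
    then have "int k dvd int (j * r)" by simp
    then have "k dvd j * r" by (simp only: int_dvd_int_iff)
    then have "k dvd j" using r(3) by (simp add: coprime_commute coprime_dvd_mult_left_iff)
    then show False using j by (auto dest: dvd_imp_le)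
  qed
  have \<eta>k: "\<eta> ^ k = 1" using \<omega>(1) unfolding \<eta>_def is_primitive_root_def by (metis mult.commute power_mult power_one)
  have "\<eta> ^ j \<noteq> 1" if j: "0 < j" "j < k" for j
  proof
    assume "\<eta> ^ j = 1"
    then have "\<gamma> 0 = \<gamma> (0 + of_nat j * \<rho>)" using pow[of j 0] by simp
    then show False using not_period[OF j] unfolding curve_eq_iff by auto
  qed
  then have \<eta>: "is_primitive_root k \<eta>" using \<eta>k \<open>0 < k\<close> by (simp add: is_primitive_root_def)
  have "\<eta> \<noteq> 1" using \<open>\<And>j. 0 < j \<Longrightarrow> j < k \<Longrightarrow> \<eta> ^ j \<noteq> 1\<close>[of 1] k_ge_3 by simp
  have norm: "norm \<eta> = 1" using norm_root_of_unity[OF \<open>0 < k\<close> \<eta>k] .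
  have symmetry: "is_symmetry (act \<eta>)" using act_symmetry[OF norm \<eta>K] .
  define \<kappa> \<sigma> where "\<kappa> = norm (\<eta> - 1)" and "\<sigma> = (\<eta> - 1) / of_real \<kappa>"
  have "0 < \<kappa>" using \<open>\<eta> \<noteq> 1\<close> by (simp add: \<kappa>_def)
  have \<sigma>2: "\<sigma>\<^sup>2 = - \<eta>"
    unfolding \<sigma>_def power_divide root_of_unity_minus_one_square[OF norm] \<kappa>_def[symmetric] using \<open>0 < \<kappa>\<close> by simp
  then have "\<sigma> \<noteq> 0" using norm by auto
  have "\<sigma> ^ (a * k) = 1" by (rule half_chord_power[OF k_ge_3 \<eta> \<sigma>2 a])
  then obtain i where "\<sigma> = \<beta> ^ i" using primitive_root_powers[OF \<beta>(1)] by blast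
  then have \<sigma>K: "act \<sigma> ` K = K" using invariant_power[OF \<beta>(2)] by simp
  have strip: "(t, t + \<rho>) \<in> strip" for t using \<rho> by (simp add: strip_iff)
  have const: "g (\<gamma> (t + \<rho>) - \<gamma> t) = \<kappa>" for t
  proof -
    have "\<gamma> (t + \<rho>) - \<gamma> t = act (of_real \<kappa> * \<sigma>) (\<gamma> t)" using \<open>0 < \<kappa>\<close> by (simp add: \<sigma>_def act_diff shift)
    also have "\<dots> = \<kappa> *\<^sub>R act \<sigma> (\<gamma> t)" by (simp only: act_mult act_of_real)
    finally have "g (\<gamma> (t + \<rho>) - \<gamma> t) = \<kappa> * g (act \<sigma> (\<gamma> t))"
      using gauge_scale[OF \<open>0 < \<kappa>\<close>] \<open>\<sigma> \<noteq> 0\<close> curve_nonzero by (simp add: act_eq_0_iff)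
    also have "g (act \<sigma> (\<gamma> t)) = 1"
      using invariant_gauge[OF \<sigma>K \<open>\<sigma> \<noteq> 0\<close>] gauge_curve[of 1 t] by simp
    finally show ?thesis by simp
  qed
  have arr_dep: "arr t (t + \<rho>) = dep (t + \<rho>) (t + \<rho> + \<rho>)" for t
  proof -
    have "arr t (t + \<rho>) - dep t (t + \<rho>) = 0"
      using chord_gauge_has_derivative[OF strip, of t] unfolding const by (metis DERIV_const DERIV_unique)
    then show ?thesis using momenta_shift[OF symmetry shift strip] by simp
  qed
  define D where "D t = phase_point t (t + \<rho>)" for t
  have T: "?T (D t) = D (t + \<rho>)" for t
    unfolding D_def billiard_map_phase_point[OF strip] by (simp add: phase_point_def arr_dep)
  have T_iter: "(?T ^^ n) (D t) = D (t + of_nat n * \<rho>)" for n t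
    by (induction n) (simp_all add: T algebra_simps)
  have D_eq: "D t = D u \<longleftrightarrow> (\<exists>n::int. u = t + of_int n * P)" for t u
    unfolding D_def phase_point_eq_iff[OF strip strip] by auto
  have inv: "rotational_invariant_curve K \<gamma> (range D)"
    unfolding rotational_invariant_curve_def
  proof
    show "\<exists>c. simple_path c \<and> pathfinish c = pathstart c \<and> path_image c = range D \<and> range D \<subseteq> phase_cylinder K \<gamma> \<and>
        \<not> (\<exists>a. homotopic_loops (phase_cylinder K \<gamma>) c (linepath a a))"
      using constant_chord_curve_essential[OF \<rho>] unfolding D_def by metis
    have "?T ` range D = range (\<lambda>t. D (t + \<rho>))" by (simp add: image_image T)
    also have "\<dots> = range D"
    proof -
      have "D t = D ((t - \<rho>) + \<rho>)" for t by simp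
      then show ?thesis by blast
    qed
    finally show "?T ` range D = range D" .
  qed
  have periodic: "(?T ^^ k) (D t) = D t" for t
  proof -
    have "D t = D (t + of_nat k * \<rho>)" unfolding D_eq
      by (rule exI[of _ "int r"]) (use \<open>0 < k\<close> in \<open>simp add: \<rho>_def\<close>)
    then show ?thesis unfolding T_iter by (rule sym)
  qed
  have minimal: "(?T ^^ j) (D t) \<noteq> D t" if j: "0 < j" "j < k" for j t
  proof
    assume "(?T ^^ j) (D t) = D t"
    then have "D t = D (t + of_nat j * \<rho>)" by (simp add: T_iter)
    then show False using not_period[OF j] unfolding D_eq by auto
  qed
  have "curve_of_periodic_orbits K \<gamma> k (range D)"
    unfolding curve_of_periodic_orbits_def using inv periodic minimal \<open>0 < k\<close> by blast
  moreover have "has_rotation_number K \<gamma> P (range D) (real r / real k)"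
    unfolding has_rotation_number_def
  proof (intro ballI)
    fix x assume "x \<in> range D"
    then obtain t0 where x: "x = D t0" by blast
    let ?t = "\<lambda>n. t0 + of_nat n * \<rho>"
    have "\<gamma> (?t n) = fst ((?T ^^ n) x) \<and> ?t n < ?t (Suc n) \<and> ?t (Suc n) < ?t n + P" for n
      unfolding x T_iter using \<rho> by (simp add: D_def phase_point_def algebra_simps)
    moreover have "(\<lambda>n. (?t n - ?t 0) / (real n * P)) \<longlonglongrightarrow> real r / real k"
    proof (rule tendsto_eventually)
      show "\<forall>\<^sub>F n in sequentially. (?t n - ?t 0) / (real n * P) = real r / real k"
        using eventually_gt_at_top[of 0] by eventually_elim (use P_pos \<open>0 < k\<close> in \<open>simp add: \<rho>_def field_simps\<close>)
    qed
    ultimately show "\<exists>t. (\<forall>n. \<gamma> (t n) = fst ((?T ^^ n) x) \<and> t n < t (Suc n) \<and> t (Suc n) < t n + P) \<and>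
        (\<lambda>n. (t n - t 0) / (real n * P)) \<longlonglongrightarrow> real r / real k"
      by (intro exI[of _ ?t]) blast
  qed
  ultimately show ?thesis by (rule that)
qed

end

section \<open>Parametrization by the gauge\<close>

text \<open>The Jordan-Brouwer theorem provides a bounded component of the complement whose frontier is the curve. A
convex inside is connected and therefore is that component.\<close>

lemma simple_loop_inside:
  fixes c :: "real \<Rightarrow> real^2"
  assumes c: "simple_path c" "pathfinish c = pathstart c" and conv: "convex (inside (path_image c))"
  shows "inside (path_image c) \<noteq> {}" and "frontier (inside (path_image c)) = path_image c"
proof -
  let ?S = "path_image c"
  have "?S homeomorphic sphere (0::complex) 1" using c by (intro homeomorphic_simple_path_image_circle) auto
  moreover have "sphere (0::complex) 1 homeomorphic sphere (0::real^2) 1" by (rule homeomorphic_spheres_gen) auto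
  ultimately have hom: "?S homeomorphic sphere (0::real^2) 1" by (rule homeomorphic_trans)
  have "bounded ?S" using c(1) by (rule bounded_simple_path_image)
  have "\<not> connected (- ?S)" using Jordan_Brouwer_separation[OF hom] by simp
  then obtain C where C: "C \<in> components (- ?S)" "bounded C"
    using cobounded_has_bounded_component[of "- ?S"] \<open>bounded ?S\<close> by (auto simp: DIM_cart)
  then obtain x where x: "x \<in> - ?S" "C = connected_component_set (- ?S) x" by (auto simp: components_def)
  have sub: "C \<subseteq> inside ?S"
  proof
    fix y assume "y \<in> C"
    then have "connected_component_set (- ?S) y = C" using x(2) connected_component_eq by metis
    moreover have "y \<in> - ?S" using C(1) \<open>y \<in> C\<close> in_components_subset by blast
    ultimately show "y \<in> inside ?S" using C(2) by (simp add: inside_def)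
  qed
  have "C \<noteq> {}" using C(1) in_components_nonempty by blast
  then show "inside ?S \<noteq> {}" using sub by blast
  have "inside ?S \<subseteq> C"
  proof (rule components_maximal[OF C(1)])
    show "connected (inside ?S)" using conv by (rule convex_connected)
    show "inside ?S \<subseteq> - ?S" using inside_no_overlap by blast
    show "C \<inter> inside ?S \<noteq> {}" using sub \<open>C \<noteq> {}\<close> by blast
  qed
  then have "inside ?S = C" using sub by blast
  then show "frontier (inside ?S) = ?S" using Jordan_Brouwer_frontier[OF hom C(1)] by simp
qed

lemma (in closed_curve) curve_simple_path:
  assumes "continuous_on UNIV \<gamma>"
  shows "simple_path (\<lambda>s. \<gamma> (P * s))" "pathfinish (\<lambda>s. \<gamma> (P * s)) = pathstart (\<lambda>s. \<gamma> (P * s))"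
    "path_image (\<lambda>s. \<gamma> (P * s)) = range \<gamma>"
proof -
  have "path (\<lambda>s. \<gamma> (P * s))" unfolding path_def
    by (rule continuous_on_compose2[OF assms]) (auto intro: continuous_intros)
  moreover have "loop_free (\<lambda>s. \<gamma> (P * s))" unfolding loop_free_def
  proof (intro ballI impI)
    fix x y :: real assume xy: "x \<in> {0..1}" "y \<in> {0..1}" "\<gamma> (P * x) = \<gamma> (P * y)"
    then obtain n :: int where "P * y = P * x + of_int n * P" using curve_eq_iff by blast
    also have "\<dots> = P * (x + of_int n)" by (simp add: algebra_simps)
    finally have n: "y = x + of_int n" using P_pos by simp
    then have "-1 \<le> n" "n \<le> 1" using xy by auto
    then have "n = -1 \<or> n = 0 \<or> n = 1" by presburger
    then show "x = y \<or> x = 0 \<and> y = 1 \<or> x = 1 \<and> y = 0" using n xy by auto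
  qed
  ultimately show "simple_path (\<lambda>s. \<gamma> (P * s))" by (simp add: simple_path_def)
  show "pathfinish (\<lambda>s. \<gamma> (P * s)) = pathstart (\<lambda>s. \<gamma> (P * s))"
    using period[of 0] by (simp add: pathfinish_def pathstart_def)
  have "(*) P ` {0..1} = {0..P}" using P_pos by (simp add: image_mult_atLeastAtMost)
  then have "\<gamma> ` ((*) P ` {0..1}) = range \<gamma>" using range_eq_image by simp
  then show "path_image (\<lambda>s. \<gamma> (P * s)) = range \<gamma>" by (simp add: path_image_def image_image)
qed

lemma C2_imp_closed_curve: "C2_closed_curve \<gamma> P \<Longrightarrow> closed_curve \<gamma> P"
  by (auto simp: C2_closed_curve_def closed_curve_def)

lemma vector_derivative_continuous:
  assumes "\<And>t. (f has_vector_derivative f' t) (at t)"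
  shows "continuous_on UNIV f"
  by (meson assms continuous_at_imp_continuous_on has_vector_derivative_continuous)

lemma strictly_convex_curve_inside:
  assumes "strictly_convex_C2_curve \<gamma> P"
  defines "K \<equiv> inside (range \<gamma>)"
  shows "open K" "convex K" "bounded K" "K \<noteq> {}" "strictly_convex_set K" "frontier K = range \<gamma>"
proof -
  have C2: "C2_closed_curve \<gamma> P" and sc: "strictly_convex_set K"
    using assms by (auto simp: strictly_convex_C2_curve_def)
  interpret closed_curve \<gamma> P using C2 by (rule C2_imp_closed_curve)
  have cont: "continuous_on UNIV \<gamma>" using C2 vector_derivative_continuous unfolding C2_closed_curve_def by metis
  note c = curve_simple_path[OF cont]
  show "strictly_convex_set K" by (rule sc)
  then show "convex K" by (simp add: strictly_convex_set_def)
  then show "K \<noteq> {}" "frontier K = range \<gamma>"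
    using simple_loop_inside[OF c(1,2)] c(3) by (simp_all add: K_def)
  have "bounded (range \<gamma>)" "closed (range \<gamma>)"
    using bounded_simple_path_image[OF c(1)] closed_simple_path_image[OF c(1)] c(3) by simp_all
  then show "bounded K" "open K" unfolding K_def by (simp_all add: bounded_inside open_inside)
qed

lemma unit_gauge_param_imp_unit_curve:
  assumes K: "open K" "convex K" "bounded K" "0 \<in> K" "strictly_convex_set K" and \<gamma>: "unit_gauge_param K \<gamma> P"
  obtains \<gamma>' where "unit_curve \<gamma> P \<gamma>' K"
proof -
  have C2: "C2_closed_curve \<gamma> P" and range: "range \<gamma> = frontier K"
    and speed: "\<And>t. gauge_fun K (vector_derivative \<gamma> (at t)) = 1"
    and supp: "\<And>t x. x \<in> K \<Longrightarrow> 0 < cross2 (vector_derivative \<gamma> (at t)) (x - \<gamma> t)"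
    using \<gamma> by (auto simp: unit_gauge_param_def)
  obtain \<gamma>' \<gamma>'' where d: "\<And>t. (\<gamma> has_vector_derivative \<gamma>' t) (at t)" "\<And>t. (\<gamma>' has_vector_derivative \<gamma>'' t) (at t)"
    using C2 unfolding C2_closed_curve_def by blast
  have vd: "vector_derivative \<gamma> (at t) = \<gamma>' t" for t using d(1) by (rule vector_derivative_at)
  interpret closed_curve \<gamma> P using C2 by (rule C2_imp_closed_curve)
  have "unit_curve \<gamma> P \<gamma>' K"
    by unfold_locales (use K range d speed supp vd vector_derivative_continuous[OF d(2)] in auto)
  then show ?thesis by (rule that)
qed

text \<open>A supporting hyperplane exists by convexity. Its normal is orthogonal to the tangent vector, as the curve
stays on one side of it.\<close>

lemma tangent_line_supports:
  fixes \<gamma> :: "real \<Rightarrow> real^2"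
  assumes K: "open K" "convex K" and range: "\<And>s. \<gamma> s \<in> frontier K" and d: "(\<gamma> has_vector_derivative v) (at t)" and "v \<noteq> 0"
  shows "(\<forall>x\<in>K. 0 < cross2 v (x - \<gamma> t)) \<or> (\<forall>x\<in>K. cross2 v (x - \<gamma> t) < 0)"
proof (cases "K = {}")
  case False
  have "rel_interior K = K" using K False by (simp add: rel_interior_open)
  then have "\<gamma> s \<in> closure K" "\<gamma> s \<notin> rel_interior K" for s
    using range[of s] K by (auto simp: frontier_def interior_open)
  then obtain a where a: "a \<noteq> 0" "\<And>y. y \<in> closure K \<Longrightarrow> a \<bullet> \<gamma> t \<le> a \<bullet> y" "\<And>y. y \<in> K \<Longrightarrow> a \<bullet> \<gamma> t < a \<bullet> y"
    using supporting_hyperplane_relative_frontier[OF K(2), of "\<gamma> t"] \<open>rel_interior K = K\<close> by metis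
  have "((\<lambda>s. a \<bullet> \<gamma> s) has_real_derivative a \<bullet> v) (at t)"
    unfolding has_real_derivative_iff_has_vector_derivative
    by (rule bounded_linear.has_vector_derivative[OF bounded_linear_inner_right d])
  then have "a \<bullet> v = 0"
    using a(2) \<open>\<And>s. \<gamma> s \<in> closure K\<close> by (intro DERIV_local_min[of "\<lambda>s. a \<bullet> \<gamma> s" _ t 1]) auto
  then have "cross2 (vector [- v$2, v$1]) a = 0" by (simp add: cross2_def inner_real2 algebra_simps)
  moreover have "vector [- v$2, v$1] \<noteq> (0::real^2)" using \<open>v \<noteq> 0\<close> by (auto simp: vec_eq_iff forall_2)
  ultimately obtain l where l: "a = l *\<^sub>R vector [- v$2, v$1]" using cross2_eq_0_imp_scaled by blast
  have "a \<bullet> w = l * cross2 v w" for w by (simp add: l inner_real2 cross2_def algebra_simps)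
  then have pos: "0 < l * cross2 v (x - \<gamma> t)" if "x \<in> K" for x
    using a(3)[OF that] by (metis inner_diff_right diff_gt_0_iff_gt)
  show ?thesis
  proof (cases "0 < l")
    case True
    then show ?thesis using pos by (simp add: zero_less_mult_iff)
  next
    case False
    then show ?thesis using pos by (metis zero_less_mult_iff)
  qed
qed simp

lemma C2_closed_curve_reverse:
  assumes "C2_closed_curve \<gamma> P"
  shows "C2_closed_curve (\<lambda>t. \<gamma> (- t)) P"
proof -
  interpret closed_curve \<gamma> P using assms by (rule C2_imp_closed_curve)
  obtain \<gamma>' \<gamma>'' where d: "\<And>t. (\<gamma> has_vector_derivative \<gamma>' t) (at t)" "\<And>t. (\<gamma>' has_vector_derivative \<gamma>'' t) (at t)"
    "continuous_on UNIV \<gamma>''" "\<And>t. \<gamma>' t \<noteq> 0"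
    using assms unfolding C2_closed_curve_def by blast
  have rev: "((\<lambda>t. f (- t)) has_vector_derivative - f' (- t)) (at t)"
    if "\<And>t. (f has_vector_derivative f' t) (at t)" for f f' :: "real \<Rightarrow> real^2" and t
  proof -
    have "(uminus has_vector_derivative (-1::real)) (at t)" by (auto intro!: derivative_eq_intros)
    from vector_diff_chain_at[OF this that] show ?thesis by (simp add: o_def)
  qed
  show ?thesis unfolding C2_closed_curve_def
  proof (intro conjI exI allI)
    show "0 < P" by (rule P_pos)
    show "\<gamma> (- (t + P)) = \<gamma> (- t)" for t using period[of "- t - P"] by simp
    show "inj_on (\<lambda>t. \<gamma> (- t)) {0..<P}"
    proof (rule inj_onI)
      fix x y assume xy: "x \<in> {0..<P}" "y \<in> {0..<P}" "\<gamma> (- x) = \<gamma> (- y)"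
      show "x = y" using curve_neq[of "-x" "-y"] curve_neq[of "-y" "-x"] xy
        by (cases x y rule: linorder_cases) auto
    qed
    show "((\<lambda>t. \<gamma> (- t)) has_vector_derivative - \<gamma>' (- t)) (at t)" for t by (rule rev[OF d(1)])
    show "((\<lambda>t. - \<gamma>' (- t)) has_vector_derivative \<gamma>'' (- t)) (at t)" for t
      using has_vector_derivative_minus[OF rev[OF d(2)]] by simp
    show "continuous_on UNIV (\<lambda>t. \<gamma>'' (- t))"
      by (rule continuous_on_compose2[OF d(3)]) (auto intro: continuous_intros)
    show "- \<gamma>' (- t) \<noteq> 0" for t using d(4) by simp
  qed
qed

text \<open>Reparametrization by the arc length \<open>\<Lambda>\<close> in the gauge. The gauge is
\<open>C\<^sup>1\<close> off the origin and \<open>\<gamma>'\<close> is \<open>C\<^sup>1\<close>, so the speed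
is \<open>C\<^sup>1\<close> and the new parametrization is again \<open>C\<^sup>2\<close>.\<close>

lemma (in convex_curve) ex_unit_gauge_param:
  assumes d2: "\<And>t. (\<gamma>' has_vector_derivative \<gamma>'' t) (at t)" and c2: "continuous_on UNIV \<gamma>''"
  shows "\<exists>\<gamma> Q. unit_gauge_param K \<gamma> Q"
proof -
  define v where "v t = g (\<gamma>' t)" for t
  have nz: "\<gamma>' t \<noteq> 0" for t using cross2_curve_pos[of t] by (auto simp: cross2_def)
  have v_pos: "0 < v t" for t using gauge_pos[OF nz] by (simp add: v_def)
  define v' where "v' t = grad (\<gamma>' t) \<bullet> \<gamma>'' t" for t
  have dv: "(v has_real_derivative v' t) (at t)" for t
    unfolding v_def v'_def by (rule gauge_comp_has_derivative[OF d2 nz])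
  have cv: "isCont v t" for t using dv by (rule DERIV_isCont)
  have cv': "continuous_on UNIV v'" unfolding v'_def
    using nz by (intro continuous_intros c2 continuous_on_compose2[OF continuous_grad continuous_deriv]) auto
  obtain \<Lambda> where d\<Lambda>: "\<And>t. (\<Lambda> has_real_derivative v t) (at t)"
    using einterval_antiderivative[of "-\<infinity>" \<infinity> v] cv by (auto simp: has_real_derivative_iff_has_vector_derivative)
  have c\<Lambda>: "isCont \<Lambda> t" for t using d\<Lambda> by (rule DERIV_isCont)
  have mono: "\<Lambda> t < \<Lambda> u" if "t < u" for t u
    using DERIV_pos_imp_increasing[OF that] d\<Lambda> v_pos by blast
  define Q where "Q = \<Lambda> P - \<Lambda> 0"
  have "0 < Q" using mono[OF P_pos] by (simp add: Q_def)
  have \<Lambda>P: "\<Lambda> (t + P) = \<Lambda> t + Q" for t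
  proof -
    have "((\<lambda>t. \<Lambda> (t + P) - \<Lambda> t) has_real_derivative 0) (at t)" for t
    proof -
      have "((\<lambda>t. \<Lambda> (t + P) - \<Lambda> t) has_real_derivative v (t + P) - v t) (at t)"
        by (intro DERIV_diff DERIV_shift[THEN iffD1] d\<Lambda>)
      then show ?thesis using deriv_period[of t 1] by (simp add: v_def)
    qed
    then have "\<Lambda> (t + P) - \<Lambda> t = \<Lambda> (0 + P) - \<Lambda> 0"
      using DERIV_isconst_all[of "\<lambda>t. \<Lambda> (t + P) - \<Lambda> t" t 0] by blast
    then show ?thesis by (simp add: Q_def)
  qed
  have \<Lambda>nP: "\<Lambda> (t + of_nat n * P) = \<Lambda> t + of_nat n * Q" for t n
  proof (induction n)
    case (Suc n)
    have "\<Lambda> (t + of_nat (Suc n) * P) = \<Lambda> ((t + of_nat n * P) + P)" by (simp add: algebra_simps)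
    then show ?case unfolding \<Lambda>P Suc by (simp add: algebra_simps)
  qed simp
  have "\<exists>t. \<Lambda> t = s" for s
  proof -
    obtain n :: nat where n: "\<bar>s - \<Lambda> 0\<bar> < of_nat n * Q" using reals_Archimedean3[OF \<open>0 < Q\<close>] by blast
    have "\<Lambda> (0 + of_nat n * P) = \<Lambda> 0 + of_nat n * Q" "\<Lambda> (- (of_nat n * P)) = \<Lambda> 0 - of_nat n * Q"
      using \<Lambda>nP[of 0 n] \<Lambda>nP[of "- (of_nat n * P)" n] by simp_all
    then have "\<Lambda> (- (of_nat n * P)) \<le> s" "s \<le> \<Lambda> (of_nat n * P)" using n by auto
    moreover have "- (of_nat n * P) \<le> of_nat n * P" using P_pos by simp
    ultimately show ?thesis using IVT[of \<Lambda> "- (of_nat n * P)" s "of_nat n * P"] c\<Lambda> by blast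
  qed
  then obtain \<mu> where \<mu>: "\<And>s. \<Lambda> (\<mu> s) = s" by metis
  have inj\<Lambda>: "\<Lambda> t = \<Lambda> u \<Longrightarrow> t = u" for t u using mono[of t u] mono[of u t] by (cases t u rule: linorder_cases) auto
  have \<mu>\<Lambda>: "\<mu> (\<Lambda> t) = t" for t using inj\<Lambda> \<mu> by blast
  have c\<mu>: "isCont \<mu> s" for s using isCont_inverse_function[of 1 "\<mu> s" \<mu> \<Lambda>] \<mu>\<Lambda> c\<Lambda> \<mu> by simp
  have d\<mu>: "(\<mu> has_real_derivative inverse (v (\<mu> s))) (at s)" for s
    using d\<Lambda>[of "\<mu> s"] v_pos[of "\<mu> s"] \<mu> c\<mu> by (intro DERIV_inverse_function[where f = \<Lambda> and g = \<mu> and a = "s - 1" and b = "s + 1"]) auto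
  have c\<mu>': "continuous_on UNIV \<mu>" using c\<mu> by (simp add: continuous_at_imp_continuous_on)
  define \<delta> where "\<delta> s = \<gamma> (\<mu> s)" for s
  define \<delta>' where "\<delta>' s = inverse (v (\<mu> s)) *\<^sub>R \<gamma>' (\<mu> s)" for s
  define w where "w s = inverse (v (\<mu> s))" for s
  define \<delta>'' where "\<delta>'' s = w s *\<^sub>R (w s *\<^sub>R \<gamma>'' (\<mu> s)) + (- (w s * (v' (\<mu> s) * w s) * w s)) *\<^sub>R \<gamma>' (\<mu> s)" for s
  have chain: "((\<lambda>s. f (\<mu> s)) has_vector_derivative w s *\<^sub>R f' (\<mu> s)) (at s)"
    if "\<And>t. (f has_vector_derivative f' t) (at t)" for f f' :: "real \<Rightarrow> real^2" and s
    using vector_diff_chain_at[OF d\<mu>[unfolded has_real_derivative_iff_has_vector_derivative] that]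
    by (simp add: o_def w_def)
  have dw: "(w has_real_derivative - (w s * (v' (\<mu> s) * w s) * w s)) (at s)" for s
  proof -
    have "((\<lambda>s. v (\<mu> s)) has_real_derivative v' (\<mu> s) * w s) (at s)"
      unfolding w_def by (rule DERIV_chain2[OF dv d\<mu>])
    from DERIV_inverse'[OF this] show ?thesis using v_pos[of "\<mu> s"] by (simp add: w_def[abs_def])
  qed
  have d\<delta>: "(\<delta> has_vector_derivative \<delta>' s) (at s)" for s
    using chain[OF deriv] by (simp add: \<delta>_def[abs_def] \<delta>'_def w_def)
  have d\<delta>': "(\<delta>' has_vector_derivative \<delta>'' s) (at s)" for s
  proof -
    have "((\<lambda>s. w s *\<^sub>R \<gamma>' (\<mu> s)) has_vector_derivative \<delta>'' s) (at s)"
      unfolding \<delta>''_def by (rule has_vector_derivative_scaleR[OF dw chain[OF d2]])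
    then show ?thesis by (simp add: \<delta>'_def[abs_def] w_def)
  qed
  have comp: "continuous_on UNIV (\<lambda>s. f (\<mu> s))" if "continuous_on UNIV f" for f :: "real \<Rightarrow> 'a::topological_space"
    by (rule continuous_on_compose2[OF that c\<mu>']) auto
  have "continuous_on UNIV v" using cv by (simp add: continuous_at_imp_continuous_on)
  then have cw: "continuous_on UNIV w" unfolding w_def
    using v_pos comp by (intro continuous_on_inverse) (auto simp: less_le)
  have "continuous_on UNIV \<delta>''" unfolding \<delta>''_def
    by (intro continuous_intros cw comp[OF c2] comp[OF cv'] comp[OF continuous_deriv])
  have \<mu>Q: "\<mu> (s + Q) = \<mu> s + P" for s using inj\<Lambda>[of "\<mu> (s + Q)" "\<mu> s + P"] \<mu> \<Lambda>P by simp
  have \<mu>_less: "\<mu> s < \<mu> u \<longleftrightarrow> s < u" for s u using mono \<mu> by (metis less_irrefl less_trans linorder_neqE)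
  have "C2_closed_curve \<delta> Q" unfolding C2_closed_curve_def
  proof (intro conjI exI allI)
    show "0 < Q" by fact
    show "\<delta> (s + Q) = \<delta> s" for s by (simp add: \<delta>_def \<mu>Q period)
    show "inj_on \<delta> {0..<Q}"
    proof (rule inj_onI)
      fix x y assume xy: "x \<in> {0..<Q}" "y \<in> {0..<Q}" "\<delta> x = \<delta> y"
      have "\<mu> y < \<mu> x + P" "\<mu> x < \<mu> y + P" using xy unfolding \<mu>Q[symmetric] \<mu>_less by auto
      then show "x = y"
        using curve_neq[of "\<mu> x" "\<mu> y"] curve_neq[of "\<mu> y" "\<mu> x"] xy
        by (cases x y rule: linorder_cases) (auto simp: \<mu>_less \<delta>_def)
    qed
    show "(\<delta> has_vector_derivative \<delta>' s) (at s)" for s by (rule d\<delta>)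
    show "(\<delta>' has_vector_derivative \<delta>'' s) (at s)" for s by (rule d\<delta>')
    show "continuous_on UNIV \<delta>''" by fact
    show "\<delta>' s \<noteq> 0" for s using v_pos[of "\<mu> s"] nz by (simp add: \<delta>'_def)
  qed
  moreover have "range \<delta> = frontier K"
  proof -
    have "\<gamma> t = \<delta> (\<Lambda> t)" for t by (simp add: \<delta>_def \<mu>\<Lambda>)
    then show ?thesis unfolding range_curve[symmetric] by (auto simp: \<delta>_def)
  qed
  moreover have "g (\<delta>' s) = 1" for s
    using gauge_scale[OF _ nz, of "inverse (v (\<mu> s))" "\<mu> s"] v_pos[of "\<mu> s"] by (simp add: \<delta>'_def v_def)
  moreover have "0 < cross2 (\<delta>' s) (x - \<delta> s)" if "x \<in> K" for x s
  proof -
    have "cross2 (\<delta>' s) (x - \<delta> s) = inverse (v (\<mu> s)) * cross2 (\<gamma>' (\<mu> s)) (x - \<gamma> (\<mu> s))"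
      by (simp add: \<delta>'_def \<delta>_def cross2_def algebra_simps)
    then show ?thesis using supporting[OF that, of "\<mu> s"] v_pos[of "\<mu> s"] by simp
  qed
  moreover have "vector_derivative \<delta> (at s) = \<delta>' s" for s using d\<delta> by (rule vector_derivative_at)
  ultimately have "unit_gauge_param K \<delta> Q" by (simp add: unit_gauge_param_def)
  then show ?thesis by blast
qed

text \<open>The side of the tangent line on which \<open>K\<close> lies cannot change along the curve, since the cross
product of position and velocity has no zero. If \<open>K\<close> lies on the right, the curve is reversed.\<close>

lemma strictly_convex_curve_ex_unit_gauge_param:
  assumes "strictly_convex_C2_curve \<gamma> P" and "0 \<in> inside (range \<gamma>)"
  shows "\<exists>\<delta> Q. unit_gauge_param (inside (range \<gamma>)) \<delta> Q"
proof -
  define K where "K = inside (range \<gamma>)"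
  note K = strictly_convex_curve_inside[OF assms(1), folded K_def]
  have "0 \<in> K" using assms(2) by (simp add: K_def)
  have C2: "C2_closed_curve \<gamma> P" using assms(1) by (simp add: strictly_convex_C2_curve_def)
  have positive: "\<exists>\<delta> Q. unit_gauge_param K \<delta> Q"
    if C2: "C2_closed_curve \<alpha> P" and range: "range \<alpha> = frontier K"
      and d: "\<And>t. (\<alpha> has_vector_derivative \<alpha>' t) (at t)" and supp: "\<And>t x. x \<in> K \<Longrightarrow> 0 < cross2 (\<alpha>' t) (x - \<alpha> t)" for \<alpha> \<alpha>'
  proof -
    obtain \<beta> \<alpha>'' where d2: "\<And>t. (\<alpha> has_vector_derivative \<beta> t) (at t)" "\<And>t. (\<beta> has_vector_derivative \<alpha>'' t) (at t)" "continuous_on UNIV \<alpha>''"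
      using C2 unfolding C2_closed_curve_def by blast
    have "\<beta> = \<alpha>'" using d d2(1) vector_derivative_unique_at by blast
    interpret closed_curve \<alpha> P using C2 by (rule C2_imp_closed_curve)
    interpret convex_curve \<alpha> P \<alpha>' K
      by unfold_locales
        (use K \<open>0 \<in> K\<close> range d supp vector_derivative_continuous[OF d2(2)] \<open>\<beta> = \<alpha>'\<close> in auto)
    show ?thesis using ex_unit_gauge_param d2 \<open>\<beta> = \<alpha>'\<close> by blast
  qed
  obtain \<gamma>' \<gamma>'' where d: "\<And>t. (\<gamma> has_vector_derivative \<gamma>' t) (at t)" "\<And>t. (\<gamma>' has_vector_derivative \<gamma>'' t) (at t)" "\<And>t. \<gamma>' t \<noteq> 0"
    using C2 unfolding C2_closed_curve_def by blast
  have side: "(\<forall>x\<in>K. 0 < cross2 (\<gamma>' t) (x - \<gamma> t)) \<or> (\<forall>x\<in>K. cross2 (\<gamma>' t) (x - \<gamma> t) < 0)" for t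
    using K(6) by (intro tangent_line_supports[OF K(1,2) _ d(1,3)]) auto
  define D where "D t = cross2 (\<gamma>' t) (0 - \<gamma> t)" for t
  have D_nz: "D t \<noteq> 0" for t using side[of t] \<open>0 \<in> K\<close> by (force simp: D_def)
  have "continuous_on UNIV \<gamma>" "continuous_on UNIV \<gamma>'" using d vector_derivative_continuous by blast+
  then have cD: "continuous_on UNIV D" unfolding D_def cross2_def by (intro continuous_intros)
  have "(\<forall>t. 0 < D t) \<or> (\<forall>t. D t < 0)"
  proof (rule ccontr)
    assume "\<not> ?thesis"
    then obtain s u where "D s < 0" "0 < D u" using D_nz by (meson linorder_neqE_linordered_idom)
    moreover have "connected (range D)" using cD connected_UNIV by (rule connected_continuous_image)
    ultimately have "0 \<in> range D" unfolding connected_iff_interval by (metis less_imp_le rangeI)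
    then show False using D_nz by auto
  qed
  then have "\<exists>\<delta> Q. unit_gauge_param K \<delta> Q"
  proof
    assume "\<forall>t. 0 < D t"
    then have "0 < cross2 (\<gamma>' t) (x - \<gamma> t)" if "x \<in> K" for t x
      using side[of t] that \<open>0 \<in> K\<close> unfolding D_def by (meson less_asym)
    then show "\<exists>\<delta> Q. unit_gauge_param K \<delta> Q" using positive[OF C2 K(6)[symmetric] d(1)] by blast
  next
    assume neg: "\<forall>t. D t < 0"
    have "0 < cross2 (- \<gamma>' (- t)) (x - \<gamma> (- t))" if "x \<in> K" for t x
    proof -
      have "cross2 (\<gamma>' (- t)) (x - \<gamma> (- t)) < 0"
        using side[of "- t"] that \<open>0 \<in> K\<close> neg unfolding D_def by (meson less_asym)
      then show ?thesis by (simp add: cross2_def algebra_simps)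
    qed
    moreover have "((\<lambda>t. \<gamma> (- t)) has_vector_derivative - \<gamma>' (- t)) (at t)" for t
    proof -
      have "(uminus has_vector_derivative (-1::real)) (at t)" by (auto intro!: derivative_eq_intros)
      from vector_diff_chain_at[OF this d(1)] show ?thesis by (simp add: o_def)
    qed
    moreover have "range (\<lambda>t. \<gamma> (- t)) = frontier K"
    proof -
      have "\<gamma> t = \<gamma> (- (- t))" for t by simp
      then show ?thesis unfolding K(6) by blast
    qed
    ultimately show "\<exists>\<delta> Q. unit_gauge_param K \<delta> Q" using positive[OF C2_closed_curve_reverse[OF C2], of "\<lambda>t. - \<gamma>' (- t)"] by blast
  qed
  then show ?thesis by (simp add: K_def)
qed

section \<open>The characterization\<close>

theorem theorem4:
  fixes \<gamma> :: "real \<Rightarrow> real^2" and P :: real and K :: "(real^2) set"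
    and A :: "real^2 \<Rightarrow> real^2" and k a :: nat
  assumes "k \<ge> 3"
    and "strictly_convex_C2_curve \<gamma> P"
    and "K = inside (range \<gamma>)"
    and "linear A" and "map_order A k" and "A ` K = K"
    and "a = (if k mod 4 = 2 then 1 else if k mod 4 = 0 then 2 else 4)"
  shows "(has_periodic_curve K k \<longrightarrow>
            (\<exists>B. linear B \<and> map_order B (a * k) \<and> B ` K = K \<and> A \<circ> B = B \<circ> A)) \<and>
         ((\<exists>B. linear B \<and> map_order B (a * k) \<and> B ` K = K \<and> A \<circ> B = B \<circ> A) \<longrightarrow>
            (\<forall>r::nat. 0 < r \<and> r < k \<and> coprime r k \<longrightarrow>
               has_periodic_curve_rot K k (real r / real k)))"
proof -
  note K = strictly_convex_curve_inside[OF assms(2), folded assms(3)]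
  obtain J \<zeta> where J: "complex_structure J" and A: "A = complex_structure.act J \<zeta>"
    and commuting: "\<And>B. \<lbrakk>linear B; A \<circ> B = B \<circ> A\<rbrakk> \<Longrightarrow> \<exists>\<beta>. B = complex_structure.act J \<beta>"
    by (rule finite_order_imp_act[OF assms(4,1,5)]) blast
  interpret complex_structure J by (rule J)
  have \<zeta>: "is_primitive_root k \<zeta>" using assms(5) unfolding A map_order_act is_primitive_root_def .
  have inv: "act \<zeta> ` K = K" using assms(6) unfolding A .
  have "0 \<in> K" using zero_in_invariant_convex_set[OF K(2,4) inv \<zeta> assms(1)] .
  have symmetric: "\<exists>\<delta>'. symmetric_curve \<delta> Q \<delta>' K J \<zeta> k" if \<delta>: "unit_gauge_param K \<delta> Q" for \<delta> Q
  proof -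
    obtain \<delta>' where "unit_curve \<delta> Q \<delta>' K"
      using unit_gauge_param_imp_unit_curve[OF K(1-3) \<open>0 \<in> K\<close> K(5) \<delta>] .
    then have "symmetric_curve \<delta> Q \<delta>' K J \<zeta> k"
      using J \<zeta> assms(1) inv by (simp add: symmetric_curve_def symmetric_curve_axioms_def)
    then show ?thesis by blast
  qed
  show ?thesis
  proof (intro conjI impI allI)
    assume "has_periodic_curve K k"
    then obtain \<delta> Q C where \<delta>: "unit_gauge_param K \<delta> Q" and C: "curve_of_periodic_orbits K \<delta> k C"
      unfolding has_periodic_curve_def by blast
    obtain \<delta>' where "symmetric_curve \<delta> Q \<delta>' K J \<zeta> k" using symmetric[OF \<delta>] by blast
    then obtain z where z: "map_order (act z) (a * k)" "act z ` K = K"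
      using symmetric_curve.periodic_curve_imp_symmetry[OF _ C assms(7)] by blast
    have "A \<circ> act z = act z \<circ> A"
      unfolding A fun_eq_iff by (simp add: mult.commute flip: act_mult)
    then show "\<exists>B. linear B \<and> map_order B (a * k) \<and> B ` K = K \<and> A \<circ> B = B \<circ> A"
      using z linear_act by blast
  next
    fix r :: nat
    assume "\<exists>B. linear B \<and> map_order B (a * k) \<and> B ` K = K \<and> A \<circ> B = B \<circ> A" and r: "0 < r \<and> r < k \<and> coprime r k"
    then obtain \<beta> where \<beta>: "map_order (act \<beta>) (a * k)" "act \<beta> ` K = K" using commuting by blast
    then have "is_primitive_root (a * k) \<beta>" unfolding map_order_act is_primitive_root_def by blast
    obtain \<delta> Q where \<delta>: "unit_gauge_param K \<delta> Q"
      using strictly_convex_curve_ex_unit_gauge_param[OF assms(2)] \<open>0 \<in> K\<close> assms(3) by blast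
    obtain \<delta>' where "symmetric_curve \<delta> Q \<delta>' K J \<zeta> k" using symmetric[OF \<delta>] by blast
    then obtain C where "curve_of_periodic_orbits K \<delta> k C" "has_rotation_number K \<delta> Q C (real r / real k)"
      using symmetric_curve.symmetry_imp_periodic_curve[OF _ assms(7) \<open>is_primitive_root (a * k) \<beta>\<close> \<beta>(2)] r by blast
    then show "has_periodic_curve_rot K k (real r / real k)"
      using \<delta> unfolding has_periodic_curve_rot_def by blast
  qed
qed

end
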